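(* Let $p$ be a prime, let $F$ be a field of characteristic $p$, and let $G$ and $H$ be finite $p$-groups. Let $G=T\times U$ and $H=S\times V$ be elementary decompositions of $G$ and $H$, with $T$ and $S$ elementary abelian. Then the following are equivalent: (1) $FG\cong FH$ as $F$-algebras. (2) $FT\cong FS$ and $FU\cong FV$ as $F$-algebras.
   Context: For a finite $p$-group $X$, $\Phi(X)$ denotes the Frattini subgroup and $\Psi(X)$ the socle, i.e. the subgroup generated by the central elements of order $p$. A decomposition $G=T\times U$ of a finite $p$-group $G$ as internal direct product of subgroups $T$ and $U$ is called elementary if both of the following hold: (i) $T\cap\Phi(G)=1$ and $|T|=|\Psi(G):\Psi(G)\cap\Phi(G)|$; (ii) $\Psi(G)U=G$ and $|U|=|G|/|\Psi(G):\Psi(G)\cap\Phi(G)|$. $FX$ denotes the group algebra of $X$ over $F$. *)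

theory Defs
  imports "HOL-Algebra.Algebra"
begin

section \<open>Finite p-groups, Frattini subgroup and socle\<close>

text \<open>\<^const>\<open>order\<close> is 0 on infinite carriers, so finiteness is implied by the order being a
  power of a prime.\<close>

definition finite_p_group :: "nat \<Rightarrow> ('a, 'c) monoid_scheme \<Rightarrow> bool" where
  "finite_p_group p G \<longleftrightarrow> group G \<and> (\<exists>n. order G = p ^ n)"

definition elementary_abelian :: "nat \<Rightarrow> ('a, 'c) monoid_scheme \<Rightarrow> bool" where
  "elementary_abelian p G \<longleftrightarrow>
     comm_group G \<and> (\<forall>x \<in> carrier G. x [^]\<^bsub>G\<^esub> p = \<one>\<^bsub>G\<^esub>)"

definition maximal_subgroup :: "'a set \<Rightarrow> ('a, 'c) monoid_scheme \<Rightarrow> bool" where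
  "maximal_subgroup M G \<longleftrightarrow> subgroup M G \<and> M \<noteq> carrier G \<and>
     (\<forall>K. subgroup K G \<and> M \<subseteq> K \<longrightarrow> K = M \<or> K = carrier G)"

text \<open>The intersection with the carrier only matters for a group without maximal subgroups,
  such as the trivial group, which is then its own Frattini subgroup.\<close>

definition frattini :: "('a, 'c) monoid_scheme \<Rightarrow> 'a set" where
  "frattini G = carrier G \<inter> \<Inter> {M. maximal_subgroup M G}"

definition center :: "('a, 'c) monoid_scheme \<Rightarrow> 'a set" where
  "center G = {z \<in> carrier G. \<forall>x \<in> carrier G. z \<otimes>\<^bsub>G\<^esub> x = x \<otimes>\<^bsub>G\<^esub> z}"

definition socle :: "nat \<Rightarrow> ('a, 'c) monoid_scheme \<Rightarrow> 'a set" where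
  "socle p G = generate G {z \<in> center G. group.ord G z = p}"


section \<open>Elementary decompositions\<close>

definition internal_direct_product ::
    "('a, 'c) monoid_scheme \<Rightarrow> 'a set \<Rightarrow> 'a set \<Rightarrow> bool" where
  "internal_direct_product G T U \<longleftrightarrow>
     T \<lhd> G \<and> U \<lhd> G \<and> T \<inter> U = {\<one>\<^bsub>G\<^esub>} \<and> T <#>\<^bsub>G\<^esub> U = carrier G"

definition subgroup_index :: "('a, 'c) monoid_scheme \<Rightarrow> 'a set \<Rightarrow> 'a set \<Rightarrow> nat" where
  "subgroup_index G A B = card (rcosets\<^bsub>G\<lparr>carrier := A\<rparr>\<^esub> B)"

text \<open>The \<open>div\<close> below is an exact division: for finite \<open>G\<close> the index divides the order of the
  socle, hence the order of \<open>G\<close>.\<close>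

definition elementary_decomposition ::
    "nat \<Rightarrow> ('a, 'c) monoid_scheme \<Rightarrow> 'a set \<Rightarrow> 'a set \<Rightarrow> bool" where
  "elementary_decomposition p G T U \<longleftrightarrow>
     internal_direct_product G T U \<and>
     T \<inter> frattini G = {\<one>\<^bsub>G\<^esub>} \<and>
     card T = subgroup_index G (socle p G) (socle p G \<inter> frattini G) \<and>
     socle p G <#>\<^bsub>G\<^esub> U = carrier G \<and>
     card U = order G div subgroup_index G (socle p G) (socle p G \<inter> frattini G)"


section \<open>Group algebras and algebra isomorphisms\<close>

text \<open>The additive order of \<open>1\<close>; \<^const>\<open>group.ord\<close> is 0 for elements of infinite order, so this
  is 0 in characteristic zero.\<close>

definition ring_char :: "('f, 'm) ring_scheme \<Rightarrow> nat" where
  "ring_char F = group.ord (add_monoid F) \<one>\<^bsub>F\<^esub>"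

text \<open>The group algebra of a finite group \<open>G\<close>: the element \<open>\<Sum>x. f x \<cdot> x\<close> is represented by its
  coefficient function \<open>f\<close>, taken extensional so that equality of elements is equality of
  functions. For infinite \<open>G\<close> one would have to require finite support; this is not done here.\<close>

definition group_algebra ::
    "('f, 'm) ring_scheme \<Rightarrow> ('a, 'c) monoid_scheme \<Rightarrow> ('f, 'a \<Rightarrow> 'f) module" where
  "group_algebra F G =
     \<lparr>carrier = carrier G \<rightarrow>\<^sub>E carrier F,
      monoid.mult = (\<lambda>f g. \<lambda>x \<in> carrier G.
        \<Oplus>\<^bsub>F\<^esub>y \<in> carrier G. f y \<otimes>\<^bsub>F\<^esub> g (inv\<^bsub>G\<^esub> y \<otimes>\<^bsub>G\<^esub> x)),
      monoid.one = (\<lambda>x \<in> carrier G. if x = \<one>\<^bsub>G\<^esub> then \<one>\<^bsub>F\<^esub> else \<zero>\<^bsub>F\<^esub>),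
      ring.zero = (\<lambda>x \<in> carrier G. \<zero>\<^bsub>F\<^esub>),
      ring.add = (\<lambda>f g. \<lambda>x \<in> carrier G. f x \<oplus>\<^bsub>F\<^esub> g x),
      module.smult = (\<lambda>a f. \<lambda>x \<in> carrier G. a \<otimes>\<^bsub>F\<^esub> f x)\<rparr>"

text \<open>The locale \<^locale>\<open>algebra\<close> covers commutative algebras only, so an isomorphism of algebras
  is a (unital) ring isomorphism that is compatible with the scalar multiplications.\<close>

definition algebra_iso ::
    "('f, 'm) ring_scheme \<Rightarrow> ('f, 'x, 'k) module_scheme \<Rightarrow> ('f, 'y, 'l) module_scheme \<Rightarrow>
     ('x \<Rightarrow> 'y) set" where
  "algebra_iso F A B = {h \<in> ring_iso A B.
     \<forall>a \<in> carrier F. \<forall>x \<in> carrier A. h (a \<odot>\<^bsub>A\<^esub> x) = a \<odot>\<^bsub>B\<^esub> h x}"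

definition algebra_isomorphic ::
    "('f, 'm) ring_scheme \<Rightarrow> ('f, 'x, 'k) module_scheme \<Rightarrow> ('f, 'y, 'l) module_scheme \<Rightarrow>
     bool" where
  "algebra_isomorphic F A B \<longleftrightarrow> algebra_iso F A B \<noteq> {}"

end

theory Submission
  imports Defs
begin

text \<open>
  Write \<open>I(X)\<close> for the augmentation ideal of \<open>FX\<close>, the kernel of the sum of the coefficients.

  From the factors to the product: \<open>FG\<close> is the tensor product of \<open>FT\<close> and \<open>FU\<close>, so homomorphisms
  \<open>f : FT \<rightarrow> FS\<close> and \<open>f' : FU \<rightarrow> FV\<close> extend to \<open>FG \<rightarrow> FH\<close> linearly from \<open>t u \<mapsto> f(t) f'(u)\<close>
  (\<open>product_map\<close>); this is multiplicative because \<open>S\<close> is central in \<open>H\<close>. Inverse pairs on the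
  factors give an inverse pair on the products.

  From the product to the factors: let \<open>h : FG \<rightarrow> FH\<close> be an isomorphism with inverse \<open>k\<close>. Composing
  \<open>h\<close> and \<open>k\<close> with the inclusions and projections of the two direct products gives homomorphisms
  between \<open>FT\<close> and \<open>FS\<close> in both directions, and likewise between \<open>FU\<close> and \<open>FV\<close>. They need not be
  inverse to each other, but their composites are the identity modulo the square of the augmentation
  ideal (\<open>left_unipotent\<close>, \<open>right_unipotent\<close>). Such an endomorphism acts trivially on every quotient
  \<open>I\<^sup>n / I\<^sup>n\<^sup>+\<^sup>1\<close>, and \<open>I\<close> is nilpotent for a p-group in characteristic \<open>p\<close>
  (\<open>augmentation_ideal_nilpotent\<close>), so the composites are bijective (\<open>unipotent_bij\<close>) and the
  homomorphisms between the factors are isomorphisms.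

  That the composites are unipotent follows once \<open>h\<close> maps \<open>I(T)\<close> into \<open>I(S) + I(H)\<^sup>2\<close>, and \<open>k\<close> maps
  \<open>I(S)\<close> into \<open>I(T) + I(G)\<^sup>2\<close> (\<open>h_linear_part\<close>). Since \<open>T\<close> is central and elementary abelian, an
  element of \<open>I(T)\<close> is central in \<open>FG\<close> with p-th power zero, and so is its image \<open>b\<close> in \<open>FH\<close>. For
  every such \<open>b\<close> one argues as follows (\<open>central_linear_part\<close>, \<open>central_p_nilpotent\<close>).
  \<^item> Modulo \<open>I(H)\<^sup>2\<close> the element \<open>g - 1\<close> depends additively on \<open>g\<close>. Conjugate group elements
    therefore contribute equally to \<open>b\<close>, and as the classes outside the center \<open>Z\<close> have size divisible
    by \<open>p\<close>, only the coefficients at central group elements matter.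
  \<^item> By the same count restriction to \<open>Z\<close> is multiplicative on central elements of \<open>FH\<close>. So the
    restriction of \<open>b\<close> to the commutative algebra \<open>FZ\<close> has p-th power zero, and by the Frobenius
    homomorphism its coefficients sum to zero over each fibre of \<open>z \<mapsto> z\<^sup>p\<close>.
  \<^item> The nonempty fibres are cosets of the group of all \<open>z\<close> in \<open>Z\<close> with \<open>z\<^sup>p = 1\<close>, the socle. Hence \<open>b\<close> is
    congruent to a combination of elements \<open>w - 1\<close> with \<open>w\<close> in the socle.
  \<^item> By the elementary decomposition each such \<open>w\<close> is \<open>s d\<close> with \<open>s\<close> in \<open>S\<close> and \<open>d\<close> in the Frattini
    subgroup (\<open>elementary_decomposition_socle\<close>), and \<open>d - 1\<close> lies in \<open>I(H)\<^sup>2\<close>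
    (\<open>linear_part_frattini\<close>), so \<open>w - 1\<close> may be replaced by \<open>s - 1\<close>.
\<close>

section \<open>Finite sums in abelian groups\<close>

lemma (in abelian_monoid) finsum_swap:
  assumes "finite A" "finite B" and f: "\<And>x y. x \<in> A \<Longrightarrow> y \<in> B \<Longrightarrow> f x y \<in> carrier G"
  shows "(\<Oplus>x\<in>A. \<Oplus>y\<in>B. f x y) = (\<Oplus>y\<in>B. \<Oplus>x\<in>A. f x y)"
  using assms(1) f
proof (induction A)
  case empty
  then show ?case by simp
next
  case (insert a A)
  have "(\<Oplus>x\<in>insert a A. \<Oplus>y\<in>B. f x y) = (\<Oplus>y\<in>B. f a y) \<oplus> (\<Oplus>x\<in>A. \<Oplus>y\<in>B. f x y)"
    using insert by (intro finsum_insert) (auto intro!: finsum_closed)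
  also have "\<dots> = (\<Oplus>y\<in>B. f a y) \<oplus> (\<Oplus>y\<in>B. \<Oplus>x\<in>A. f x y)"
    using insert by simp
  also have "\<dots> = (\<Oplus>y\<in>B. f a y \<oplus> (\<Oplus>x\<in>A. f x y))"
    using insert by (intro finsum_addf[symmetric]) (auto intro!: finsum_closed)
  also have "\<dots> = (\<Oplus>y\<in>B. \<Oplus>x\<in>insert a A. f x y)"
    using insert by (intro finsum_cong' refl) (auto intro!: finsum_closed finsum_insert[symmetric])
  finally show ?case .
qed

lemma additive_finsum:
  assumes "abelian_monoid M" "abelian_monoid N"
    and h: "\<And>x. x \<in> carrier M \<Longrightarrow> h x \<in> carrier N" "h \<zero>\<^bsub>M\<^esub> = \<zero>\<^bsub>N\<^esub>"
      "\<And>x y. x \<in> carrier M \<Longrightarrow> y \<in> carrier M \<Longrightarrow> h (x \<oplus>\<^bsub>M\<^esub> y) = h x \<oplus>\<^bsub>N\<^esub> h y"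
    and f: "\<And>i. i \<in> I \<Longrightarrow> f i \<in> carrier M"
  shows "h (\<Oplus>\<^bsub>M\<^esub>i\<in>I. f i) = (\<Oplus>\<^bsub>N\<^esub>i\<in>I. h (f i))"
proof -
  interpret M: abelian_monoid M by fact
  interpret N: abelian_monoid N by fact
  show ?thesis
    using f
  proof (induction I rule: infinite_finite_induct)
    case (insert i I)
    then show ?case
      using h(1) by (simp add: M.finsum_insert N.finsum_insert Pi_def h(3) M.finsum_closed)
  qed (simp_all add: h(2))
qed

lemma (in abelian_monoid) finsum_fibres:
  assumes "finite A" "finite B" "\<And>x. x \<in> A \<Longrightarrow> h x \<in> B" "\<And>x. x \<in> A \<Longrightarrow> f x \<in> carrier G"
  shows "(\<Oplus>x\<in>A. f x) = (\<Oplus>y\<in>B. \<Oplus>x\<in>{x \<in> A. h x = y}. f x)"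
proof -
  have "A = (\<Union>y\<in>B. {x \<in> A. h x = y})" using assms(3) by blast
  then have "(\<Oplus>x\<in>A. f x) = (\<Oplus>x\<in>(\<Union>y\<in>B. {x \<in> A. h x = y}). f x)" by simp
  also have "\<dots> = (\<Oplus>y\<in>B. \<Oplus>x\<in>{x \<in> A. h x = y}. f x)"
    using assms by (intro add.finprod_UN_disjoint) (auto simp: pairwise_def disjnt_def)
  finally show ?thesis .
qed

lemma (in abelian_monoid) finsum_subset_zero:
  assumes "finite A" "B \<subseteq> A" "\<And>x. x \<in> A - B \<Longrightarrow> f x = \<zero>" "\<And>x. x \<in> B \<Longrightarrow> f x \<in> carrier G"
  shows "(\<Oplus>x\<in>A. f x) = (\<Oplus>x\<in>B. f x)"
  using assms by (intro add.finprod_mono_neutral_cong_right) (auto, metis zero_closed)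

lemma (in abelian_monoid) finsum_delta:
  assumes "finite A" "a \<in> A" "\<And>x. x \<in> A \<Longrightarrow> f x \<in> carrier G"
  shows "(\<Oplus>x\<in>A. if x = a then f x else \<zero>) = f a"
  using add.finprod_singleton_swap[of a A f] assms by auto

lemma (in abelian_group) finsum_minus:
  assumes "\<And>x. x \<in> A \<Longrightarrow> f x \<in> carrier G" "\<And>x. x \<in> A \<Longrightarrow> g x \<in> carrier G"
  shows "(\<Oplus>x\<in>A. f x) \<ominus> (\<Oplus>x\<in>A. g x) = (\<Oplus>x\<in>A. f x \<ominus> g x)"
proof -
  have "\<ominus> (\<Oplus>x\<in>A. g x) = (\<Oplus>x\<in>A. \<ominus> g x)"
    using assms by (intro additive_finsum[where h = "\<lambda>x. \<ominus> x"])
      (auto simp: minus_add intro: abelian_monoid_axioms)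
  moreover have "(\<Oplus>x\<in>A. f x \<oplus> \<ominus> g x) = (\<Oplus>x\<in>A. f x) \<oplus> (\<Oplus>x\<in>A. \<ominus> g x)"
    using assms by (intro finsum_addf) auto
  ultimately show ?thesis by (simp add: minus_eq)
qed

lemma (in abelian_group) finsum_in_subgroup:
  assumes "additive_subgroup J G" "\<And>x. x \<in> A \<Longrightarrow> f x \<in> J"
  shows "(\<Oplus>x\<in>A. f x) \<in> J"
  using assms(2)
proof (induction A rule: infinite_finite_induct)
  case (insert a A)
  then have "f a \<in> carrier G" "f \<in> A \<rightarrow> carrier G"
    using additive_subgroup.a_subset[OF assms(1)] by auto
  then show ?case
    using insert by (simp add: finsum_insert additive_subgroup.a_closed[OF assms(1)])
qed (simp_all add: additive_subgroup.zero_closed[OF assms(1)])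


section \<open>Group algebras\<close>

definition basis :: "('f, 'm) ring_scheme \<Rightarrow> ('a, 'c) monoid_scheme \<Rightarrow> 'a \<Rightarrow> 'a \<Rightarrow> 'f" where
  "basis F G g = (\<lambda>x \<in> carrier G. if x = g then \<one>\<^bsub>F\<^esub> else \<zero>\<^bsub>F\<^esub>)"

definition augmentation :: "('f, 'm) ring_scheme \<Rightarrow> ('a, 'c) monoid_scheme \<Rightarrow> ('a \<Rightarrow> 'f) \<Rightarrow> 'f" where
  "augmentation F G f = (\<Oplus>\<^bsub>F\<^esub>x\<in>carrier G. f x)"

definition linear_extension ::
    "('a, 'c) monoid_scheme \<Rightarrow> ('f, 'x, 'k) module_scheme \<Rightarrow> ('a \<Rightarrow> 'x) \<Rightarrow> ('a \<Rightarrow> 'f) \<Rightarrow> 'x" where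
  "linear_extension G B \<mu> f = (\<Oplus>\<^bsub>B\<^esub>g\<in>carrier G. f g \<odot>\<^bsub>B\<^esub> \<mu> g)"

text \<open>The group algebra of a nonabelian group is a noncommutative ring, so only the scalars are asked to
  commute with all elements.\<close>

locale unital_algebra = module F B + ring B for F (structure) and B (structure) +
  assumes smult_mult_left:
      "a \<in> carrier F \<Longrightarrow> x \<in> carrier B \<Longrightarrow> y \<in> carrier B \<Longrightarrow>
        (a \<odot>\<^bsub>B\<^esub> x) \<otimes>\<^bsub>B\<^esub> y = a \<odot>\<^bsub>B\<^esub> (x \<otimes>\<^bsub>B\<^esub> y)"
    and smult_mult_right:
      "a \<in> carrier F \<Longrightarrow> x \<in> carrier B \<Longrightarrow> y \<in> carrier B \<Longrightarrow>
        x \<otimes>\<^bsub>B\<^esub> (a \<odot>\<^bsub>B\<^esub> y) = a \<odot>\<^bsub>B\<^esub> (x \<otimes>\<^bsub>B\<^esub> y)"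

locale finite_group_algebra = F: field F + G: group G
  for F :: "('f, 'm) ring_scheme" and G :: "('a, 'c) monoid_scheme" +
  assumes finite_G: "finite (carrier G)"
begin

abbreviation A where "A \<equiv> group_algebra F G"

abbreviation \<delta> where "\<delta> \<equiv> basis F G"

abbreviation \<epsilon> where "\<epsilon> \<equiv> augmentation F G"

lemma elem_closed [simp, intro]: "f \<in> carrier A \<Longrightarrow> x \<in> carrier G \<Longrightarrow> f x \<in> carrier F"
  by (auto simp: group_algebra_def)

lemma elem_eqI:
  "f \<in> carrier A \<Longrightarrow> g \<in> carrier A \<Longrightarrow> (\<And>x. x \<in> carrier G \<Longrightarrow> f x = g x) \<Longrightarrow> f = g"
  by (auto simp: group_algebra_def intro: PiE_ext)

lemma add_apply: "x \<in> carrier G \<Longrightarrow> (f \<oplus>\<^bsub>A\<^esub> g) x = f x \<oplus>\<^bsub>F\<^esub> g x"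
  by (simp add: group_algebra_def)

lemma zero_apply: "x \<in> carrier G \<Longrightarrow> \<zero>\<^bsub>A\<^esub> x = \<zero>\<^bsub>F\<^esub>"
  by (simp add: group_algebra_def)

lemma smult_apply: "x \<in> carrier G \<Longrightarrow> (a \<odot>\<^bsub>A\<^esub> f) x = a \<otimes>\<^bsub>F\<^esub> f x"
  by (simp add: group_algebra_def)

lemma mult_apply:
  "x \<in> carrier G \<Longrightarrow>
    (f \<otimes>\<^bsub>A\<^esub> g) x = (\<Oplus>\<^bsub>F\<^esub>y\<in>carrier G. f y \<otimes>\<^bsub>F\<^esub> g (inv\<^bsub>G\<^esub> y \<otimes>\<^bsub>G\<^esub> x))"
  by (simp add: group_algebra_def)

lemma one_eq_basis: "\<one>\<^bsub>A\<^esub> = \<delta> \<one>\<^bsub>G\<^esub>"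
  by (simp add: group_algebra_def basis_def)

lemma basis_closed [simp, intro]: "\<delta> g \<in> carrier A"
  by (simp add: group_algebra_def basis_def)

lemma basis_apply: "x \<in> carrier G \<Longrightarrow> \<delta> g x = (if x = g then \<one>\<^bsub>F\<^esub> else \<zero>\<^bsub>F\<^esub>)"
  by (simp add: basis_def)

lemma operations_closed:
  shows add_closed_A: "f \<in> carrier A \<Longrightarrow> g \<in> carrier A \<Longrightarrow> f \<oplus>\<^bsub>A\<^esub> g \<in> carrier A"
    and zero_closed_A: "\<zero>\<^bsub>A\<^esub> \<in> carrier A"
    and smult_closed_A: "a \<in> carrier F \<Longrightarrow> f \<in> carrier A \<Longrightarrow> a \<odot>\<^bsub>A\<^esub> f \<in> carrier A"
    and mult_closed_A: "f \<in> carrier A \<Longrightarrow> g \<in> carrier A \<Longrightarrow> f \<otimes>\<^bsub>A\<^esub> g \<in> carrier A"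
  by (auto simp: group_algebra_def PiE_iff intro!: F.finsum_closed)

lemma left_translate_bij:
  "y \<in> carrier G \<Longrightarrow> bij_betw (\<lambda>x. y \<otimes>\<^bsub>G\<^esub> x) (carrier G) (carrier G)"
  by (rule bij_betw_byWitness[where f' = "\<lambda>x. inv\<^bsub>G\<^esub> y \<otimes>\<^bsub>G\<^esub> x"])
    (auto simp: G.m_assoc[symmetric])

text \<open>The substitution \<open>x \<mapsto> y x\<close>, which turns double sums over factorisations of a group element into
  products of sums.\<close>

lemma finsum_translate:
  assumes "abelian_monoid M" "y \<in> carrier G" "\<And>x. x \<in> carrier G \<Longrightarrow> h x \<in> carrier M"
  shows "(\<Oplus>\<^bsub>M\<^esub>x\<in>carrier G. h (inv\<^bsub>G\<^esub> y \<otimes>\<^bsub>G\<^esub> x)) = (\<Oplus>\<^bsub>M\<^esub>x\<in>carrier G. h x)"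
proof -
  interpret M: abelian_monoid M by fact
  let ?t = "\<lambda>x. inv\<^bsub>G\<^esub> y \<otimes>\<^bsub>G\<^esub> x"
  have b: "bij_betw ?t (carrier G) (carrier G)"
    using assms(2) by (intro left_translate_bij) auto
  then have "(\<Oplus>\<^bsub>M\<^esub>x\<in>?t ` carrier G. h x) = (\<Oplus>\<^bsub>M\<^esub>x\<in>carrier G. h (?t x))"
    using assms(3) by (intro M.finsum_reindex) (auto simp: bij_betw_def)
  then show ?thesis using b by (simp add: bij_betw_def)
qed

lemma abelian_group_A: "abelian_group A"
proof (rule abelian_groupI)
  fix x assume x: "x \<in> carrier A"
  show "\<exists>y\<in>carrier A. y \<oplus>\<^bsub>A\<^esub> x = \<zero>\<^bsub>A\<^esub>"
  proof
    show "(\<lambda>g\<in>carrier G. \<ominus>\<^bsub>F\<^esub> x g) \<oplus>\<^bsub>A\<^esub> x = \<zero>\<^bsub>A\<^esub>"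
      using x by (auto simp: group_algebra_def F.l_neg PiE_iff)
    show "(\<lambda>g\<in>carrier G. \<ominus>\<^bsub>F\<^esub> x g) \<in> carrier A"
      using x by (auto simp: group_algebra_def PiE_iff)
  qed
qed (auto simp: operations_closed add_apply zero_apply F.a_ac intro!: elem_eqI)

lemma mult_assoc_A:
  assumes f: "f \<in> carrier A" and g: "g \<in> carrier A" and h: "h \<in> carrier A"
  shows "(f \<otimes>\<^bsub>A\<^esub> g) \<otimes>\<^bsub>A\<^esub> h = f \<otimes>\<^bsub>A\<^esub> (g \<otimes>\<^bsub>A\<^esub> h)"
proof (rule elem_eqI)
  fix x assume x: "x \<in> carrier G"
  let ?C = "carrier G"
  have "((f \<otimes>\<^bsub>A\<^esub> g) \<otimes>\<^bsub>A\<^esub> h) x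
    = (\<Oplus>\<^bsub>F\<^esub>y\<in>?C. (\<Oplus>\<^bsub>F\<^esub>z\<in>?C. f z \<otimes>\<^bsub>F\<^esub> g (inv\<^bsub>G\<^esub> z \<otimes>\<^bsub>G\<^esub> y)) \<otimes>\<^bsub>F\<^esub> h (inv\<^bsub>G\<^esub> y \<otimes>\<^bsub>G\<^esub> x))"
    using x f g h by (simp add: mult_apply cong: F.finsum_cong)
  also have "\<dots> = (\<Oplus>\<^bsub>F\<^esub>y\<in>?C. \<Oplus>\<^bsub>F\<^esub>z\<in>?C. f z \<otimes>\<^bsub>F\<^esub> g (inv\<^bsub>G\<^esub> z \<otimes>\<^bsub>G\<^esub> y) \<otimes>\<^bsub>F\<^esub> h (inv\<^bsub>G\<^esub> y \<otimes>\<^bsub>G\<^esub> x))"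
    using x f g h finite_G by (intro F.finsum_cong' refl F.finsum_ldistr) (auto intro!: F.finsum_closed)
  also have "\<dots> = (\<Oplus>\<^bsub>F\<^esub>z\<in>?C. \<Oplus>\<^bsub>F\<^esub>y\<in>?C. f z \<otimes>\<^bsub>F\<^esub> g (inv\<^bsub>G\<^esub> z \<otimes>\<^bsub>G\<^esub> y) \<otimes>\<^bsub>F\<^esub> h (inv\<^bsub>G\<^esub> y \<otimes>\<^bsub>G\<^esub> x))"
    using x f g h finite_G by (intro F.finsum_swap) auto
  also have "\<dots> = (\<Oplus>\<^bsub>F\<^esub>z\<in>?C. f z \<otimes>\<^bsub>F\<^esub> (\<Oplus>\<^bsub>F\<^esub>y\<in>?C. g y \<otimes>\<^bsub>F\<^esub> h (inv\<^bsub>G\<^esub> y \<otimes>\<^bsub>G\<^esub> (inv\<^bsub>G\<^esub> z \<otimes>\<^bsub>G\<^esub> x))))"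
  proof (intro F.finsum_cong' refl)
    fix z assume z: "z \<in> ?C"
    have "(\<Oplus>\<^bsub>F\<^esub>y\<in>?C. f z \<otimes>\<^bsub>F\<^esub> g (inv\<^bsub>G\<^esub> z \<otimes>\<^bsub>G\<^esub> y) \<otimes>\<^bsub>F\<^esub> h (inv\<^bsub>G\<^esub> y \<otimes>\<^bsub>G\<^esub> x))
      = (\<Oplus>\<^bsub>F\<^esub>y\<in>?C. (\<lambda>u. f z \<otimes>\<^bsub>F\<^esub> (g u \<otimes>\<^bsub>F\<^esub> h (inv\<^bsub>G\<^esub> u \<otimes>\<^bsub>G\<^esub> (inv\<^bsub>G\<^esub> z \<otimes>\<^bsub>G\<^esub> x)))) (inv\<^bsub>G\<^esub> z \<otimes>\<^bsub>G\<^esub> y))"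
    proof (intro F.finsum_cong' refl)
      fix y assume y: "y \<in> ?C"
      have "inv\<^bsub>G\<^esub> (inv\<^bsub>G\<^esub> z \<otimes>\<^bsub>G\<^esub> y) \<otimes>\<^bsub>G\<^esub> (inv\<^bsub>G\<^esub> z \<otimes>\<^bsub>G\<^esub> x) = inv\<^bsub>G\<^esub> y \<otimes>\<^bsub>G\<^esub> x"
        using x y z by (simp add: G.inv_mult_group G.m_assoc, simp add: G.m_assoc[symmetric])
      then show "f z \<otimes>\<^bsub>F\<^esub> g (inv\<^bsub>G\<^esub> z \<otimes>\<^bsub>G\<^esub> y) \<otimes>\<^bsub>F\<^esub> h (inv\<^bsub>G\<^esub> y \<otimes>\<^bsub>G\<^esub> x)
        = (\<lambda>u. f z \<otimes>\<^bsub>F\<^esub> (g u \<otimes>\<^bsub>F\<^esub> h (inv\<^bsub>G\<^esub> u \<otimes>\<^bsub>G\<^esub> (inv\<^bsub>G\<^esub> z \<otimes>\<^bsub>G\<^esub> x)))) (inv\<^bsub>G\<^esub> z \<otimes>\<^bsub>G\<^esub> y)"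
        using x y z f g h by (simp add: F.m_assoc)
    qed (use x z f g h in auto)
    also have "\<dots> = (\<Oplus>\<^bsub>F\<^esub>u\<in>?C. f z \<otimes>\<^bsub>F\<^esub> (g u \<otimes>\<^bsub>F\<^esub> h (inv\<^bsub>G\<^esub> u \<otimes>\<^bsub>G\<^esub> (inv\<^bsub>G\<^esub> z \<otimes>\<^bsub>G\<^esub> x))))"
      using x z f g h by (intro finsum_translate) (auto intro: F.abelian_monoid_axioms)
    also have "\<dots> = f z \<otimes>\<^bsub>F\<^esub> (\<Oplus>\<^bsub>F\<^esub>u\<in>?C. g u \<otimes>\<^bsub>F\<^esub> h (inv\<^bsub>G\<^esub> u \<otimes>\<^bsub>G\<^esub> (inv\<^bsub>G\<^esub> z \<otimes>\<^bsub>G\<^esub> x)))"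
      using x z f g h finite_G by (intro F.finsum_rdistr[symmetric]) auto
    finally show "(\<Oplus>\<^bsub>F\<^esub>y\<in>?C. f z \<otimes>\<^bsub>F\<^esub> g (inv\<^bsub>G\<^esub> z \<otimes>\<^bsub>G\<^esub> y) \<otimes>\<^bsub>F\<^esub> h (inv\<^bsub>G\<^esub> y \<otimes>\<^bsub>G\<^esub> x)) = \<dots>" .
  qed (use x f g h in \<open>auto intro!: F.finsum_closed\<close>)
  also have "\<dots> = (f \<otimes>\<^bsub>A\<^esub> (g \<otimes>\<^bsub>A\<^esub> h)) x"
    using x f g h by (simp add: mult_apply cong: F.finsum_cong)
  finally show "((f \<otimes>\<^bsub>A\<^esub> g) \<otimes>\<^bsub>A\<^esub> h) x = (f \<otimes>\<^bsub>A\<^esub> (g \<otimes>\<^bsub>A\<^esub> h)) x" .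
qed (auto simp: operations_closed f g h)

lemma basis_mult_apply:
  assumes "g \<in> carrier G" "f \<in> carrier A" "x \<in> carrier G"
  shows "(\<delta> g \<otimes>\<^bsub>A\<^esub> f) x = f (inv\<^bsub>G\<^esub> g \<otimes>\<^bsub>G\<^esub> x)"
proof -
  have "(\<delta> g \<otimes>\<^bsub>A\<^esub> f) x
      = (\<Oplus>\<^bsub>F\<^esub>y\<in>carrier G. if y = g then f (inv\<^bsub>G\<^esub> y \<otimes>\<^bsub>G\<^esub> x) else \<zero>\<^bsub>F\<^esub>)"
    unfolding mult_apply[OF assms(3)] using assms
    by (intro F.finsum_cong') (auto simp: basis_apply)
  also have "\<dots> = f (inv\<^bsub>G\<^esub> g \<otimes>\<^bsub>G\<^esub> x)"
    using assms finite_G by (intro F.finsum_delta) auto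
  finally show ?thesis .
qed

lemma mult_basis_apply:
  assumes "g \<in> carrier G" "f \<in> carrier A" "x \<in> carrier G"
  shows "(f \<otimes>\<^bsub>A\<^esub> \<delta> g) x = f (x \<otimes>\<^bsub>G\<^esub> inv\<^bsub>G\<^esub> g)"
proof -
  have eq: "inv\<^bsub>G\<^esub> y \<otimes>\<^bsub>G\<^esub> x = g \<longleftrightarrow> y = x \<otimes>\<^bsub>G\<^esub> inv\<^bsub>G\<^esub> g" if "y \<in> carrier G" for y
    using that assms by (metis G.inv_closed G.inv_solve_left G.inv_solve_right G.m_closed)
  have "(f \<otimes>\<^bsub>A\<^esub> \<delta> g) x
      = (\<Oplus>\<^bsub>F\<^esub>y\<in>carrier G. if y = x \<otimes>\<^bsub>G\<^esub> inv\<^bsub>G\<^esub> g then f y else \<zero>\<^bsub>F\<^esub>)"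
    unfolding mult_apply[OF assms(3)] using assms
    by (intro F.finsum_cong') (auto simp: basis_apply eq)
  also have "\<dots> = f (x \<otimes>\<^bsub>G\<^esub> inv\<^bsub>G\<^esub> g)"
    using assms finite_G by (intro F.finsum_delta) auto
  finally show ?thesis .
qed

lemma ring_A: "ring A"
proof (rule ringI)
  show "abelian_group A" by (rule abelian_group_A)
  show "Group.monoid A"
  proof (rule monoidI)
    fix x assume x: "x \<in> carrier A"
    show "\<one>\<^bsub>A\<^esub> \<otimes>\<^bsub>A\<^esub> x = x" "x \<otimes>\<^bsub>A\<^esub> \<one>\<^bsub>A\<^esub> = x"
      unfolding one_eq_basis using x
      by (auto intro!: elem_eqI simp: basis_mult_apply mult_basis_apply operations_closed)
  qed (auto simp: operations_closed mult_assoc_A one_eq_basis)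
  fix x y z assume xyz: "x \<in> carrier A" "y \<in> carrier A" "z \<in> carrier A"
  show "(x \<oplus>\<^bsub>A\<^esub> y) \<otimes>\<^bsub>A\<^esub> z = x \<otimes>\<^bsub>A\<^esub> z \<oplus>\<^bsub>A\<^esub> y \<otimes>\<^bsub>A\<^esub> z"
  proof (rule elem_eqI)
    fix g assume g: "g \<in> carrier G"
    have "((x \<oplus>\<^bsub>A\<^esub> y) \<otimes>\<^bsub>A\<^esub> z) g = (\<Oplus>\<^bsub>F\<^esub>u\<in>carrier G.
        x u \<otimes>\<^bsub>F\<^esub> z (inv\<^bsub>G\<^esub> u \<otimes>\<^bsub>G\<^esub> g) \<oplus>\<^bsub>F\<^esub> y u \<otimes>\<^bsub>F\<^esub> z (inv\<^bsub>G\<^esub> u \<otimes>\<^bsub>G\<^esub> g))"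
      unfolding mult_apply[OF g] using xyz g
      by (intro F.finsum_cong') (auto simp: add_apply F.l_distr)
    also have "\<dots> = (x \<otimes>\<^bsub>A\<^esub> z \<oplus>\<^bsub>A\<^esub> y \<otimes>\<^bsub>A\<^esub> z) g"
      using xyz g by (subst F.finsum_addf) (auto simp: add_apply mult_apply)
    finally show "((x \<oplus>\<^bsub>A\<^esub> y) \<otimes>\<^bsub>A\<^esub> z) g = (x \<otimes>\<^bsub>A\<^esub> z \<oplus>\<^bsub>A\<^esub> y \<otimes>\<^bsub>A\<^esub> z) g" .
  qed (auto simp: operations_closed xyz)
  show "z \<otimes>\<^bsub>A\<^esub> (x \<oplus>\<^bsub>A\<^esub> y) = z \<otimes>\<^bsub>A\<^esub> x \<oplus>\<^bsub>A\<^esub> z \<otimes>\<^bsub>A\<^esub> y"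
  proof (rule elem_eqI)
    fix g assume g: "g \<in> carrier G"
    have "(z \<otimes>\<^bsub>A\<^esub> (x \<oplus>\<^bsub>A\<^esub> y)) g = (\<Oplus>\<^bsub>F\<^esub>u\<in>carrier G.
        z u \<otimes>\<^bsub>F\<^esub> x (inv\<^bsub>G\<^esub> u \<otimes>\<^bsub>G\<^esub> g) \<oplus>\<^bsub>F\<^esub> z u \<otimes>\<^bsub>F\<^esub> y (inv\<^bsub>G\<^esub> u \<otimes>\<^bsub>G\<^esub> g))"
      unfolding mult_apply[OF g] using xyz g
      by (intro F.finsum_cong') (auto simp: add_apply F.r_distr)
    also have "\<dots> = (z \<otimes>\<^bsub>A\<^esub> x \<oplus>\<^bsub>A\<^esub> z \<otimes>\<^bsub>A\<^esub> y) g"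
      using xyz g by (subst F.finsum_addf) (auto simp: add_apply mult_apply)
    finally show "(z \<otimes>\<^bsub>A\<^esub> (x \<oplus>\<^bsub>A\<^esub> y)) g = (z \<otimes>\<^bsub>A\<^esub> x \<oplus>\<^bsub>A\<^esub> z \<otimes>\<^bsub>A\<^esub> y) g" .
  qed (auto simp: operations_closed xyz)
qed

sublocale A: ring A by (rule ring_A)

sublocale Alg: unital_algebra F A
proof -
  have m: "module F A"
    by (rule moduleI)
      (auto intro!: elem_eqI simp: F.cring_axioms abelian_group_A operations_closed smult_apply add_apply
        F.l_distr F.r_distr F.m_assoc)
  have l: "(a \<odot>\<^bsub>A\<^esub> x) \<otimes>\<^bsub>A\<^esub> y = a \<odot>\<^bsub>A\<^esub> (x \<otimes>\<^bsub>A\<^esub> y)"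
    if "a \<in> carrier F" "x \<in> carrier A" "y \<in> carrier A" for a x y
  proof (rule elem_eqI)
    fix g assume g: "g \<in> carrier G"
    show "((a \<odot>\<^bsub>A\<^esub> x) \<otimes>\<^bsub>A\<^esub> y) g = (a \<odot>\<^bsub>A\<^esub> (x \<otimes>\<^bsub>A\<^esub> y)) g"
      using that g finite_G
      by (auto simp: mult_apply smult_apply F.finsum_rdistr Pi_def F.m_assoc intro!: F.finsum_cong')
  qed (auto simp: operations_closed that)
  have r: "x \<otimes>\<^bsub>A\<^esub> (a \<odot>\<^bsub>A\<^esub> y) = a \<odot>\<^bsub>A\<^esub> (x \<otimes>\<^bsub>A\<^esub> y)"
    if "a \<in> carrier F" "x \<in> carrier A" "y \<in> carrier A" for a x y
  proof (rule elem_eqI)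
    fix g assume g: "g \<in> carrier G"
    show "(x \<otimes>\<^bsub>A\<^esub> (a \<odot>\<^bsub>A\<^esub> y)) g = (a \<odot>\<^bsub>A\<^esub> (x \<otimes>\<^bsub>A\<^esub> y)) g"
      using that g finite_G
      by (auto simp: mult_apply smult_apply F.finsum_rdistr Pi_def F.m_lcomm intro!: F.finsum_cong')
  qed (auto simp: operations_closed that)
  show "unital_algebra F A"
    using l r by (intro unital_algebra.intro m ring_A unital_algebra_axioms.intro) auto
qed

end

section \<open>Homomorphisms out of a group algebra\<close>

definition algebra_hom ::
    "('f, 'm) ring_scheme \<Rightarrow> ('f, 'x, 'k) module_scheme \<Rightarrow> ('f, 'y, 'l) module_scheme \<Rightarrow>
     ('x \<Rightarrow> 'y) set" where
  "algebra_hom F A B = {h \<in> ring_hom A B.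
     \<forall>a \<in> carrier F. \<forall>x \<in> carrier A. h (a \<odot>\<^bsub>A\<^esub> x) = a \<odot>\<^bsub>B\<^esub> h x}"

lemma algebra_homD:
  assumes "h \<in> algebra_hom F A B"
  shows "x \<in> carrier A \<Longrightarrow> h x \<in> carrier B"
    and "x \<in> carrier A \<Longrightarrow> y \<in> carrier A \<Longrightarrow> h (x \<otimes>\<^bsub>A\<^esub> y) = h x \<otimes>\<^bsub>B\<^esub> h y"
    and "x \<in> carrier A \<Longrightarrow> y \<in> carrier A \<Longrightarrow> h (x \<oplus>\<^bsub>A\<^esub> y) = h x \<oplus>\<^bsub>B\<^esub> h y"
    and "h \<one>\<^bsub>A\<^esub> = \<one>\<^bsub>B\<^esub>"
    and "a \<in> carrier F \<Longrightarrow> x \<in> carrier A \<Longrightarrow> h (a \<odot>\<^bsub>A\<^esub> x) = a \<odot>\<^bsub>B\<^esub> h x"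
  using assms by (auto simp: algebra_hom_def ring_hom_def)

lemma algebra_homI:
  assumes "\<And>x. x \<in> carrier A \<Longrightarrow> h x \<in> carrier B"
    and "\<And>x y. x \<in> carrier A \<Longrightarrow> y \<in> carrier A \<Longrightarrow> h (x \<otimes>\<^bsub>A\<^esub> y) = h x \<otimes>\<^bsub>B\<^esub> h y"
    and "\<And>x y. x \<in> carrier A \<Longrightarrow> y \<in> carrier A \<Longrightarrow> h (x \<oplus>\<^bsub>A\<^esub> y) = h x \<oplus>\<^bsub>B\<^esub> h y"
    and "h \<one>\<^bsub>A\<^esub> = \<one>\<^bsub>B\<^esub>"
    and "\<And>a x. a \<in> carrier F \<Longrightarrow> x \<in> carrier A \<Longrightarrow> h (a \<odot>\<^bsub>A\<^esub> x) = a \<odot>\<^bsub>B\<^esub> h x"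
  shows "h \<in> algebra_hom F A B"
  using assms by (auto simp: algebra_hom_def ring_hom_def)

lemma algebra_hom_compose:
  "h \<in> algebra_hom F A B \<Longrightarrow> k \<in> algebra_hom F B C \<Longrightarrow> (\<lambda>x. k (h x)) \<in> algebra_hom F A C"
  by (rule algebra_homI) (simp_all add: algebra_homD)

lemma algebra_hom_ring_hom_ring:
  assumes "h \<in> algebra_hom F A B" "ring A" "ring B"
  shows "ring_hom_ring A B h"
  using assms by (intro ring_hom_ringI2) (auto simp: algebra_hom_def)

lemma algebra_hom_minus:
  assumes "h \<in> algebra_hom F A B" "ring A" "ring B" "x \<in> carrier A" "y \<in> carrier A"
  shows "h (x \<ominus>\<^bsub>A\<^esub> y) = h x \<ominus>\<^bsub>B\<^esub> h y" "h \<zero>\<^bsub>A\<^esub> = \<zero>\<^bsub>B\<^esub>"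
proof -
  interpret ring_hom_ring A B h by (rule algebra_hom_ring_hom_ring[OF assms(1-3)])
  show "h (x \<ominus>\<^bsub>A\<^esub> y) = h x \<ominus>\<^bsub>B\<^esub> h y" "h \<zero>\<^bsub>A\<^esub> = \<zero>\<^bsub>B\<^esub>"
    using assms(4,5) by (auto simp: a_minus_def)
qed

lemma algebra_isomorphicI:
  assumes h: "h \<in> algebra_hom F A B" and k: "k \<in> carrier B \<rightarrow> carrier A"
    and "\<And>x. x \<in> carrier A \<Longrightarrow> k (h x) = x" "\<And>y. y \<in> carrier B \<Longrightarrow> h (k y) = y"
  shows "algebra_isomorphic F A B"
proof -
  have "bij_betw h (carrier A) (carrier B)"
    using assms algebra_homD(1)[OF h] by (intro bij_betw_byWitness[where f' = k]) auto
  then show ?thesis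
    using h by (auto simp: algebra_isomorphic_def algebra_iso_def algebra_hom_def ring_iso_def)
qed

lemma algebra_isomorphicE:
  assumes "algebra_isomorphic F A B" "unital_algebra F A" "unital_algebra F B"
  obtains h k where "h \<in> algebra_hom F A B" "k \<in> algebra_hom F B A"
    "\<And>x. x \<in> carrier A \<Longrightarrow> k (h x) = x" "\<And>y. y \<in> carrier B \<Longrightarrow> h (k y) = y"
proof -
  interpret A: ring A using assms(2) by (simp add: unital_algebra_def)
  interpret MA: unital_algebra F A by fact
  obtain h where h: "h \<in> algebra_hom F A B" and b: "bij_betw h (carrier A) (carrier B)"
    using assms(1) by (auto simp: algebra_isomorphic_def algebra_iso_def algebra_hom_def ring_iso_def)
  define k where "k = inv_into (carrier A) h"
  have kh: "k (h x) = x" if "x \<in> carrier A" for x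
    using b that by (auto simp: k_def bij_betw_def)
  have hk: "h (k y) = y" and kc: "k y \<in> carrier A" if "y \<in> carrier B" for y
    using b that by (auto simp: k_def bij_betw_def f_inv_into_f inv_into_into)
  have k_eqI: "k y = x" if "h x = y" "x \<in> carrier A" for x y
    using kh that by auto
  have "k \<in> algebra_hom F B A"
    by (rule algebra_homI)
      (auto intro!: k_eqI simp: kc hk algebra_homD[OF h] intro: MA.smult_closed)
  then show ?thesis using that h kh hk by blast
qed

definition group_map ::
    "('f, 'm) ring_scheme \<Rightarrow> ('a, 'c) monoid_scheme \<Rightarrow> ('b, 'd) monoid_scheme \<Rightarrow> ('a \<Rightarrow> 'b) \<Rightarrow>
     ('a \<Rightarrow> 'f) \<Rightarrow> 'b \<Rightarrow> 'f" where
  "group_map F G H \<alpha> = linear_extension G (group_algebra F H) (\<lambda>g. basis F H (\<alpha> g))"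

context finite_group_algebra
begin

lemma finsum_apply:
  assumes "x \<in> carrier G" "\<And>i. i \<in> I \<Longrightarrow> f i \<in> carrier A"
  shows "(\<Oplus>\<^bsub>A\<^esub>i\<in>I. f i) x = (\<Oplus>\<^bsub>F\<^esub>i\<in>I. f i x)"
  using assms
  by (intro additive_finsum[where h = "\<lambda>f. f x"])
    (auto simp: zero_apply add_apply A.abelian_monoid_axioms F.abelian_monoid_axioms)

lemma basis_expansion:
  assumes "f \<in> carrier A"
  shows "(\<Oplus>\<^bsub>A\<^esub>g\<in>carrier G. f g \<odot>\<^bsub>A\<^esub> \<delta> g) = f"
proof (rule elem_eqI)
  fix x assume x: "x \<in> carrier G"
  have "(\<Oplus>\<^bsub>A\<^esub>g\<in>carrier G. f g \<odot>\<^bsub>A\<^esub> \<delta> g) x = (\<Oplus>\<^bsub>F\<^esub>g\<in>carrier G. (f g \<odot>\<^bsub>A\<^esub> \<delta> g) x)"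
    using x assms by (intro finsum_apply) auto
  also have "\<dots> = (\<Oplus>\<^bsub>F\<^esub>g\<in>carrier G. if g = x then f g else \<zero>\<^bsub>F\<^esub>)"
    using x assms by (intro F.finsum_cong') (auto simp: smult_apply basis_apply)
  also have "\<dots> = f x"
    using x assms finite_G by (intro F.finsum_delta) auto
  finally show "(\<Oplus>\<^bsub>A\<^esub>g\<in>carrier G. f g \<odot>\<^bsub>A\<^esub> \<delta> g) x = f x" .
qed (use assms in \<open>auto intro!: A.finsum_closed\<close>)

lemma basis_mult:
  assumes "g \<in> carrier G" "h \<in> carrier G"
  shows "\<delta> g \<otimes>\<^bsub>A\<^esub> \<delta> h = \<delta> (g \<otimes>\<^bsub>G\<^esub> h)"
proof (rule elem_eqI)
  fix x assume "x \<in> carrier G"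
  moreover have "inv\<^bsub>G\<^esub> g \<otimes>\<^bsub>G\<^esub> x = h \<longleftrightarrow> x = g \<otimes>\<^bsub>G\<^esub> h" if "x \<in> carrier G"
    using that assms by (metis G.inv_closed G.inv_solve_left G.inv_inv)
  ultimately show "(\<delta> g \<otimes>\<^bsub>A\<^esub> \<delta> h) x = \<delta> (g \<otimes>\<^bsub>G\<^esub> h) x"
    using assms by (simp add: basis_mult_apply basis_apply)
qed auto

lemma basis_pow: "g \<in> carrier G \<Longrightarrow> \<delta> g [^]\<^bsub>A\<^esub> (n::nat) = \<delta> (g [^]\<^bsub>G\<^esub> n)"
  by (induction n) (auto simp: one_eq_basis basis_mult)

context
  fixes B :: "('f, 'x, 'k) module_scheme" and \<mu> :: "'a \<Rightarrow> 'x"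
  assumes B: "unital_algebra F B" and \<mu>: "\<And>g. g \<in> carrier G \<Longrightarrow> \<mu> g \<in> carrier B"
begin

lemma linear_extension_closed:
  assumes "f \<in> carrier A"
  shows "linear_extension G B \<mu> f \<in> carrier B"
proof -
  interpret B: ring B using B by (simp add: unital_algebra_def)
  interpret MB: unital_algebra F B by (rule B)
  show ?thesis using assms \<mu> by (auto simp: linear_extension_def intro!: B.finsum_closed)
qed

lemma linear_extension_add:
  assumes "f \<in> carrier A" "g \<in> carrier A"
  shows "linear_extension G B \<mu> (f \<oplus>\<^bsub>A\<^esub> g) = linear_extension G B \<mu> f \<oplus>\<^bsub>B\<^esub> linear_extension G B \<mu> g"
proof -
  interpret B: ring B using B by (simp add: unital_algebra_def)
  interpret MB: unital_algebra F B by (rule B)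
  have "linear_extension G B \<mu> (f \<oplus>\<^bsub>A\<^esub> g)
      = (\<Oplus>\<^bsub>B\<^esub>x\<in>carrier G. f x \<odot>\<^bsub>B\<^esub> \<mu> x \<oplus>\<^bsub>B\<^esub> g x \<odot>\<^bsub>B\<^esub> \<mu> x)"
    unfolding linear_extension_def using assms \<mu>
    by (intro B.finsum_cong') (auto simp: add_apply MB.smult_l_distr)
  then show ?thesis
    using assms \<mu> by (simp add: linear_extension_def B.finsum_addf Pi_def)
qed

lemma linear_extension_smult:
  assumes "a \<in> carrier F" "f \<in> carrier A"
  shows "linear_extension G B \<mu> (a \<odot>\<^bsub>A\<^esub> f) = a \<odot>\<^bsub>B\<^esub> linear_extension G B \<mu> f"
proof -
  interpret B: ring B using B by (simp add: unital_algebra_def)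
  interpret MB: unital_algebra F B by (rule B)
  have "a \<odot>\<^bsub>B\<^esub> linear_extension G B \<mu> f = (\<Oplus>\<^bsub>B\<^esub>x\<in>carrier G. a \<odot>\<^bsub>B\<^esub> (f x \<odot>\<^bsub>B\<^esub> \<mu> x))"
    unfolding linear_extension_def using assms \<mu>
    by (intro additive_finsum[where h = "\<lambda>x. a \<odot>\<^bsub>B\<^esub> x"])
      (auto simp: MB.smult_r_distr B.abelian_monoid_axioms)
  also have "\<dots> = linear_extension G B \<mu> (a \<odot>\<^bsub>A\<^esub> f)"
    unfolding linear_extension_def using assms \<mu>
    by (intro B.finsum_cong') (auto simp: smult_apply MB.smult_assoc1)
  finally show ?thesis by simp
qed

lemma linear_extension_basis:
  assumes "g \<in> carrier G"
  shows "linear_extension G B \<mu> (\<delta> g) = \<mu> g"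
proof -
  interpret B: ring B using B by (simp add: unital_algebra_def)
  interpret MB: unital_algebra F B by (rule B)
  have "linear_extension G B \<mu> (\<delta> g) = (\<Oplus>\<^bsub>B\<^esub>x\<in>carrier G. if x = g then \<mu> x else \<zero>\<^bsub>B\<^esub>)"
    unfolding linear_extension_def using assms \<mu>
    by (intro B.finsum_cong') (auto simp: basis_apply)
  also have "\<dots> = \<mu> g"
    using assms \<mu> finite_G by (intro B.finsum_delta) auto
  finally show ?thesis .
qed

text \<open>Together with \<open>linear_extension_basis\<close> this is the universal property of the group algebra: a
  multiplicative map from \<open>G\<close> to an algebra extends to an algebra homomorphism.\<close>

lemma linear_extension_mult:
  assumes "\<And>g h. g \<in> carrier G \<Longrightarrow> h \<in> carrier G \<Longrightarrow> \<mu> (g \<otimes>\<^bsub>G\<^esub> h) = \<mu> g \<otimes>\<^bsub>B\<^esub> \<mu> h"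
    and f: "f \<in> carrier A" and g: "g \<in> carrier A"
  shows "linear_extension G B \<mu> (f \<otimes>\<^bsub>A\<^esub> g) = linear_extension G B \<mu> f \<otimes>\<^bsub>B\<^esub> linear_extension G B \<mu> g"
proof -
  interpret B: ring B using B by (simp add: unital_algebra_def)
  interpret MB: unital_algebra F B by (rule B)
  let ?C = "carrier G" and ?L = "linear_extension G B \<mu>"
  have "?L (f \<otimes>\<^bsub>A\<^esub> g) = (\<Oplus>\<^bsub>B\<^esub>x\<in>?C. \<Oplus>\<^bsub>B\<^esub>y\<in>?C. (f y \<otimes>\<^bsub>F\<^esub> g (inv\<^bsub>G\<^esub> y \<otimes>\<^bsub>G\<^esub> x)) \<odot>\<^bsub>B\<^esub> \<mu> x)"
    unfolding linear_extension_def
  proof (intro B.finsum_cong' refl)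
    fix x assume x: "x \<in> ?C"
    show "(f \<otimes>\<^bsub>A\<^esub> g) x \<odot>\<^bsub>B\<^esub> \<mu> x = (\<Oplus>\<^bsub>B\<^esub>y\<in>?C. (f y \<otimes>\<^bsub>F\<^esub> g (inv\<^bsub>G\<^esub> y \<otimes>\<^bsub>G\<^esub> x)) \<odot>\<^bsub>B\<^esub> \<mu> x)"
      unfolding mult_apply[OF x] using x f g \<mu>
      by (intro additive_finsum[where h = "\<lambda>a. a \<odot>\<^bsub>B\<^esub> \<mu> x"])
        (auto simp: MB.smult_l_distr B.abelian_monoid_axioms F.abelian_monoid_axioms)
  qed (use f g \<mu> in \<open>auto intro!: B.finsum_closed\<close>)
  also have "\<dots> = (\<Oplus>\<^bsub>B\<^esub>y\<in>?C. \<Oplus>\<^bsub>B\<^esub>x\<in>?C. (f y \<otimes>\<^bsub>F\<^esub> g (inv\<^bsub>G\<^esub> y \<otimes>\<^bsub>G\<^esub> x)) \<odot>\<^bsub>B\<^esub> \<mu> x)"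
    using f g \<mu> finite_G by (intro B.finsum_swap) auto
  also have "\<dots> = (\<Oplus>\<^bsub>B\<^esub>y\<in>?C. (f y \<odot>\<^bsub>B\<^esub> \<mu> y) \<otimes>\<^bsub>B\<^esub> ?L g)"
  proof (intro B.finsum_cong' refl)
    fix y assume y: "y \<in> ?C"
    have "(\<Oplus>\<^bsub>B\<^esub>x\<in>?C. (f y \<otimes>\<^bsub>F\<^esub> g (inv\<^bsub>G\<^esub> y \<otimes>\<^bsub>G\<^esub> x)) \<odot>\<^bsub>B\<^esub> \<mu> x)
      = (\<Oplus>\<^bsub>B\<^esub>x\<in>?C. (\<lambda>u. (f y \<odot>\<^bsub>B\<^esub> \<mu> y) \<otimes>\<^bsub>B\<^esub> (g u \<odot>\<^bsub>B\<^esub> \<mu> u)) (inv\<^bsub>G\<^esub> y \<otimes>\<^bsub>G\<^esub> x))"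
    proof (intro B.finsum_cong' refl)
      fix x assume x: "x \<in> ?C"
      have "\<mu> x = \<mu> y \<otimes>\<^bsub>B\<^esub> \<mu> (inv\<^bsub>G\<^esub> y \<otimes>\<^bsub>G\<^esub> x)"
        using x y by (subst assms(1)[symmetric]) (auto simp: G.m_assoc[symmetric])
      then show "(f y \<otimes>\<^bsub>F\<^esub> g (inv\<^bsub>G\<^esub> y \<otimes>\<^bsub>G\<^esub> x)) \<odot>\<^bsub>B\<^esub> \<mu> x =
          (\<lambda>u. (f y \<odot>\<^bsub>B\<^esub> \<mu> y) \<otimes>\<^bsub>B\<^esub> (g u \<odot>\<^bsub>B\<^esub> \<mu> u)) (inv\<^bsub>G\<^esub> y \<otimes>\<^bsub>G\<^esub> x)"
        using x y f g \<mu> F.m_comm[of "f y" "g (inv\<^bsub>G\<^esub> y \<otimes>\<^bsub>G\<^esub> x)"]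
        by (simp add: MB.smult_mult_left MB.smult_mult_right MB.smult_assoc1)
    qed (use y f g \<mu> in auto)
    also have "\<dots> = (\<Oplus>\<^bsub>B\<^esub>u\<in>?C. (f y \<odot>\<^bsub>B\<^esub> \<mu> y) \<otimes>\<^bsub>B\<^esub> (g u \<odot>\<^bsub>B\<^esub> \<mu> u))"
      using y f g \<mu> by (intro finsum_translate) (auto intro: B.abelian_monoid_axioms)
    also have "\<dots> = (f y \<odot>\<^bsub>B\<^esub> \<mu> y) \<otimes>\<^bsub>B\<^esub> ?L g"
      unfolding linear_extension_def
      using y f g \<mu> finite_G by (intro B.finsum_rdistr[symmetric]) auto
    finally show "(\<Oplus>\<^bsub>B\<^esub>x\<in>?C. (f y \<otimes>\<^bsub>F\<^esub> g (inv\<^bsub>G\<^esub> y \<otimes>\<^bsub>G\<^esub> x)) \<odot>\<^bsub>B\<^esub> \<mu> x) = \<dots>" .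
  qed (use f g \<mu> linear_extension_closed in \<open>auto intro!: B.m_closed\<close>)
  also have "\<dots> = ?L f \<otimes>\<^bsub>B\<^esub> ?L g"
    unfolding linear_extension_def[of _ _ _ f]
    using f g \<mu> finite_G linear_extension_closed by (intro B.finsum_ldistr[symmetric]) auto
  finally show ?thesis .
qed

lemma linear_extension_algebra_hom:
  assumes "\<And>g h. g \<in> carrier G \<Longrightarrow> h \<in> carrier G \<Longrightarrow> \<mu> (g \<otimes>\<^bsub>G\<^esub> h) = \<mu> g \<otimes>\<^bsub>B\<^esub> \<mu> h"
    and "\<mu> \<one>\<^bsub>G\<^esub> = \<one>\<^bsub>B\<^esub>"
  shows "linear_extension G B \<mu> \<in> algebra_hom F A B"
  by (rule algebra_homI)
    (auto simp: linear_extension_closed linear_extension_add linear_extension_smult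
      linear_extension_mult assms one_eq_basis linear_extension_basis)

end

text \<open>Uniqueness in the universal property.\<close>

lemma algebra_hom_expansion:
  assumes h: "h \<in> algebra_hom F A B" and B: "unital_algebra F B" and f: "f \<in> carrier A"
  shows "h f = linear_extension G B (\<lambda>g. h (\<delta> g)) f"
proof -
  interpret B: ring B using B by (simp add: unital_algebra_def)
  have "h (\<Oplus>\<^bsub>A\<^esub>g\<in>carrier G. f g \<odot>\<^bsub>A\<^esub> \<delta> g) = (\<Oplus>\<^bsub>B\<^esub>g\<in>carrier G. h (f g \<odot>\<^bsub>A\<^esub> \<delta> g))"
    using f by (intro additive_finsum[where h = h])
      (auto simp: A.abelian_monoid_axioms B.abelian_monoid_axioms algebra_homD[OF h]
        algebra_hom_minus(2)[OF h ring_A B.ring_axioms f f])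
  also have "\<dots> = linear_extension G B (\<lambda>g. h (\<delta> g)) f"
    unfolding linear_extension_def
    using f algebra_homD(1)[OF h] unital_algebra.axioms(1)[OF B]
    by (intro B.finsum_cong') (auto simp: algebra_homD(5)[OF h] intro!: module.smult_closed)
  finally show ?thesis by (simp add: basis_expansion[OF f])
qed

lemma algebra_hom_eqI:
  assumes "h \<in> algebra_hom F A B" "k \<in> algebra_hom F A B" "unital_algebra F B"
    and "\<And>g. g \<in> carrier G \<Longrightarrow> h (\<delta> g) = k (\<delta> g)" and "f \<in> carrier A"
  shows "h f = k f"
proof -
  interpret B: ring B using assms by (simp add: unital_algebra_def)
  interpret MB: unital_algebra F B by fact
  show ?thesis
    unfolding algebra_hom_expansion[OF assms(1,3,5)] algebra_hom_expansion[OF assms(2,3,5)]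
    unfolding linear_extension_def using assms(5) algebra_homD(1)[OF assms(2)]
    by (intro B.finsum_cong' refl) (auto simp: assms(4))
qed

lemma augmentation_closed [simp]: "f \<in> carrier A \<Longrightarrow> \<epsilon> f \<in> carrier F"
  by (auto simp: augmentation_def intro!: F.finsum_closed)

lemma augmentation_add:
  "f \<in> carrier A \<Longrightarrow> g \<in> carrier A \<Longrightarrow> \<epsilon> (f \<oplus>\<^bsub>A\<^esub> g) = \<epsilon> f \<oplus>\<^bsub>F\<^esub> \<epsilon> g"
  unfolding augmentation_def
  using F.finsum_addf[of f "carrier G" g] by (simp add: add_apply Pi_def cong: F.finsum_cong)

lemma augmentation_smult:
  "a \<in> carrier F \<Longrightarrow> f \<in> carrier A \<Longrightarrow> \<epsilon> (a \<odot>\<^bsub>A\<^esub> f) = a \<otimes>\<^bsub>F\<^esub> \<epsilon> f"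
  unfolding augmentation_def
  by (subst F.finsum_rdistr) (auto simp: smult_apply finite_G intro!: F.finsum_cong')

lemma augmentation_basis: "g \<in> carrier G \<Longrightarrow> \<epsilon> (\<delta> g) = \<one>\<^bsub>F\<^esub>"
  using F.finsum_delta[of "carrier G" g "\<lambda>_. \<one>\<^bsub>F\<^esub>"] finite_G
  unfolding augmentation_def by (simp add: basis_apply cong: F.finsum_cong)

lemma augmentation_mult:
  assumes f: "f \<in> carrier A" and g: "g \<in> carrier A"
  shows "\<epsilon> (f \<otimes>\<^bsub>A\<^esub> g) = \<epsilon> f \<otimes>\<^bsub>F\<^esub> \<epsilon> g"
proof -
  let ?C = "carrier G"
  have "\<epsilon> (f \<otimes>\<^bsub>A\<^esub> g) = (\<Oplus>\<^bsub>F\<^esub>x\<in>?C. \<Oplus>\<^bsub>F\<^esub>y\<in>?C. f y \<otimes>\<^bsub>F\<^esub> g (inv\<^bsub>G\<^esub> y \<otimes>\<^bsub>G\<^esub> x))"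
    unfolding augmentation_def using f g
    by (intro F.finsum_cong') (auto simp: mult_apply intro!: F.finsum_closed)
  also have "\<dots> = (\<Oplus>\<^bsub>F\<^esub>y\<in>?C. \<Oplus>\<^bsub>F\<^esub>x\<in>?C. f y \<otimes>\<^bsub>F\<^esub> g (inv\<^bsub>G\<^esub> y \<otimes>\<^bsub>G\<^esub> x))"
    using f g finite_G by (intro F.finsum_swap) auto
  also have "\<dots> = (\<Oplus>\<^bsub>F\<^esub>y\<in>?C. f y \<otimes>\<^bsub>F\<^esub> \<epsilon> g)"
  proof (intro F.finsum_cong' refl)
    fix y assume y: "y \<in> ?C"
    have "(\<Oplus>\<^bsub>F\<^esub>x\<in>?C. f y \<otimes>\<^bsub>F\<^esub> g (inv\<^bsub>G\<^esub> y \<otimes>\<^bsub>G\<^esub> x)) = (\<Oplus>\<^bsub>F\<^esub>x\<in>?C. f y \<otimes>\<^bsub>F\<^esub> g x)"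
      using y f g by (intro finsum_translate[where h = "\<lambda>u. f y \<otimes>\<^bsub>F\<^esub> g u"])
        (auto intro: F.abelian_monoid_axioms)
    also have "\<dots> = f y \<otimes>\<^bsub>F\<^esub> \<epsilon> g"
      unfolding augmentation_def using y f g finite_G by (intro F.finsum_rdistr[symmetric]) auto
    finally show "(\<Oplus>\<^bsub>F\<^esub>x\<in>?C. f y \<otimes>\<^bsub>F\<^esub> g (inv\<^bsub>G\<^esub> y \<otimes>\<^bsub>G\<^esub> x)) = f y \<otimes>\<^bsub>F\<^esub> \<epsilon> g" .
  qed (use f g in auto)
  also have "\<dots> = \<epsilon> f \<otimes>\<^bsub>F\<^esub> \<epsilon> g"
    unfolding augmentation_def[of _ _ f] using f g finite_G
    by (intro F.finsum_ldistr[symmetric]) auto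
  finally show ?thesis .
qed

lemma augmentation_ring_hom: "ring_hom_ring A F \<epsilon>"
  by (rule ring_hom_ringI2)
    (auto simp: ring_hom_def ring_A F.ring_axioms augmentation_add augmentation_mult
      one_eq_basis augmentation_basis)

end

lemma group_map_algebra_hom:
  assumes "finite_group_algebra F G" "finite_group_algebra F H" "\<alpha> \<in> hom G H"
  shows "group_map F G H \<alpha> \<in> algebra_hom F (group_algebra F G) (group_algebra F H)"
proof -
  interpret G: finite_group_algebra F G by fact
  interpret H: finite_group_algebra F H by fact
  have "group_hom G H \<alpha>" using assms(3) by (intro group_hom.intro group_hom_axioms.intro) auto
  then have "\<alpha> \<one>\<^bsub>G\<^esub> = \<one>\<^bsub>H\<^esub>" by (rule group_hom.hom_one)
  then show ?thesis
    unfolding group_map_def using assms(3)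
    by (intro G.linear_extension_algebra_hom)
      (auto simp: hom_def H.basis_mult H.one_eq_basis Pi_def H.Alg.unital_algebra_axioms)
qed

lemma group_map_basis:
  assumes "finite_group_algebra F G" "finite_group_algebra F H" "g \<in> carrier G"
  shows "group_map F G H \<alpha> (basis F G g) = basis F H (\<alpha> g)"
proof -
  interpret G: finite_group_algebra F G by fact
  interpret H: finite_group_algebra F H by fact
  show ?thesis unfolding group_map_def using assms(3)
    by (intro G.linear_extension_basis) (auto simp: H.Alg.unital_algebra_axioms)
qed

lemma augmentation_group_map:
  assumes "finite_group_algebra F G" "finite_group_algebra F H" "\<alpha> \<in> hom G H"
    and f: "f \<in> carrier (group_algebra F G)"
  shows "augmentation F H (group_map F G H \<alpha> f) = augmentation F G f"
proof -
  interpret G: finite_group_algebra F G by fact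
  interpret H: finite_group_algebra F H by fact
  interpret e: ring_hom_ring H.A F H.\<epsilon> by (rule H.augmentation_ring_hom)
  have "augmentation F H (group_map F G H \<alpha> f)
      = (\<Oplus>\<^bsub>F\<^esub>g\<in>carrier G. H.\<epsilon> (f g \<odot>\<^bsub>H.A\<^esub> H.\<delta> (\<alpha> g)))"
    unfolding group_map_def linear_extension_def using f
    by (intro additive_finsum[where h = H.\<epsilon>])
      (auto simp: H.A.abelian_monoid_axioms G.F.abelian_monoid_axioms)
  also have "\<dots> = augmentation F G f"
    unfolding augmentation_def[of F G] using f assms(3)
    by (intro G.F.finsum_cong')
      (auto simp: H.augmentation_smult H.augmentation_basis hom_def Pi_def)
  finally show ?thesis .
qed

section \<open>Powers of the augmentation ideal\<close>

definition augmentation_ideal ::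
    "('f, 'm) ring_scheme \<Rightarrow> ('a, 'c) monoid_scheme \<Rightarrow> ('a \<Rightarrow> 'f) set" where
  "augmentation_ideal F G = {f \<in> carrier (group_algebra F G). augmentation F G f = \<zero>\<^bsub>F\<^esub>}"

primrec augmentation_power ::
    "('f, 'm) ring_scheme \<Rightarrow> ('a, 'c) monoid_scheme \<Rightarrow> nat \<Rightarrow> ('a \<Rightarrow> 'f) set" where
  "augmentation_power F G 0 = carrier (group_algebra F G)"
| "augmentation_power F G (Suc k) =
     ideal_prod (group_algebra F G) (augmentation_ideal F G) (augmentation_power F G k)"

lemmas augmentation_power_Suc = augmentation_power.simps(2)

declare augmentation_power_Suc [simp del]

lemma (in abelian_group) add_minus_cancel:
  assumes "x \<in> carrier G" "y \<in> carrier G"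
  shows "y \<oplus> (x \<ominus> y) = x" "(x \<ominus> y) \<oplus> y = x"
proof -
  have "y \<oplus> (x \<ominus> y) = x \<oplus> (y \<oplus> \<ominus> y)"
    unfolding minus_eq using assms by (intro a_lcomm) auto
  then show "y \<oplus> (x \<ominus> y) = x" using assms by (simp add: r_neg)
  then show "(x \<ominus> y) \<oplus> y = x" using assms by (simp add: a_comm)
qed

lemma (in abelian_group) minus_telescope:
  assumes "x \<in> carrier G" "y \<in> carrier G" "z \<in> carrier G"
  shows "(x \<ominus> y) \<oplus> (y \<ominus> z) = x \<ominus> z"
proof -
  have "(x \<ominus> y) \<oplus> (y \<ominus> z) = ((x \<ominus> y) \<oplus> y) \<oplus> \<ominus> z"
    using assms by (simp only: minus_eq a_assoc a_inv_closed a_closed)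
  then show ?thesis using assms by (simp add: add_minus_cancel, simp add: minus_eq)
qed

lemma (in abelian_group) minus_minus_cancel:
  assumes "x \<in> carrier G" "y \<in> carrier G" "z \<in> carrier G"
  shows "(x \<ominus> z) \<ominus> (y \<ominus> z) = x \<ominus> y"
proof -
  have "\<ominus> (y \<ominus> z) = z \<ominus> y" using assms by (simp add: minus_eq minus_add a_comm)
  then have "(x \<ominus> z) \<ominus> (y \<ominus> z) = (x \<ominus> z) \<oplus> (z \<ominus> y)" by (simp add: minus_eq)
  then show ?thesis using minus_telescope assms by simp
qed

lemma (in ring) ideal_minus_trans:
  assumes "ideal J R" "x \<in> carrier R" "y \<in> carrier R" "z \<in> carrier R"
    and "x \<ominus> y \<in> J" "y \<ominus> z \<in> J"
  shows "x \<ominus> z \<in> J"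
proof -
  have "(x \<ominus> y) \<oplus> (y \<ominus> z) \<in> J"
    using assms by (simp add: additive_subgroup.a_closed ideal.axioms(1))
  moreover have "(x \<ominus> y) \<oplus> (y \<ominus> z) = x \<ominus> z"
    using assms by (simp add: minus_telescope)
  ultimately show ?thesis by simp
qed

lemma (in ring) ideal_minus_sym:
  assumes "ideal J R" "x \<in> carrier R" "y \<in> carrier R" "x \<ominus> y \<in> J"
  shows "y \<ominus> x \<in> J"
proof -
  have "\<ominus> (x \<ominus> y) \<in> J"
    using assms by (simp add: additive_subgroup.a_inv_closed ideal.axioms(1))
  then show ?thesis using assms by (simp add: minus_eq minus_add a_comm)
qed

context finite_group_algebra
begin

abbreviation I where "I \<equiv> augmentation_ideal F G"

abbreviation P where "P \<equiv> augmentation_power F G"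

lemma augmentation_ideal_closed [dest]: "x \<in> I \<Longrightarrow> x \<in> carrier A"
  by (simp add: augmentation_ideal_def)

lemma ideal_I: "ideal I A"
  using ring_hom_ring.kernel_is_ideal[OF augmentation_ring_hom]
  unfolding a_kernel_def' augmentation_ideal_def .

lemma ideal_P: "ideal (P k) A"
  by (induction k) (auto simp: augmentation_power_Suc A.ideal_prod_is_ideal ideal_I A.oneideal)

lemma P_closed: "x \<in> P k \<Longrightarrow> x \<in> carrier A"
  by (rule ideal.Icarr[OF ideal_P])

lemma P_add: "x \<in> P k \<Longrightarrow> y \<in> P k \<Longrightarrow> x \<oplus>\<^bsub>A\<^esub> y \<in> P k"
  by (rule additive_subgroup.a_closed[OF ideal.axioms(1)[OF ideal_P]])

lemma P_one: "P (Suc 0) = I"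
proof
  show "P (Suc 0) \<subseteq> I"
    using A.ideal_prod_inter[OF ideal_I A.oneideal] by (simp add: augmentation_power_Suc)
  show "I \<subseteq> P (Suc 0)"
  proof
    fix x assume "x \<in> I"
    then have "x \<otimes>\<^bsub>A\<^esub> \<one>\<^bsub>A\<^esub> \<in> ideal_prod A I (carrier A)"
      by (rule ideal_prod.prod) simp
    then show "x \<in> P (Suc 0)" using augmentation_ideal_closed[OF \<open>x \<in> I\<close>] by (simp add: augmentation_power_Suc)
  qed
qed

lemma P_Suc_subset: "P (Suc k) \<subseteq> P k"
  using A.ideal_prod_inter[OF ideal_I ideal_P] by (simp add: augmentation_power_Suc)

lemma P_two_subset: "P 2 \<subseteq> I"
  using P_Suc_subset[of "Suc 0"] unfolding P_one numeral_2_eq_2 .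

text \<open>The ideal product is built with the factors \<open>I\<close> on the left; this lemma absorbs a factor \<open>I\<^sup>2\<close>,
  which is how a congruence modulo \<open>I\<^sup>2\<close> gains one power of \<open>I\<close> inside a product.\<close>

lemma P_two_mult:
  assumes x: "x \<in> P 2" and y: "y \<in> P k"
  shows "x \<otimes>\<^bsub>A\<^esub> y \<in> P (Suc (Suc k))"
proof -
  have mul: "z \<otimes>\<^bsub>A\<^esub> y \<in> P (Suc k)" if "z \<in> P (Suc 0)" for z
    using ideal_prod.prod[of z I y "P k" A] that y unfolding P_one by (simp add: augmentation_power_Suc)
  have "x \<in> ideal_prod A I (P (Suc 0))" using x by (simp add: numeral_2_eq_2 augmentation_power_Suc)
  then show ?thesis
  proof (induction rule: ideal_prod.induct)
    case (prod i j)
    have "i \<in> carrier A" "j \<in> carrier A" "y \<in> carrier A"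
      using augmentation_ideal_closed[OF prod(1)] P_closed[OF prod(2)] P_closed[OF y] by blast+
    then have "(i \<otimes>\<^bsub>A\<^esub> j) \<otimes>\<^bsub>A\<^esub> y = i \<otimes>\<^bsub>A\<^esub> (j \<otimes>\<^bsub>A\<^esub> y)" by (rule A.m_assoc)
    then show ?case
      using ideal_prod.prod[OF prod(1) mul[OF prod(2)], of A]
      by (simp only: augmentation_power_Suc[of F G "Suc k"])
  next
    case (sum s t)
    have "s \<in> carrier A" "t \<in> carrier A"
      using sum(1,2) P_closed[of _ "Suc (Suc 0)"] by (auto simp: augmentation_power_Suc)
    then have "(s \<oplus>\<^bsub>A\<^esub> t) \<otimes>\<^bsub>A\<^esub> y = s \<otimes>\<^bsub>A\<^esub> y \<oplus>\<^bsub>A\<^esub> t \<otimes>\<^bsub>A\<^esub> y"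
      using P_closed[OF y] by (intro A.l_distr)
    then show ?case using P_add[OF sum(3,4)] by (simp only: augmentation_power_Suc)
  qed
qed

text \<open>Subtracting \<open>\<epsilon> f \<cdot> 1 = 0\<close> replaces each \<open>g\<close> by \<open>g - 1\<close>; so \<open>I\<close> is spanned by the
  differences \<open>g - 1\<close>.\<close>

lemma I_expansion:
  assumes f: "f \<in> carrier A" "\<epsilon> f = \<zero>\<^bsub>F\<^esub>"
  shows "(\<Oplus>\<^bsub>A\<^esub>g\<in>carrier G. f g \<odot>\<^bsub>A\<^esub> (\<delta> g \<ominus>\<^bsub>A\<^esub> \<one>\<^bsub>A\<^esub>)) = f"
proof -
  have "(\<Oplus>\<^bsub>A\<^esub>g\<in>carrier G. f g \<odot>\<^bsub>A\<^esub> \<one>\<^bsub>A\<^esub>) = \<epsilon> f \<odot>\<^bsub>A\<^esub> \<one>\<^bsub>A\<^esub>"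
    unfolding augmentation_def using f(1)
    by (intro additive_finsum[where h = "\<lambda>a. a \<odot>\<^bsub>A\<^esub> \<one>\<^bsub>A\<^esub>", symmetric])
      (auto simp: Alg.smult_l_distr A.abelian_monoid_axioms F.abelian_monoid_axioms)
  then have *: "(\<Oplus>\<^bsub>A\<^esub>g\<in>carrier G. f g \<odot>\<^bsub>A\<^esub> \<one>\<^bsub>A\<^esub>) = \<zero>\<^bsub>A\<^esub>" using f(2) by simp
  have "(\<Oplus>\<^bsub>A\<^esub>g\<in>carrier G. f g \<odot>\<^bsub>A\<^esub> (\<delta> g \<ominus>\<^bsub>A\<^esub> \<one>\<^bsub>A\<^esub>))
      = (\<Oplus>\<^bsub>A\<^esub>g\<in>carrier G. f g \<odot>\<^bsub>A\<^esub> \<delta> g \<ominus>\<^bsub>A\<^esub> f g \<odot>\<^bsub>A\<^esub> \<one>\<^bsub>A\<^esub>)"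
    using f(1) by (intro A.finsum_cong')
      (auto simp: A.minus_eq Alg.smult_r_distr Alg.smult_r_minus)
  also have "\<dots> = (\<Oplus>\<^bsub>A\<^esub>g\<in>carrier G. f g \<odot>\<^bsub>A\<^esub> \<delta> g) \<ominus>\<^bsub>A\<^esub> (\<Oplus>\<^bsub>A\<^esub>g\<in>carrier G. f g \<odot>\<^bsub>A\<^esub> \<one>\<^bsub>A\<^esub>)"
    using f(1) by (intro A.finsum_minus[symmetric]) auto
  also have "\<dots> = f"
    using f(1) by (simp add: * basis_expansion A.minus_eq)
  finally show ?thesis .
qed

lemma minus_augmentation:
  assumes "f \<in> carrier A"
  shows "f \<ominus>\<^bsub>A\<^esub> \<epsilon> f \<odot>\<^bsub>A\<^esub> \<one>\<^bsub>A\<^esub> \<in> I"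
proof -
  interpret e: ring_hom_ring A F \<epsilon> by (rule augmentation_ring_hom)
  show ?thesis
    using assms
    by (simp add: augmentation_ideal_def A.minus_eq augmentation_smult F.r_neg)
qed

lemma basis_minus_one: "g \<in> carrier G \<Longrightarrow> \<delta> g \<ominus>\<^bsub>A\<^esub> \<one>\<^bsub>A\<^esub> \<in> I"
proof -
  interpret e: ring_hom_ring A F \<epsilon> by (rule augmentation_ring_hom)
  show "g \<in> carrier G \<Longrightarrow> \<delta> g \<ominus>\<^bsub>A\<^esub> \<one>\<^bsub>A\<^esub> \<in> I"
    by (simp add: augmentation_ideal_def A.minus_eq augmentation_basis F.r_neg)
qed

text \<open>On a product \<open>i j\<close> write \<open>h (i j) - i j = (h i - i) h j + i (h j - j)\<close>; the first bracket lies in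
  \<open>I\<^sup>2\<close>, the second gains a power by induction.\<close>

lemma unipotent_step:
  assumes h: "h \<in> algebra_hom F A A" and u: "\<And>x. x \<in> I \<Longrightarrow> h x \<ominus>\<^bsub>A\<^esub> x \<in> P 2"
    and "x \<in> P (Suc k)"
  shows "h x \<ominus>\<^bsub>A\<^esub> x \<in> P (Suc (Suc k))"
  using assms(3)
proof (induction k arbitrary: x)
  case 0
  then show ?case using u P_one by (simp add: numeral_2_eq_2)
next
  case (Suc k)
  note hc = algebra_homD(1)[OF h]
  have "x \<in> ideal_prod A I (P (Suc k))" using Suc.prems by (simp add: augmentation_power_Suc)
  then show ?case
  proof (induction rule: ideal_prod.induct)
    case (prod i j)
    have c: "i \<in> carrier A" "j \<in> carrier A" "h i \<in> carrier A" "h j \<in> carrier A"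
      using augmentation_ideal_closed[OF prod(1)] P_closed[OF prod(2)] hc by blast+
    have "h j \<ominus>\<^bsub>A\<^esub> j \<in> P (Suc k)" using Suc.IH[OF prod(2)] P_Suc_subset[of "Suc k"] by blast
    then have "(h j \<ominus>\<^bsub>A\<^esub> j) \<oplus>\<^bsub>A\<^esub> j \<in> P (Suc k)" using prod(2) P_add by blast
    then have hj: "h j \<in> P (Suc k)"
      using c by (simp only: A.add_minus_cancel)
    have "h (i \<otimes>\<^bsub>A\<^esub> j) \<ominus>\<^bsub>A\<^esub> i \<otimes>\<^bsub>A\<^esub> j = (h i \<ominus>\<^bsub>A\<^esub> i) \<otimes>\<^bsub>A\<^esub> h j \<oplus>\<^bsub>A\<^esub> i \<otimes>\<^bsub>A\<^esub> (h j \<ominus>\<^bsub>A\<^esub> j)"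
    proof -
      have "(h i \<ominus>\<^bsub>A\<^esub> i) \<otimes>\<^bsub>A\<^esub> h j = h i \<otimes>\<^bsub>A\<^esub> h j \<ominus>\<^bsub>A\<^esub> i \<otimes>\<^bsub>A\<^esub> h j"
        "i \<otimes>\<^bsub>A\<^esub> (h j \<ominus>\<^bsub>A\<^esub> j) = i \<otimes>\<^bsub>A\<^esub> h j \<ominus>\<^bsub>A\<^esub> i \<otimes>\<^bsub>A\<^esub> j"
        using c by (simp_all add: A.minus_eq A.l_distr A.r_distr A.l_minus A.r_minus)
      then show ?thesis using c by (simp add: algebra_homD(2)[OF h] A.minus_telescope)
    qed
    moreover have "(h i \<ominus>\<^bsub>A\<^esub> i) \<otimes>\<^bsub>A\<^esub> h j \<in> P (Suc (Suc (Suc k)))"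
      using P_two_mult[OF u[OF prod(1)] hj] .
    moreover have "i \<otimes>\<^bsub>A\<^esub> (h j \<ominus>\<^bsub>A\<^esub> j) \<in> P (Suc (Suc (Suc k)))"
      using ideal_prod.prod[OF prod(1) Suc.IH[OF prod(2)], of A] by (simp add: augmentation_power_Suc)
    ultimately show ?case using P_add by simp
  next
    case (sum s t)
    have c: "s \<in> carrier A" "t \<in> carrier A"
      using sum(1,2) P_closed[of _ "Suc (Suc k)"] by (auto simp: augmentation_power_Suc)
    then have "h (s \<oplus>\<^bsub>A\<^esub> t) \<ominus>\<^bsub>A\<^esub> (s \<oplus>\<^bsub>A\<^esub> t) = (h s \<ominus>\<^bsub>A\<^esub> s) \<oplus>\<^bsub>A\<^esub> (h t \<ominus>\<^bsub>A\<^esub> t)"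
      using hc by (simp add: algebra_homD(3)[OF h] A.minus_eq A.minus_add A.add.m_ac)
    then show ?case using sum P_add by simp
  qed
qed

text \<open>An endomorphism that is trivial on \<open>I / I\<^sup>2\<close> is trivial on all graded pieces of the filtration by
  powers of \<open>I\<close>. It fixes the scalars, so nilpotency of \<open>I\<close> makes it bijective.\<close>

lemma unipotent_bij:
  assumes h: "h \<in> algebra_hom F A A" and u: "\<And>x. x \<in> I \<Longrightarrow> h x \<ominus>\<^bsub>A\<^esub> x \<in> P 2"
    and nil: "P n = {\<zero>\<^bsub>A\<^esub>}"
  shows "bij_betw h (carrier A) (carrier A)"
proof -
  interpret h: ring_hom_ring A A h
    by (rule algebra_hom_ring_hom_ring[OF h ring_A ring_A])
  interpret e: ring_hom_ring A F \<epsilon> by (rule augmentation_ring_hom)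
  note hc = algebra_homD(1)[OF h]
  have step: "h x \<ominus>\<^bsub>A\<^esub> x \<in> P (Suc (Suc k))" if "x \<in> P (Suc k)" for x k
    using unipotent_step[OF h u that] .
  have P_zero: "x = \<zero>\<^bsub>A\<^esub>" if "x \<in> P (Suc n)" for x
    using that P_Suc_subset[of n] nil by blast
  have scalar: "h (a \<odot>\<^bsub>A\<^esub> \<one>\<^bsub>A\<^esub>) = a \<odot>\<^bsub>A\<^esub> \<one>\<^bsub>A\<^esub>" if "a \<in> carrier F" for a
    using that by (simp add: algebra_homD(5)[OF h])
  have \<epsilon>h: "\<epsilon> (h x) = \<epsilon> x" if x: "x \<in> carrier A" for x
  proof -
    have i: "x \<ominus>\<^bsub>A\<^esub> \<epsilon> x \<odot>\<^bsub>A\<^esub> \<one>\<^bsub>A\<^esub> \<in> I" using minus_augmentation[OF x] .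
    have "h (x \<ominus>\<^bsub>A\<^esub> \<epsilon> x \<odot>\<^bsub>A\<^esub> \<one>\<^bsub>A\<^esub>) \<ominus>\<^bsub>A\<^esub> (x \<ominus>\<^bsub>A\<^esub> \<epsilon> x \<odot>\<^bsub>A\<^esub> \<one>\<^bsub>A\<^esub>) = h x \<ominus>\<^bsub>A\<^esub> x"
      using x hc[OF x] algebra_hom_minus(1)[OF h ring_A ring_A, of x "\<epsilon> x \<odot>\<^bsub>A\<^esub> \<one>\<^bsub>A\<^esub>"]
      by (simp add: scalar A.minus_minus_cancel)
    then have "h x \<ominus>\<^bsub>A\<^esub> x \<in> I" using u[OF i] P_two_subset by auto
    then have "\<epsilon> (h x) \<ominus>\<^bsub>F\<^esub> \<epsilon> x = \<zero>\<^bsub>F\<^esub>"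
      using x hc[OF x] by (simp add: augmentation_ideal_def A.minus_eq F.minus_eq)
    then show ?thesis using x hc[OF x] by simp
  qed
  have "inj_on h (carrier A)"
  proof (rule h.trivial_ker_imp_inj)
    have "x = \<zero>\<^bsub>A\<^esub>" if x: "x \<in> carrier A" "h x = \<zero>\<^bsub>A\<^esub>" for x
    proof -
      have "x \<in> P (Suc k)" for k
      proof (induction k)
        case 0
        have "\<epsilon> x = \<zero>\<^bsub>F\<^esub>" using \<epsilon>h[OF x(1)] x by simp
        then show ?case unfolding P_one using x by (simp add: augmentation_ideal_def)
      next
        case (Suc k)
        have "h x \<ominus>\<^bsub>A\<^esub> x = \<ominus>\<^bsub>A\<^esub> x" using x by (simp add: A.minus_eq)
        then have "\<ominus>\<^bsub>A\<^esub> (\<ominus>\<^bsub>A\<^esub> x) \<in> P (Suc (Suc k))"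
          using additive_subgroup.a_inv_closed[OF ideal.axioms(1)[OF ideal_P] step[OF Suc]] by simp
        then show ?case using x by simp
      qed
      then show ?thesis using P_zero by blast
    qed
    then show "a_kernel A A h = {\<zero>\<^bsub>A\<^esub>}"
      unfolding a_kernel_def' using h.hom_zero A.zero_closed by blast
  qed
  moreover have "h ` carrier A = carrier A"
  proof
    show "h ` carrier A \<subseteq> carrier A" using hc by auto
    have sum_im: "x \<oplus>\<^bsub>A\<^esub> y \<in> h ` carrier A" if xy: "x \<in> h ` carrier A" "y \<in> h ` carrier A" for x y
    proof -
      obtain a b where "x = h a" "y = h b" "a \<in> carrier A" "b \<in> carrier A" using xy by auto
      then have "x \<oplus>\<^bsub>A\<^esub> y = h (a \<oplus>\<^bsub>A\<^esub> b)" "a \<oplus>\<^bsub>A\<^esub> b \<in> carrier A" by auto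
      then show ?thesis by blast
    qed
    \<comment> \<open>descending induction: \<open>y = h y + (y - h y)\<close>, where the bracket lies one power deeper\<close>
    have ideal_im: "y \<in> h ` carrier A" if "y \<in> P (Suc k)" "k \<le> n" for y k
      using that(2,1)
    proof (induction arbitrary: y rule: inc_induct)
      case base
      then have "y = h \<zero>\<^bsub>A\<^esub>" using P_zero[of y] by simp
      then show ?case by blast
    next
      case (step k)
      have c: "y \<in> carrier A" "h y \<in> carrier A" using step.prems P_closed hc by auto
      have "y \<ominus>\<^bsub>A\<^esub> h y \<in> P (Suc (Suc k))"
        by (rule A.ideal_minus_sym[OF ideal_P c(2,1) unipotent_step[OF h u step.prems]])
      then have "h y \<oplus>\<^bsub>A\<^esub> (y \<ominus>\<^bsub>A\<^esub> h y) \<in> h ` carrier A"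
        using c(1) by (intro sum_im[OF imageI step.IH])
      moreover have "h y \<oplus>\<^bsub>A\<^esub> (y \<ominus>\<^bsub>A\<^esub> h y) = y"
        using c by (simp only: A.add_minus_cancel)
      ultimately show ?case by simp
    qed
    show "carrier A \<subseteq> h ` carrier A"
    proof
      fix y assume y: "y \<in> carrier A"
      have "\<epsilon> y \<odot>\<^bsub>A\<^esub> \<one>\<^bsub>A\<^esub> \<in> h ` carrier A"
        using scalar[of "\<epsilon> y"] y by (metis A.one_closed Alg.smult_closed augmentation_closed image_eqI)
      moreover have "y \<ominus>\<^bsub>A\<^esub> \<epsilon> y \<odot>\<^bsub>A\<^esub> \<one>\<^bsub>A\<^esub> \<in> h ` carrier A"
        using ideal_im[of _ 0] minus_augmentation[OF y] P_one by blast
      ultimately have "\<epsilon> y \<odot>\<^bsub>A\<^esub> \<one>\<^bsub>A\<^esub> \<oplus>\<^bsub>A\<^esub> (y \<ominus>\<^bsub>A\<^esub> \<epsilon> y \<odot>\<^bsub>A\<^esub> \<one>\<^bsub>A\<^esub>) \<in> h ` carrier A"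
        by (rule sum_im)
      then show "y \<in> h ` carrier A"
        using y by (simp add: A.add_minus_cancel)
    qed
  qed
  ultimately show ?thesis by (simp add: bij_betw_def)
qed

end

lemma algebra_hom_augmentation_power:
  assumes "finite_group_algebra F G" "finite_group_algebra F H"
    and h: "h \<in> algebra_hom F (group_algebra F G) (group_algebra F H)"
    and aug: "\<And>x. x \<in> carrier (group_algebra F G) \<Longrightarrow> augmentation F H (h x) = augmentation F G x"
    and "x \<in> augmentation_power F G k"
  shows "h x \<in> augmentation_power F H k"
  using assms(5)
proof (induction k arbitrary: x)
  case 0
  then show ?case by (simp add: algebra_homD(1)[OF h])
next
  case (Suc k)
  interpret G: finite_group_algebra F G by fact
  interpret H: finite_group_algebra F H by fact
  have hI: "h i \<in> H.I" if "i \<in> G.I" for i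
    using that by (simp add: augmentation_ideal_def aug algebra_homD(1)[OF h])
  have "x \<in> ideal_prod G.A G.I (G.P k)" using Suc.prems by (simp add: augmentation_power_Suc)
  then show ?case
  proof (induction rule: ideal_prod.induct)
    case (prod i j)
    then have "h (i \<otimes>\<^bsub>G.A\<^esub> j) = h i \<otimes>\<^bsub>H.A\<^esub> h j"
      by (intro algebra_homD(2)[OF h] G.augmentation_ideal_closed G.P_closed)
    then show ?case
      using ideal_prod.prod[OF hI[OF prod(1)] Suc.IH[OF prod(2)], of H.A]
      by (simp add: augmentation_power_Suc)
  next
    case (sum s t)
    have "s \<in> carrier G.A" "t \<in> carrier G.A"
      using sum(1,2) G.P_closed[of _ "Suc k"] by (auto simp: augmentation_power_Suc)
    then show ?case using H.P_add[OF sum(3,4)] by (simp only: augmentation_power_Suc algebra_homD(3)[OF h])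
  qed
qed

section \<open>Orbit sums modulo p\<close>

text \<open>The orbit length divides the group order, which is a power of \<open>p\<close>, and it is not 1.\<close>

lemma p_group_orbit_card:
  fixes G :: "('a, 'c) monoid_scheme" and act :: "'a \<Rightarrow> 'e \<Rightarrow> 'e"
  assumes G: "group G" "order G = p ^ n" and p: "Factorial_Ring.prime p"
    and closed: "\<And>g x. g \<in> carrier G \<Longrightarrow> x \<in> E \<Longrightarrow> act g x \<in> E"
    and one: "\<And>x. x \<in> E \<Longrightarrow> act \<one>\<^bsub>G\<^esub> x = x"
    and mult: "\<And>g h x. g \<in> carrier G \<Longrightarrow> h \<in> carrier G \<Longrightarrow> x \<in> E \<Longrightarrow>
      act (g \<otimes>\<^bsub>G\<^esub> h) x = act g (act h x)"
    and x: "x \<in> E" and g: "g \<in> carrier G" "act g x \<noteq> x"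
  shows "p dvd card ((\<lambda>g. act g x) ` carrier G)"
proof -
  interpret G: group G by fact
  let ?\<phi> = "\<lambda>g. restrict (act g) E"
  have inv: "act (inv\<^bsub>G\<^esub> g) (act g y) = y" "act g (act (inv\<^bsub>G\<^esub> g) y) = y"
    if "g \<in> carrier G" "y \<in> E" for g y
    using that mult[of "inv\<^bsub>G\<^esub> g" g y] mult[of g "inv\<^bsub>G\<^esub> g" y] by (auto simp: one)
  have bij: "?\<phi> g \<in> Bij E" if "g \<in> carrier G" for g
    unfolding Bij_def
  proof (intro IntI CollectI)
    show "bij_betw (?\<phi> g) E E"
      using that by (intro bij_betw_byWitness[where f' = "act (inv\<^bsub>G\<^esub> g)"]) (auto simp: closed inv)
  qed simp
  have "group_hom G (BijGroup E) ?\<phi>"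
  proof (intro group_hom.intro group_hom_axioms.intro)
    show "?\<phi> \<in> hom G (BijGroup E)"
    proof (rule homI)
      fix g h assume gh: "g \<in> carrier G" "h \<in> carrier G"
      have "?\<phi> (g \<otimes>\<^bsub>G\<^esub> h) = compose E (?\<phi> g) (?\<phi> h)"
        using gh by (auto simp: compose_def mult closed)
      then show "?\<phi> (g \<otimes>\<^bsub>G\<^esub> h) = ?\<phi> g \<otimes>\<^bsub>BijGroup E\<^esub> ?\<phi> h"
        using bij gh by (simp add: BijGroup_def)
    qed (use bij in \<open>auto simp: BijGroup_def\<close>)
  qed (auto intro: G group_BijGroup)
  then interpret act: group_action G E ?\<phi> by (rule group_action.intro)
  have orb: "orbit G ?\<phi> x = (\<lambda>g. act g x) ` carrier G"
    using x by (auto simp: orbit_def)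
  have "card (orbit G ?\<phi> x) * card (stabilizer G ?\<phi> x) = p ^ n"
    using act.orbit_stabilizer_theorem[OF x] G(2) by simp
  then have "card (orbit G ?\<phi> x) dvd p ^ n" by (metis dvd_triv_left)
  then obtain k where k: "card (orbit G ?\<phi> x) = p ^ k"
    using p by (auto simp: divides_primepow_nat)
  have "k \<noteq> 0"
  proof
    assume "k = 0"
    then obtain y where "(\<lambda>g. act g x) ` carrier G = {y}"
      using k by (auto simp: card_1_singleton_iff orb)
    then have "act g x \<in> {y}" "act \<one>\<^bsub>G\<^esub> x \<in> {y}"
      using imageI[OF g(1), of "\<lambda>g. act g x"] imageI[OF G.one_closed, of "\<lambda>g. act g x"] by simp_all
    then have "act g x = act \<one>\<^bsub>G\<^esub> x" by simp
    then show False using g x one by simp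
  qed
  then show ?thesis using k by (simp add: orb)
qed

text \<open>Orbits other than fixed points have length divisible by \<open>p\<close>, so an invariant function sums to zero
  over each of them. With the constant function 1 this is the usual congruence between the number of
  all points and the number of fixed points; for conjugation it removes the noncentral classes.\<close>

lemma p_group_fixed_points_sum:
  fixes G :: "('a, 'c) monoid_scheme" and act :: "'a \<Rightarrow> 'e \<Rightarrow> 'e"
    and M :: "('x, 'y) ring_scheme"
  assumes G: "group G" "order G = p ^ n" and p: "Factorial_Ring.prime p"
    and E: "finite E" and closed: "\<And>g x. g \<in> carrier G \<Longrightarrow> x \<in> E \<Longrightarrow> act g x \<in> E"
    and one: "\<And>x. x \<in> E \<Longrightarrow> act \<one>\<^bsub>G\<^esub> x = x"
    and mult: "\<And>g h x. g \<in> carrier G \<Longrightarrow> h \<in> carrier G \<Longrightarrow> x \<in> E \<Longrightarrow>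
      act (g \<otimes>\<^bsub>G\<^esub> h) x = act g (act h x)"
    and M: "abelian_group M"
    and exponent: "\<And>m. m \<in> carrier M \<Longrightarrow> [p] \<cdot>\<^bsub>M\<^esub> m = \<zero>\<^bsub>M\<^esub>"
    and f: "\<And>x. x \<in> E \<Longrightarrow> f x \<in> carrier M"
    and inv: "\<And>g x. g \<in> carrier G \<Longrightarrow> x \<in> E \<Longrightarrow> f (act g x) = f x"
  shows "(\<Oplus>\<^bsub>M\<^esub>x\<in>E. f x) = (\<Oplus>\<^bsub>M\<^esub>x\<in>{x \<in> E. \<forall>g\<in>carrier G. act g x = x}. f x)"
  using E closed one mult f inv
proof (induction "card E" arbitrary: E rule: less_induct)
  case less
  note lE = less.prems
  interpret G: group G by fact
  interpret M: abelian_group M by fact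
  let ?fix = "\<lambda>E. {x \<in> E. \<forall>g\<in>carrier G. act g x = x}"
  show ?case
  proof (cases "?fix E = E")
    case True
    then show ?thesis by simp
  next
    case False
    then obtain x g where x: "x \<in> E" and g: "g \<in> carrier G" "act g x \<noteq> x" by blast
    define U where "U = (\<lambda>g. act g x) ` carrier G"
    have "act \<one>\<^bsub>G\<^esub> x \<in> U" unfolding U_def by (intro imageI G.one_closed)
    then have xU: "x \<in> U" using lE(3)[OF x] by simp
    have UE: "U \<subseteq> E" using lE(2) x by (auto simp: U_def)
    have finU: "finite U" using UE lE(1) finite_subset by blast
    have pU: "p dvd card U"
      unfolding U_def by (rule p_group_orbit_card[where act = act, OF G p lE(2,3,4) x g])
    have actU: "act h y \<in> U" if hy: "h \<in> carrier G" "y \<in> U" for h y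
    proof -
      obtain k where k: "k \<in> carrier G" "y = act k x" using hy(2) by (auto simp: U_def)
      then have "act h y = act (h \<otimes>\<^bsub>G\<^esub> k) x" using lE(4)[OF hy(1) k(1) x] by simp
      then show ?thesis using hy k by (auto simp: U_def)
    qed
    have act_inv: "act (inv\<^bsub>G\<^esub> h) (act h y) = y" if "h \<in> carrier G" "y \<in> E" for h y
      using that lE(4)[of "inv\<^bsub>G\<^esub> h" h y] lE(3) by simp
    have closed': "act h y \<in> E - U" if hy: "h \<in> carrier G" "y \<in> E - U" for h y
    proof
      show "act h y \<in> E" using hy lE(2) by simp
      show "act h y \<notin> U"
        using actU[of "inv\<^bsub>G\<^esub> h" "act h y"] act_inv[of h y] hy by auto
    qed
    have "?fix E \<inter> U = {}"
    proof -
      \<comment> \<open>no point of the orbit is fixed, because \<open>x\<close> is not\<close>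
    have False if yU: "y \<in> U" and fy: "\<forall>h\<in>carrier G. act h y = y" for y
      proof -
        obtain k where k: "k \<in> carrier G" "y = act k x" using yU unfolding U_def by (rule imageE)
        have "x = y" using act_inv[OF k(1) x] fy k by (metis G.inv_closed)
        then show ?thesis using g fy by auto
      qed
      then show ?thesis by blast
    qed
    then have fixE: "?fix (E - U) = ?fix E" by auto
    have IH: "(\<Oplus>\<^bsub>M\<^esub>x\<in>E - U. f x) = (\<Oplus>\<^bsub>M\<^esub>x\<in>?fix (E - U). f x)"
    proof (rule less.hyps)
      show "card (E - U) < card E"
        using xU UE lE(1) by (intro psubset_card_mono) auto
    qed (use lE closed' in auto)
    have fU: "f y \<in> carrier M" if "y \<in> U" for y using that UE lE(5) by auto
    have "(\<Oplus>\<^bsub>M\<^esub>y\<in>U. f y) = (\<Oplus>\<^bsub>M\<^esub>y\<in>U. f x)"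
      using lE(5)[OF x] by (intro M.finsum_cong' refl) (auto simp: U_def lE(6)[OF _ x])
    also have "\<dots> = [card U] \<cdot>\<^bsub>M\<^esub> f x"
      using lE(5)[OF x] by (rule M.add.finprod_const)
    also have "\<dots> = \<zero>\<^bsub>M\<^esub>"
    proof -
      obtain m where "card U = m * p" using pU by (metis dvd_def mult.commute)
      then show ?thesis
        using M.add.nat_pow_pow[OF lE(5)[OF x], of m p] exponent[OF lE(5)[OF x]]
        by (simp add: mult.commute)
    qed
    finally have zero: "(\<Oplus>\<^bsub>M\<^esub>y\<in>U. f y) = \<zero>\<^bsub>M\<^esub>" .
    have c: "(\<Oplus>\<^bsub>M\<^esub>y\<in>E - U. f y) \<in> carrier M"
      using lE(5) by (auto intro!: M.finsum_closed)
    have "E = U \<union> (E - U)" using UE by auto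
    then have "(\<Oplus>\<^bsub>M\<^esub>y\<in>E. f y) = (\<Oplus>\<^bsub>M\<^esub>y\<in>U \<union> (E - U). f y)" by simp
    also have "\<dots> = (\<Oplus>\<^bsub>M\<^esub>y\<in>U. f y) \<oplus>\<^bsub>M\<^esub> (\<Oplus>\<^bsub>M\<^esub>y\<in>E - U. f y)"
      using lE(1,5) finU fU by (intro M.finsum_Un_disjoint) auto
    also have "\<dots> = (\<Oplus>\<^bsub>M\<^esub>y\<in>E - U. f y)" using zero c by simp
    finally show ?thesis unfolding IH fixE .
  qed
qed


section \<open>The augmentation ideal of a p-group is nilpotent\<close>

locale p_group_algebra = finite_group_algebra F G
  for F :: "('f, 'm) ring_scheme" and G :: "('a, 'c) monoid_scheme" +
  fixes p :: nat
  assumes prime_p: "Factorial_Ring.prime p"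
    and order_G: "\<exists>n. order G = p ^ n"
    and char_F: "ring_char F = p"

lemma p_group_algebraI:
  assumes "field F" "Factorial_Ring.prime p" "ring_char F = p" "finite_p_group p G"
  shows "p_group_algebra F G p"
proof -
  interpret field F by fact
  obtain n where G: "group G" "order G = p ^ n" using assms(4) by (auto simp: finite_p_group_def)
  then have "card (carrier G) \<noteq> 0" using assms(2) by (simp add: order_def prime_gt_0_nat)
  then have "finite (carrier G)" using card_ge_0_finite by blast
  then show ?thesis
    using G assms by (intro p_group_algebra.intro finite_group_algebra.intro
      finite_group_algebra_axioms.intro p_group_algebra_axioms.intro) auto
qed

text \<open>The \<open>k\<close>-th set consists of the elements killed by all products of \<open>k\<close> differences \<open>g - 1\<close> from the
  left. This ascending filtration is easier to control than the powers of the augmentation ideal,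
  because a p-group acting on a nontrivial finite abelian p-group has nonzero fixed points.\<close>

primrec annihilator_filtration ::
    "('f, 'm) ring_scheme \<Rightarrow> ('a, 'c) monoid_scheme \<Rightarrow> nat \<Rightarrow> ('a \<Rightarrow> 'f) set" where
  "annihilator_filtration F G 0 = {\<zero>\<^bsub>group_algebra F G\<^esub>}"
| "annihilator_filtration F G (Suc k) = {f \<in> carrier (group_algebra F G). \<forall>g \<in> carrier G.
     basis F G g \<otimes>\<^bsub>group_algebra F G\<^esub> f \<ominus>\<^bsub>group_algebra F G\<^esub> f \<in> annihilator_filtration F G k}"

context p_group_algebra
begin

lemma F_exponent:
  assumes "a \<in> carrier F"
  shows "[p] \<cdot>\<^bsub>F\<^esub> a = \<zero>\<^bsub>F\<^esub>"
proof -
  have "\<one>\<^bsub>F\<^esub> [^]\<^bsub>add_monoid F\<^esub> group.ord (add_monoid F) \<one>\<^bsub>F\<^esub> = \<one>\<^bsub>add_monoid F\<^esub>"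
    by (rule group.pow_ord_eq_1) (auto intro: F.a_group)
  then have "[p] \<cdot>\<^bsub>F\<^esub> \<one>\<^bsub>F\<^esub> = \<zero>\<^bsub>F\<^esub>"
    using char_F by (simp add: ring_char_def add_pow_def)
  then show ?thesis
    using F.add_pow_ldistr[of "\<one>\<^bsub>F\<^esub>" a p] assms by simp
qed

lemma A_exponent:
  assumes "f \<in> carrier A"
  shows "[p] \<cdot>\<^bsub>A\<^esub> f = \<zero>\<^bsub>A\<^esub>"
proof -
  have *: "[k] \<cdot>\<^bsub>A\<^esub> f = ([k] \<cdot>\<^bsub>F\<^esub> \<one>\<^bsub>F\<^esub>) \<odot>\<^bsub>A\<^esub> f" for k :: nat
    using assms by (induction k) (auto simp: Alg.smult_l_distr)
  show ?thesis using assms F_exponent[of "\<one>\<^bsub>F\<^esub>"] by (simp add: *)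
qed

abbreviation N where "N \<equiv> annihilator_filtration F G"

declare annihilator_filtration.simps(2) [simp del]

lemma mem_N_Suc:
  "f \<in> N (Suc k) \<longleftrightarrow> f \<in> carrier A \<and> (\<forall>g \<in> carrier G. \<delta> g \<otimes>\<^bsub>A\<^esub> f \<ominus>\<^bsub>A\<^esub> f \<in> N k)"
  by (simp add: annihilator_filtration.simps(2))

lemma N_closed: "f \<in> N k \<Longrightarrow> f \<in> carrier A"
  by (cases k) (auto simp: mem_N_Suc)

lemma N_zero: "\<zero>\<^bsub>A\<^esub> \<in> N k"
  by (induction k) (auto simp: mem_N_Suc A.minus_eq)

lemma N_add: "f \<in> N k \<Longrightarrow> h \<in> N k \<Longrightarrow> f \<oplus>\<^bsub>A\<^esub> h \<in> N k"
proof (induction k arbitrary: f h)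
  case (Suc k)
  have "\<delta> g \<otimes>\<^bsub>A\<^esub> (f \<oplus>\<^bsub>A\<^esub> h) \<ominus>\<^bsub>A\<^esub> (f \<oplus>\<^bsub>A\<^esub> h)
      = (\<delta> g \<otimes>\<^bsub>A\<^esub> f \<ominus>\<^bsub>A\<^esub> f) \<oplus>\<^bsub>A\<^esub> (\<delta> g \<otimes>\<^bsub>A\<^esub> h \<ominus>\<^bsub>A\<^esub> h)" for g
    using N_closed[OF Suc.prems(1)] N_closed[OF Suc.prems(2)]
    by (simp add: A.r_distr A.minus_eq A.minus_add A.add.m_ac)
  then show ?case using Suc unfolding mem_N_Suc by auto
qed simp

lemma N_mult_right: "f \<in> N k \<Longrightarrow> h \<in> carrier A \<Longrightarrow> f \<otimes>\<^bsub>A\<^esub> h \<in> N k"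
proof (induction k arbitrary: f)
  case (Suc k)
  have "\<delta> g \<otimes>\<^bsub>A\<^esub> (f \<otimes>\<^bsub>A\<^esub> h) \<ominus>\<^bsub>A\<^esub> f \<otimes>\<^bsub>A\<^esub> h = (\<delta> g \<otimes>\<^bsub>A\<^esub> f \<ominus>\<^bsub>A\<^esub> f) \<otimes>\<^bsub>A\<^esub> h" for g
    using N_closed[OF Suc.prems(1)] Suc.prems(2)
    by (simp add: A.minus_eq A.l_distr A.l_minus A.m_assoc)
  then show ?case using Suc unfolding mem_N_Suc by auto
qed simp

lemma N_smult:
  assumes "a \<in> carrier F" "f \<in> N k"
  shows "a \<odot>\<^bsub>A\<^esub> f \<in> N k"
proof -
  have "f \<otimes>\<^bsub>A\<^esub> (a \<odot>\<^bsub>A\<^esub> \<one>\<^bsub>A\<^esub>) = a \<odot>\<^bsub>A\<^esub> f"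
    using assms(1) N_closed[OF assms(2)] by (simp add: Alg.smult_mult_right)
  then show ?thesis using N_mult_right[OF assms(2), of "a \<odot>\<^bsub>A\<^esub> \<one>\<^bsub>A\<^esub>"] assms(1) by simp
qed

lemma N_additive_subgroup: "additive_subgroup (N k) A"
proof (rule additive_subgroup.intro, rule A.add.subgroupI)
  show "\<ominus>\<^bsub>A\<^esub> f \<in> N k" if "f \<in> N k" for f
    using N_smult[OF _ that, of "\<ominus>\<^bsub>F\<^esub> \<one>\<^bsub>F\<^esub>"] N_closed[OF that] by (simp add: Alg.smult_l_minus)
  show "N k \<noteq> {}" using N_zero[of k] by auto
qed (use N_closed N_add in auto)

lemma N_subset_Suc: "N k \<subseteq> N (Suc k)"
proof (induction k)
  case 0
  then show ?case by (auto simp: mem_N_Suc A.minus_eq)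
next
  case (Suc k)
  show ?case
  proof
    fix f assume "f \<in> N (Suc k)"
    then show "f \<in> N (Suc (Suc k))"
      using Suc unfolding mem_N_Suc[of f "Suc k"] mem_N_Suc[of f k] by blast
  qed
qed

lemma N_translate: "f \<in> N k \<Longrightarrow> g \<in> carrier G \<Longrightarrow> \<delta> g \<otimes>\<^bsub>A\<^esub> f \<in> N k"
proof -
  assume f: "f \<in> N k" and g: "g \<in> carrier G"
  have "\<delta> g \<otimes>\<^bsub>A\<^esub> f \<ominus>\<^bsub>A\<^esub> f \<in> N k"
    using f g N_subset_Suc[of k] mem_N_Suc[of f k] by blast
  then have "(\<delta> g \<otimes>\<^bsub>A\<^esub> f \<ominus>\<^bsub>A\<^esub> f) \<oplus>\<^bsub>A\<^esub> f \<in> N k" using f N_add by blast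
  then show ?thesis using N_closed[OF f] by (simp add: A.add_minus_cancel)
qed

lemma I_mult_N:
  assumes x: "x \<in> I" and f: "f \<in> N (Suc k)"
  shows "x \<otimes>\<^bsub>A\<^esub> f \<in> N k"
proof -
  have c: "x \<in> carrier A" "\<epsilon> x = \<zero>\<^bsub>F\<^esub>" "f \<in> carrier A"
    using x N_closed[OF f] by (auto simp: augmentation_ideal_def)
  have "x \<otimes>\<^bsub>A\<^esub> f = (\<Oplus>\<^bsub>A\<^esub>g\<in>carrier G. x g \<odot>\<^bsub>A\<^esub> (\<delta> g \<ominus>\<^bsub>A\<^esub> \<one>\<^bsub>A\<^esub>)) \<otimes>\<^bsub>A\<^esub> f"
    using I_expansion[OF c(1,2)] by simp
  also have "\<dots> = (\<Oplus>\<^bsub>A\<^esub>g\<in>carrier G. (x g \<odot>\<^bsub>A\<^esub> (\<delta> g \<ominus>\<^bsub>A\<^esub> \<one>\<^bsub>A\<^esub>)) \<otimes>\<^bsub>A\<^esub> f)"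
    using c finite_G by (intro A.finsum_ldistr) auto
  also have "\<dots> \<in> N k"
  proof (rule A.finsum_in_subgroup[OF N_additive_subgroup])
    fix g assume g: "g \<in> carrier G"
    have "(x g \<odot>\<^bsub>A\<^esub> (\<delta> g \<ominus>\<^bsub>A\<^esub> \<one>\<^bsub>A\<^esub>)) \<otimes>\<^bsub>A\<^esub> f = x g \<odot>\<^bsub>A\<^esub> (\<delta> g \<otimes>\<^bsub>A\<^esub> f \<ominus>\<^bsub>A\<^esub> f)"
      using c g by (simp add: Alg.smult_mult_left A.minus_eq A.l_distr A.l_minus)
    then show "(x g \<odot>\<^bsub>A\<^esub> (\<delta> g \<ominus>\<^bsub>A\<^esub> \<one>\<^bsub>A\<^esub>)) \<otimes>\<^bsub>A\<^esub> f \<in> N k"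
      using c g f mem_N_Suc N_smult by auto
  qed
  finally show ?thesis .
qed

text \<open>The additive span of the group elements. The field may be infinite, but this span is a finite
  p-group on which \<open>G\<close> acts, so fixed points can be counted in it.\<close>

definition prime_span :: "('a \<Rightarrow> 'f) set" where
  "prime_span = Pi\<^sub>E (carrier G) (\<lambda>_. generate (add_monoid F) {\<one>\<^bsub>F\<^esub>})"

lemma prime_subgroup: "additive_subgroup (generate (add_monoid F) {\<one>\<^bsub>F\<^esub>}) F"
  by (intro additive_subgroup.intro group.generate_is_subgroup[OF F.a_group]) auto

lemma card_prime_span: "card prime_span = p ^ card (carrier G)" and finite_prime_span: "finite prime_span"
proof -
  have c: "card (generate (add_monoid F) {\<one>\<^bsub>F\<^esub>}) = p"
    using group.generate_pow_card[OF F.a_group, of "\<one>\<^bsub>F\<^esub>"] char_F by (simp add: ring_char_def)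
  then show "card prime_span = p ^ card (carrier G)"
    unfolding prime_span_def using finite_G by (simp add: card_PiE)
  show "finite prime_span"
    unfolding prime_span_def using finite_G c prime_gt_0_nat[OF prime_p]
    by (intro finite_PiE) (auto intro: card_ge_0_finite)
qed

lemma prime_span_additive_subgroup: "additive_subgroup prime_span A"
proof -
  interpret K: additive_subgroup "generate (add_monoid F) {\<one>\<^bsub>F\<^esub>}" F by (rule prime_subgroup)
  have sub: "prime_span \<subseteq> carrier A" using K.a_subset by (auto simp: prime_span_def group_algebra_def PiE_iff)
  show ?thesis
  proof (rule additive_subgroup.intro, rule A.add.subgroupI)
    show "f \<oplus>\<^bsub>A\<^esub> h \<in> prime_span" if "f \<in> prime_span" "h \<in> prime_span" for f h
      using that by (auto simp: prime_span_def group_algebra_def PiE_iff)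
    show "\<ominus>\<^bsub>A\<^esub> f \<in> prime_span" if f: "f \<in> prime_span" for f
    proof -
      have "\<ominus>\<^bsub>A\<^esub> f = (\<ominus>\<^bsub>F\<^esub> \<one>\<^bsub>F\<^esub>) \<odot>\<^bsub>A\<^esub> f"
        using f sub by (simp add: subset_iff Alg.smult_l_minus)
      also have "\<dots> = (\<lambda>x\<in>carrier G. \<ominus>\<^bsub>F\<^esub> f x)"
        using f sub by (auto simp: group_algebra_def fun_eq_iff F.l_minus PiE_iff subset_iff)
      also have "\<dots> \<in> prime_span" using f by (auto simp: prime_span_def PiE_iff)
      finally show ?thesis .
    qed
    have "\<zero>\<^bsub>A\<^esub> \<in> prime_span" by (auto simp: prime_span_def group_algebra_def)
    then show "prime_span \<noteq> {}" by auto
  qed (use sub in auto)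
qed

lemma basis_in_prime_span: "\<delta> g \<in> prime_span"
proof -
  interpret K: additive_subgroup "generate (add_monoid F) {\<one>\<^bsub>F\<^esub>}" F by (rule prime_subgroup)
  show ?thesis by (auto simp: prime_span_def basis_def intro: generate.incl)
qed

lemma prime_span_translate:
  assumes "f \<in> prime_span" "g \<in> carrier G"
  shows "\<delta> g \<otimes>\<^bsub>A\<^esub> f \<in> prime_span"
proof -
  have f: "f \<in> carrier A" using assms(1) additive_subgroup.a_subset[OF prime_span_additive_subgroup] by auto
  have "\<delta> g \<otimes>\<^bsub>A\<^esub> f \<in> extensional (carrier G)"
    using A.m_closed[OF basis_closed f] by (auto simp: group_algebra_def PiE_iff)
  then show ?thesis
    using assms f by (auto simp: prime_span_def PiE_iff basis_mult_apply)
qed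

text \<open>\<open>G\<close> acts on the cosets of \<open>prime_span \<inter> N k\<close> in \<open>prime_span\<close>. Their number is a power of \<open>p\<close> greater
  than 1, so the zero coset is not the only fixed one; a representative \<open>f\<close> of another fixed coset
  satisfies \<open>g f - f \<in> N k\<close> for all \<open>g\<close>.\<close>

lemma N_grows:
  assumes "\<not> prime_span \<subseteq> N k"
  shows "prime_span \<inter> N k \<subset> prime_span \<inter> N (Suc k)"
proof -
  interpret X: additive_subgroup prime_span A by (rule prime_span_additive_subgroup)
  interpret N: additive_subgroup "N k" A by (rule N_additive_subgroup)
  define M where "M = prime_span \<inter> N k"
  let ?X = "add_monoid A \<lparr>carrier := prime_span\<rparr>"
  have group_X: "group ?X"
    using group.subgroup_imp_group[OF A.a_group X.a_subgroup] by simp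
  interpret M: additive_subgroup M A
    unfolding M_def using group.subgroups_Inter_pair[OF A.a_group X.a_subgroup N.a_subgroup]
    by (rule additive_subgroup.intro)
  have MX: "M \<subseteq> prime_span" and MA: "M \<subseteq> carrier A" using M.a_subset by (auto simp: M_def)
  have M: "subgroup M ?X"
    using group.subgroup_incl[OF A.a_group M.a_subgroup X.a_subgroup] MX by simp
  have M_translate: "\<delta> g \<otimes>\<^bsub>A\<^esub> m \<in> M" if "m \<in> M" "g \<in> carrier G" for m g
    using that prime_span_translate N_translate by (auto simp: M_def)
  define coset where "coset f = (\<lambda>m. m \<oplus>\<^bsub>A\<^esub> f) ` M" for f
  have rc: "rcosets\<^bsub>?X\<^esub> M = coset ` prime_span"
    by (auto simp: RCOSETS_def r_coset_def coset_def image_def)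
  have self: "f \<in> coset f" if "f \<in> prime_span" for f
    using that M.zero_closed X.a_subset unfolding coset_def
    by (intro image_eqI[of _ _ "\<zero>\<^bsub>A\<^esub>"]) auto
  have coset_zero: "coset \<zero>\<^bsub>A\<^esub> = M"
    using MA by (force simp: coset_def)
  define act where "act g C = (\<lambda>f. \<delta> g \<otimes>\<^bsub>A\<^esub> f) ` C" for g and C :: "('a \<Rightarrow> 'f) set"
  have act_coset: "act g (coset f) = coset (\<delta> g \<otimes>\<^bsub>A\<^esub> f)"
    if g: "g \<in> carrier G" and f: "f \<in> prime_span" for g f
  proof -
    have fA: "f \<in> carrier A" using f X.a_subset by auto
    have cancel: "\<delta> g \<otimes>\<^bsub>A\<^esub> (\<delta> (inv\<^bsub>G\<^esub> g) \<otimes>\<^bsub>A\<^esub> m) = m" if "m \<in> carrier A" for m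
      using that g A.m_assoc[of "\<delta> g" "\<delta> (inv\<^bsub>G\<^esub> g)" m]
      by (simp add: basis_mult flip: one_eq_basis)
    have "(\<lambda>m. \<delta> g \<otimes>\<^bsub>A\<^esub> m) ` M = M"
    proof
      show "M \<subseteq> (\<lambda>m. \<delta> g \<otimes>\<^bsub>A\<^esub> m) ` M"
      proof
        fix m assume m: "m \<in> M"
        then have "m = \<delta> g \<otimes>\<^bsub>A\<^esub> (\<delta> (inv\<^bsub>G\<^esub> g) \<otimes>\<^bsub>A\<^esub> m)" using cancel MA by auto
        then show "m \<in> (\<lambda>m. \<delta> g \<otimes>\<^bsub>A\<^esub> m) ` M" using M_translate[OF m, of "inv\<^bsub>G\<^esub> g"] g by blast
      qed
    qed (use M_translate g in auto)
    then have "coset (\<delta> g \<otimes>\<^bsub>A\<^esub> f) = (\<lambda>m. m \<oplus>\<^bsub>A\<^esub> \<delta> g \<otimes>\<^bsub>A\<^esub> f) ` (\<lambda>m. \<delta> g \<otimes>\<^bsub>A\<^esub> m) ` M"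
      by (simp add: coset_def)
    also have "\<dots> = act g (coset f)"
      unfolding act_def coset_def image_image using MA fA
      by (intro image_cong refl) (auto simp: A.r_distr subset_iff)
    finally show ?thesis by simp
  qed
  let ?E = "coset ` prime_span" and ?fix = "{C \<in> coset ` prime_span. \<forall>g\<in>carrier G. act g C = C}"
  obtain n where n: "order G = p ^ n" using order_G by auto
  have finE: "finite ?E" using finite_prime_span by simp
  have one: "(\<Oplus>\<^bsub>F\<^esub>C\<in>E. \<one>\<^bsub>F\<^esub>) = [card E] \<cdot>\<^bsub>F\<^esub> \<one>\<^bsub>F\<^esub>" for E :: "('a \<Rightarrow> 'f) set set"
    by (rule F.add.finprod_const) simp
  have eq: "[card ?E] \<cdot>\<^bsub>F\<^esub> \<one>\<^bsub>F\<^esub> = [card ?fix] \<cdot>\<^bsub>F\<^esub> \<one>\<^bsub>F\<^esub>"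
    unfolding one[symmetric]
  proof (rule p_group_fixed_points_sum[OF G.group_axioms n prime_p finE])
    show "act \<one>\<^bsub>G\<^esub> C = C" if "C \<in> ?E" for C
      using that X.a_subset by (auto simp: act_coset simp flip: one_eq_basis)
    show "act (g \<otimes>\<^bsub>G\<^esub> h) C = act g (act h C)" if "g \<in> carrier G" "h \<in> carrier G" "C \<in> ?E" for g h C
      using that X.a_subset prime_span_translate
      by (auto simp: act_coset A.m_assoc subset_iff simp flip: basis_mult)
  qed (use prime_span_translate in \<open>auto simp: act_coset F.abelian_group_axioms F_exponent\<close>)
  have "p dvd card ?E"
  proof -
    have "card (rcosets\<^bsub>?X\<^esub> M) * card M = p ^ card (carrier G)"
      using group.lagrange[OF group_X M] card_prime_span by (simp add: order_def)
    then have lag: "card ?E * card M = p ^ card (carrier G)" unfolding rc .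
    then have "card ?E dvd p ^ card (carrier G)" by (metis dvd_triv_left)
    then obtain j where j: "card ?E = p ^ j" using prime_p by (auto simp: divides_primepow_nat)
    have "card M \<noteq> card prime_span"
      using assms MX finite_prime_span card_subset_eq[of prime_span M] by (auto simp: M_def)
    then have "j \<noteq> 0" using lag j card_prime_span by (cases j) auto
    then show ?thesis using j by simp
  qed
  then obtain m where "card ?E = p * m" by (auto simp: dvd_def)
  then have "[card ?E] \<cdot>\<^bsub>F\<^esub> \<one>\<^bsub>F\<^esub> = \<zero>\<^bsub>F\<^esub>"
    using F.add.nat_pow_pow[of "\<one>\<^bsub>F\<^esub>" m p] F_exponent[of "\<one>\<^bsub>F\<^esub>"] by simp
  then have ne: "?fix \<noteq> {coset \<zero>\<^bsub>A\<^esub>}" using eq by (auto simp: card_1_singleton_iff)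
  have mem: "coset \<zero>\<^bsub>A\<^esub> \<in> ?fix"
    using X.zero_closed by (auto simp: act_coset)
  have "\<exists>c. c \<in> S \<and> c \<noteq> a" if "S \<noteq> {a}" "a \<in> S" for S and a :: "('a \<Rightarrow> 'f) set"
    using that by auto
  from this[OF ne mem] obtain C where C: "C \<in> ?fix" "C \<noteq> coset \<zero>\<^bsub>A\<^esub>" by (elim exE conjE)
  then obtain f where f: "f \<in> prime_span" "C = coset f" by blast
  have act_C: "act g C = C" if "g \<in> carrier G" for g using C(1) that by blast
  have fA: "f \<in> carrier A" using f X.a_subset by auto
  have "f \<notin> M"
  proof
    assume fM: "f \<in> M"
    have "coset f = M"
    proof
      show "coset f \<subseteq> M" using fM M.a_closed by (auto simp: coset_def)
      show "M \<subseteq> coset f"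
      proof
        fix m assume m: "m \<in> M"
        then have "m = (m \<ominus>\<^bsub>A\<^esub> f) \<oplus>\<^bsub>A\<^esub> f" using MA fA by (auto simp: A.add_minus_cancel)
        moreover have "m \<ominus>\<^bsub>A\<^esub> f \<in> M" using m fM by (simp add: A.minus_eq M.a_closed M.a_inv_closed)
        ultimately show "m \<in> coset f" unfolding coset_def by blast
      qed
    qed
    then show False using C(2) f(2) coset_zero by simp
  qed
  moreover have "f \<in> N (Suc k)"
    unfolding mem_N_Suc
  proof (intro conjI ballI fA)
    fix g assume g: "g \<in> carrier G"
    have "\<delta> g \<otimes>\<^bsub>A\<^esub> f \<in> coset (\<delta> g \<otimes>\<^bsub>A\<^esub> f)" using self prime_span_translate f g by blast
    also have "\<dots> = coset f" using act_C[OF g] act_coset[OF g f(1)] f(2) by simp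
    finally obtain m where m: "m \<in> M" "\<delta> g \<otimes>\<^bsub>A\<^esub> f = m \<oplus>\<^bsub>A\<^esub> f" by (auto simp: coset_def)
    then have "\<delta> g \<otimes>\<^bsub>A\<^esub> f \<ominus>\<^bsub>A\<^esub> f = m"
      using MA fA by (auto simp: A.minus_eq A.a_assoc A.r_neg)
    then show "\<delta> g \<otimes>\<^bsub>A\<^esub> f \<ominus>\<^bsub>A\<^esub> f \<in> N k" using m by (simp add: M_def)
  qed
  ultimately show ?thesis using f(1) N_subset_Suc[of k] unfolding M_def by blast
qed

text \<open>The finite set \<open>prime_span\<close> is reached after finitely many proper steps. It contains 1, and every
  \<open>N k\<close> is a right ideal.\<close>

lemma N_exhausts: "\<exists>n. N n = carrier A"
proof -
  \<comment> \<open>each proper step adds at least one element\<close>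
  have "prime_span \<subseteq> N k \<or> k \<le> card (prime_span \<inter> N k)" for k
  proof (induction k)
    case (Suc k)
    show ?case
    proof (cases "prime_span \<subseteq> N k")
      case True
      then show ?thesis using N_subset_Suc by blast
    next
      case False
      have "card (prime_span \<inter> N k) < card (prime_span \<inter> N (Suc k))"
        by (rule psubset_card_mono[OF _ N_grows[OF False]]) (simp add: finite_prime_span)
      then show ?thesis using Suc False by linarith
    qed
  qed simp
  moreover have "card (prime_span \<inter> N (Suc (card prime_span))) \<le> card prime_span"
    by (rule card_mono) (auto simp: finite_prime_span)
  ultimately have "prime_span \<subseteq> N (Suc (card prime_span))" by (metis not_less_eq_eq)
  then have one: "\<one>\<^bsub>A\<^esub> \<in> N (Suc (card prime_span))" using basis_in_prime_span by (auto simp only: one_eq_basis)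
  have "f \<in> N (Suc (card prime_span))" if "f \<in> carrier A" for f
    using N_mult_right[OF one that] that by simp
  then show ?thesis using N_closed by blast
qed

text \<open>Multiplication by \<open>I\<close> lowers the annihilator filtration by one step, and the filtration starts at
  zero and ends at the whole algebra.\<close>

theorem augmentation_ideal_nilpotent: "\<exists>n. P n = {\<zero>\<^bsub>A\<^esub>}"
proof -
  obtain n where n: "N n = carrier A" using N_exhausts by blast
  \<comment> \<open>the truncated subtraction is exact, as \<open>j \<le> n\<close>\<close>
  have "P j \<subseteq> N (n - j)" if "j \<le> n" for j
    using that
  proof (induction j)
    case (Suc j)
    show ?case
    proof
      fix x assume "x \<in> P (Suc j)"
      then have "x \<in> ideal_prod A I (P j)" by (simp add: augmentation_power_Suc)
      then show "x \<in> N (n - Suc j)"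
      proof (induction rule: ideal_prod.induct)
        case (prod x y)
        have "y \<in> N (Suc (n - Suc j))" using prod(2) Suc by (auto simp: Suc_diff_Suc)
        then show ?case using I_mult_N[OF prod(1)] by blast
      next
        case (sum s t)
        then show ?case using N_add by blast
      qed
    qed
  qed (simp add: n)
  from this[of n] have "P n \<subseteq> {\<zero>\<^bsub>A\<^esub>}" by simp
  then show ?thesis
    using additive_subgroup.zero_closed[OF ideal.axioms(1)[OF ideal_P]] by blast
qed

end

section \<open>The p-th power map\<close>

lemma (in cring) binomial:
  assumes x: "x \<in> carrier R" and y: "y \<in> carrier R"
  shows "(x \<oplus> y) [^] n = (\<Oplus>k\<in>{..n}. [(n choose k)] \<cdot>\<^bsub>R\<^esub> (x [^] k \<otimes> y [^] (n - k)))"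
proof (induction n)
  case 0
  then show ?case by (simp add: finsum_0)
next
  case (Suc n)
  let ?t = "\<lambda>(n::nat) (k::nat). x [^] k \<otimes> y [^] (n - k)"
  have c: "?t n k \<in> carrier R" for n k using x y by simp
  have shift: "x \<otimes> ?t n k = ?t (Suc n) (Suc k)" for k
    using x y by (simp add: m_ac)
  have up: "y \<otimes> ?t n k = ?t (Suc n) k" if "k \<le> n" for k
    using x y that by (simp add: Suc_diff_le m_ac)
  have "(x \<oplus> y) [^] Suc n = (x \<oplus> y) \<otimes> (\<Oplus>k\<in>{..n}. [(n choose k)] \<cdot>\<^bsub>R\<^esub> ?t n k)"
    using x y Suc by (simp add: m_comm)
  also have "\<dots> = (\<Oplus>k\<in>{..n}. x \<otimes> ([(n choose k)] \<cdot>\<^bsub>R\<^esub> ?t n k)) \<oplus> (\<Oplus>k\<in>{..n}. y \<otimes> ([(n choose k)] \<cdot>\<^bsub>R\<^esub> ?t n k))"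
    using x y by (simp add: l_distr finsum_rdistr Pi_def)
  also have "(\<Oplus>k\<in>{..n}. x \<otimes> ([(n choose k)] \<cdot>\<^bsub>R\<^esub> ?t n k)) = (\<Oplus>k\<in>{..n}. [(n choose k)] \<cdot>\<^bsub>R\<^esub> ?t (Suc n) (Suc k))"
    using x y c by (intro finsum_cong') (auto simp: add_pow_rdistr shift simp del: nat_pow_Suc)
  also have "(\<Oplus>k\<in>{..n}. y \<otimes> ([(n choose k)] \<cdot>\<^bsub>R\<^esub> ?t n k)) = (\<Oplus>k\<in>{..n}. [(n choose k)] \<cdot>\<^bsub>R\<^esub> ?t (Suc n) k)"
    using x y c by (intro finsum_cong') (auto simp: add_pow_rdistr up)
  also have "\<dots> = (\<Oplus>k\<in>{..Suc n}. [(n choose k)] \<cdot>\<^bsub>R\<^esub> ?t (Suc n) k)"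
    using x y c by (simp add: finsum_Suc Pi_def finsum_closed binomial_eq_0 del: nat_pow_Suc)
  also have "\<dots> = (\<Oplus>k\<in>{..n}. [(n choose Suc k)] \<cdot>\<^bsub>R\<^esub> ?t (Suc n) (Suc k)) \<oplus> ?t (Suc n) 0"
    using x y c by (subst finsum_Suc2) (auto simp del: nat_pow_Suc)
  also have "(\<Oplus>k\<in>{..n}. [(n choose k)] \<cdot>\<^bsub>R\<^esub> ?t (Suc n) (Suc k)) \<oplus>
      ((\<Oplus>k\<in>{..n}. [(n choose Suc k)] \<cdot>\<^bsub>R\<^esub> ?t (Suc n) (Suc k)) \<oplus> ?t (Suc n) 0)
    = (\<Oplus>k\<in>{..n}. [(Suc n choose Suc k)] \<cdot>\<^bsub>R\<^esub> ?t (Suc n) (Suc k)) \<oplus> ?t (Suc n) 0"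
  proof -
    have "(\<Oplus>k\<in>{..n}. [(n choose k)] \<cdot>\<^bsub>R\<^esub> ?t (Suc n) (Suc k)) \<oplus>
        (\<Oplus>k\<in>{..n}. [(n choose Suc k)] \<cdot>\<^bsub>R\<^esub> ?t (Suc n) (Suc k))
      = (\<Oplus>k\<in>{..n}. [(n choose k)] \<cdot>\<^bsub>R\<^esub> ?t (Suc n) (Suc k) \<oplus> [(n choose Suc k)] \<cdot>\<^bsub>R\<^esub> ?t (Suc n) (Suc k))"
      using x y by (intro finsum_addf[symmetric]) auto
    also have "\<dots> = (\<Oplus>k\<in>{..n}. [(Suc n choose Suc k)] \<cdot>\<^bsub>R\<^esub> ?t (Suc n) (Suc k))"
      using x y by (intro finsum_cong') (auto simp: add.nat_pow_mult)
    finally show ?thesis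
      using x y by (simp add: a_assoc[symmetric] finsum_closed Pi_def del: nat_pow_Suc binomial_Suc_Suc)
  qed
  also have "\<dots> = (\<Oplus>k\<in>{..Suc n}. [(Suc n choose k)] \<cdot>\<^bsub>R\<^esub> ?t (Suc n) k)"
    using x y c by (subst finsum_Suc2) (auto simp del: nat_pow_Suc binomial_Suc_Suc)
  finally show ?case .
qed

lemma (in cring) frobenius_add:
  fixes p :: nat
  assumes p: "Factorial_Ring.prime p" and exponent: "\<And>x. x \<in> carrier R \<Longrightarrow> [p] \<cdot>\<^bsub>R\<^esub> x = \<zero>"
    and x: "x \<in> carrier R" and y: "y \<in> carrier R"
  shows "(x \<oplus> y) [^] p = x [^] p \<oplus> y [^] p"
proof -
  let ?t = "\<lambda>k::nat. x [^] k \<otimes> y [^] (p - k)"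
  have c: "?t k \<in> carrier R" for k using x y by simp
  have p0: "p > 0" using p by (rule prime_gt_0_nat)
  \<comment> \<open>the inner binomial coefficients are divisible by \<open>p\<close>\<close>
  have zero: "[(p choose k)] \<cdot>\<^bsub>R\<^esub> ?t k = \<zero>" if "k \<in> {..p} - {0, p}" for k
  proof -
    have "p dvd (p choose k)" using that p by (intro dvd_choose_prime) auto
    then obtain m where m: "p choose k = p * m" by (auto simp: dvd_def)
    show ?thesis
      unfolding m using add.nat_pow_pow[OF c, of m p] exponent[OF add.nat_pow_closed[OF c]]
        exponent[OF c] by (metis add.nat_pow_one add.nat_pow_pow c mult.commute)
  qed
  have "(x \<oplus> y) [^] p = (\<Oplus>k\<in>{..p}. [(p choose k)] \<cdot>\<^bsub>R\<^esub> ?t k)"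
    using x y by (rule binomial)
  also have "\<dots> = (\<Oplus>k\<in>{0, p}. [(p choose k)] \<cdot>\<^bsub>R\<^esub> ?t k)"
    using zero c by (intro finsum_subset_zero) auto
  also have "\<dots> = x [^] p \<oplus> y [^] p"
    using x y p0 by (simp add: finsum_insert a_comm)
  finally show ?thesis .
qed

lemma (in cring) frobenius_finsum:
  fixes p :: nat
  assumes p: "Factorial_Ring.prime p" and exponent: "\<And>x. x \<in> carrier R \<Longrightarrow> [p] \<cdot>\<^bsub>R\<^esub> x = \<zero>"
    and f: "\<And>i. i \<in> I \<Longrightarrow> f i \<in> carrier R"
  shows "(\<Oplus>i\<in>I. f i) [^] p = (\<Oplus>i\<in>I. f i [^] p)"
proof (rule additive_finsum[where h = "\<lambda>x. x [^] p"])
  show "\<zero> [^] p = \<zero>" using prime_gt_0_nat[OF p] by (simp add: nat_pow_zero)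
qed (auto simp: frobenius_add[OF p exponent] f intro: abelian_monoid_axioms)

lemma (in domain) nat_pow_eq_zero:
  assumes "x \<in> carrier R" "x [^] (n::nat) = \<zero>"
  shows "x = \<zero>"
  using assms(2) by (induction n) (auto simp: integral_iff assms(1))

lemma (in unital_algebra) smult_pow:
  assumes "a \<in> carrier F" "x \<in> carrier B"
  shows "(a \<odot>\<^bsub>B\<^esub> x) [^]\<^bsub>B\<^esub> (n::nat) = (a [^]\<^bsub>F\<^esub> n) \<odot>\<^bsub>B\<^esub> (x [^]\<^bsub>B\<^esub> n)"
proof -
  show ?thesis
    using assms
    by (induction n) (auto simp: smult_mult_left smult_mult_right smult_assoc1[symmetric] R.m_comm)
qed

context p_group_algebra
begin

lemma cring_A:
  assumes "comm_group G"
  shows "cring A"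
proof (rule cringI[OF abelian_group_A])
  interpret C: comm_group G by fact
  show "comm_monoid A"
  proof (rule comm_monoidI)
    fix f h assume f: "f \<in> carrier A" and h: "h \<in> carrier A"
    show "f \<otimes>\<^bsub>A\<^esub> h = h \<otimes>\<^bsub>A\<^esub> f"
    proof (rule elem_eqI)
      fix x assume x: "x \<in> carrier G"
      let ?s = "\<lambda>y. inv\<^bsub>G\<^esub> y \<otimes>\<^bsub>G\<^esub> x"
      have s: "?s (?s y) = y" if "y \<in> carrier G" for y
        using that x by (simp add: G.inv_mult_group C.m_comm[of "inv\<^bsub>G\<^esub> x"] G.m_assoc)
      have b: "bij_betw ?s (carrier G) (carrier G)"
        using x s by (intro bij_betw_byWitness[where f' = ?s]) auto
      have "(h \<otimes>\<^bsub>A\<^esub> f) x = (\<Oplus>\<^bsub>F\<^esub>y\<in>?s ` carrier G. h y \<otimes>\<^bsub>F\<^esub> f (?s y))"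
        using x b by (simp add: mult_apply bij_betw_def)
      also have "\<dots> = (\<Oplus>\<^bsub>F\<^esub>y\<in>carrier G. h (?s y) \<otimes>\<^bsub>F\<^esub> f (?s (?s y)))"
        using x b f h by (intro F.finsum_reindex) (auto simp: bij_betw_def)
      also have "\<dots> = (\<Oplus>\<^bsub>F\<^esub>y\<in>carrier G. f y \<otimes>\<^bsub>F\<^esub> h (?s y))"
        using x f h by (intro F.finsum_cong') (auto simp: s F.m_comm)
      also have "\<dots> = (f \<otimes>\<^bsub>A\<^esub> h) x" using x by (simp add: mult_apply)
      finally show "(f \<otimes>\<^bsub>A\<^esub> h) x = (h \<otimes>\<^bsub>A\<^esub> f) x" by simp
    qed (use f h in auto)
  qed (auto simp: A.m_assoc)
qed (auto simp: A.l_distr)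

lemma frobenius_A:
  assumes "comm_group G" and f: "f \<in> carrier A"
  shows "f [^]\<^bsub>A\<^esub> p = (\<Oplus>\<^bsub>A\<^esub>g\<in>carrier G. (f g [^]\<^bsub>F\<^esub> p) \<odot>\<^bsub>A\<^esub> \<delta> (g [^]\<^bsub>G\<^esub> p))"
proof -
  interpret C: cring A by (rule cring_A) fact
  have "f [^]\<^bsub>A\<^esub> p = (\<Oplus>\<^bsub>A\<^esub>g\<in>carrier G. f g \<odot>\<^bsub>A\<^esub> \<delta> g) [^]\<^bsub>A\<^esub> p"
    using f by (simp add: basis_expansion)
  also have "\<dots> = (\<Oplus>\<^bsub>A\<^esub>g\<in>carrier G. (f g \<odot>\<^bsub>A\<^esub> \<delta> g) [^]\<^bsub>A\<^esub> p)"
    using f by (intro C.frobenius_finsum prime_p A_exponent) auto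
  also have "\<dots> = (\<Oplus>\<^bsub>A\<^esub>g\<in>carrier G. (f g [^]\<^bsub>F\<^esub> p) \<odot>\<^bsub>A\<^esub> \<delta> (g [^]\<^bsub>G\<^esub> p))"
    using f by (intro A.finsum_cong') (auto simp: Alg.smult_pow basis_pow)
  finally show ?thesis .
qed

text \<open>The coefficient of \<open>f\<^sup>p\<close> at \<open>w\<close> is the sum of the p-th powers of the coefficients on the fibre, which
  is the p-th power of their sum.\<close>

lemma fibre_sums_zero:
  assumes "comm_group G" and f: "f \<in> carrier A" "f [^]\<^bsub>A\<^esub> p = \<zero>\<^bsub>A\<^esub>" and w: "w \<in> carrier G"
  shows "(\<Oplus>\<^bsub>F\<^esub>g\<in>{g \<in> carrier G. g [^]\<^bsub>G\<^esub> p = w}. f g) = \<zero>\<^bsub>F\<^esub>"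
proof -
  let ?R = "{g \<in> carrier G. g [^]\<^bsub>G\<^esub> p = w}"
  have "(\<Oplus>\<^bsub>F\<^esub>g\<in>?R. f g) [^]\<^bsub>F\<^esub> p = (\<Oplus>\<^bsub>F\<^esub>g\<in>?R. f g [^]\<^bsub>F\<^esub> p)"
    using f by (intro F.frobenius_finsum prime_p F_exponent) auto
  also have "\<dots> = (\<Oplus>\<^bsub>F\<^esub>g\<in>carrier G. ((f g [^]\<^bsub>F\<^esub> p) \<odot>\<^bsub>A\<^esub> \<delta> (g [^]\<^bsub>G\<^esub> p)) w)"
  proof -
    have "(\<Oplus>\<^bsub>F\<^esub>g\<in>carrier G. ((f g [^]\<^bsub>F\<^esub> p) \<odot>\<^bsub>A\<^esub> \<delta> (g [^]\<^bsub>G\<^esub> p)) w)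
        = (\<Oplus>\<^bsub>F\<^esub>g\<in>?R. ((f g [^]\<^bsub>F\<^esub> p) \<odot>\<^bsub>A\<^esub> \<delta> (g [^]\<^bsub>G\<^esub> p)) w)"
      using f w finite_G by (intro F.finsum_subset_zero) (auto simp: smult_apply basis_apply)
    also have "\<dots> = (\<Oplus>\<^bsub>F\<^esub>g\<in>?R. f g [^]\<^bsub>F\<^esub> p)"
      using f w by (intro F.finsum_cong') (auto simp: smult_apply basis_apply)
    finally show ?thesis by simp
  qed
  also have "\<dots> = (f [^]\<^bsub>A\<^esub> p) w"
    unfolding frobenius_A[OF assms(1) f(1)] using f w by (intro finsum_apply[symmetric]) auto
  also have "\<dots> = \<zero>\<^bsub>F\<^esub>" using f w by (simp add: zero_apply)
  finally have "(\<Oplus>\<^bsub>F\<^esub>g\<in>?R. f g) [^]\<^bsub>F\<^esub> p = \<zero>\<^bsub>F\<^esub>" .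
  then show ?thesis
    by (rule F.nat_pow_eq_zero[rotated]) (use f in \<open>auto intro!: F.finsum_closed\<close>)
qed

lemma pow_p_eq_zero:
  assumes "elementary_abelian p G" and f: "f \<in> I"
  shows "f [^]\<^bsub>A\<^esub> p = \<zero>\<^bsub>A\<^esub>"
proof -
  have comm: "comm_group G" and pow: "\<And>g. g \<in> carrier G \<Longrightarrow> g [^]\<^bsub>G\<^esub> p = \<one>\<^bsub>G\<^esub>"
    using assms(1) by (auto simp: elementary_abelian_def)
  have fA: "f \<in> carrier A" and \<epsilon>: "\<epsilon> f = \<zero>\<^bsub>F\<^esub>" using f by (auto simp: augmentation_ideal_def)
  have "f [^]\<^bsub>A\<^esub> p = (\<Oplus>\<^bsub>A\<^esub>g\<in>carrier G. (f g [^]\<^bsub>F\<^esub> p) \<odot>\<^bsub>A\<^esub> \<one>\<^bsub>A\<^esub>)"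
    unfolding frobenius_A[OF comm fA] using fA
    by (intro A.finsum_cong') (auto simp: pow one_eq_basis)
  also have "\<dots> = (\<Oplus>\<^bsub>F\<^esub>g\<in>carrier G. f g [^]\<^bsub>F\<^esub> p) \<odot>\<^bsub>A\<^esub> \<one>\<^bsub>A\<^esub>"
    using fA by (intro additive_finsum[where h = "\<lambda>a. a \<odot>\<^bsub>A\<^esub> \<one>\<^bsub>A\<^esub>", symmetric])
      (auto simp: Alg.smult_l_distr A.abelian_monoid_axioms F.abelian_monoid_axioms)
  also have "(\<Oplus>\<^bsub>F\<^esub>g\<in>carrier G. f g [^]\<^bsub>F\<^esub> p) = \<epsilon> f [^]\<^bsub>F\<^esub> p"
    unfolding augmentation_def
    using fA by (intro F.frobenius_finsum[symmetric] prime_p F_exponent) auto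
  also have "\<dots> = \<zero>\<^bsub>F\<^esub>" using \<epsilon> prime_gt_0_nat[OF prime_p] by (simp add: F.nat_pow_zero)
  finally show ?thesis by simp
qed

end

section \<open>Restriction of central elements to the center\<close>

lemma center_subgroup:
  assumes "group G"
  shows "subgroup (center G) G"
proof -
  interpret group G by fact
  show ?thesis
  proof (rule subgroupI)
    fix a assume a: "a \<in> center G"
    have "inv\<^bsub>G\<^esub> a \<otimes>\<^bsub>G\<^esub> x = x \<otimes>\<^bsub>G\<^esub> inv\<^bsub>G\<^esub> a" if x: "x \<in> carrier G" for x
    proof -
      have ac: "a \<in> carrier G" and ax: "a \<otimes>\<^bsub>G\<^esub> x = x \<otimes>\<^bsub>G\<^esub> a" using a x by (auto simp: center_def)
      have "x = inv\<^bsub>G\<^esub> a \<otimes>\<^bsub>G\<^esub> (x \<otimes>\<^bsub>G\<^esub> a)" using ac x by (simp flip: ax add: m_assoc[symmetric])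
      then show ?thesis using ac x by (metis inv_closed inv_solve_right m_assoc m_closed)
    qed
    then show "inv\<^bsub>G\<^esub> a \<in> center G" using a by (auto simp: center_def)
  next
    fix a b assume a: "a \<in> center G" and b: "b \<in> center G"
    then have c: "a \<in> carrier G" "b \<in> carrier G" by (auto simp: center_def)
    have "a \<otimes>\<^bsub>G\<^esub> b \<otimes>\<^bsub>G\<^esub> x = x \<otimes>\<^bsub>G\<^esub> (a \<otimes>\<^bsub>G\<^esub> b)" if x: "x \<in> carrier G" for x
    proof -
      have "a \<otimes>\<^bsub>G\<^esub> b \<otimes>\<^bsub>G\<^esub> x = a \<otimes>\<^bsub>G\<^esub> (x \<otimes>\<^bsub>G\<^esub> b)" using b c x by (simp add: m_assoc center_def)
      also have "\<dots> = x \<otimes>\<^bsub>G\<^esub> a \<otimes>\<^bsub>G\<^esub> b" using a c x by (simp add: m_assoc[symmetric] center_def)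
      finally show ?thesis using c x by (simp add: m_assoc)
    qed
    then show "a \<otimes>\<^bsub>G\<^esub> b \<in> center G" using c by (auto simp: center_def)
  qed (auto simp: center_def)
qed

lemma p_group_algebra_subgroup:
  assumes "p_group_algebra F G p" "subgroup K G"
  shows "p_group_algebra F (G\<lparr>carrier := K\<rparr>) p"
proof -
  interpret p_group_algebra F G p by fact
  obtain n where "order G = p ^ n" using order_G by auto
  then have "card K dvd p ^ n" using G.lagrange[OF assms(2)] by (metis dvd_triv_right)
  then have "\<exists>k. order (G\<lparr>carrier := K\<rparr>) = p ^ k"
    using prime_p by (auto simp: order_def divides_primepow_nat)
  then show ?thesis
    using assms(2) prime_p char_F
    by (intro p_group_algebraI) (auto simp: finite_p_group_def G.subgroup_imp_group F.field_axioms)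
qed

context p_group_algebra
begin

definition central :: "('a \<Rightarrow> 'f) \<Rightarrow> bool" where
  "central b \<longleftrightarrow> b \<in> carrier A \<and> (\<forall>f \<in> carrier A. b \<otimes>\<^bsub>A\<^esub> f = f \<otimes>\<^bsub>A\<^esub> b)"

lemma central_closed: "central b \<Longrightarrow> b \<in> carrier A"
  by (simp add: central_def)

lemma central_one: "central \<one>\<^bsub>A\<^esub>"
  by (simp add: central_def)

lemma central_mult:
  assumes "central b" "central c"
  shows "central (b \<otimes>\<^bsub>A\<^esub> c)"
  unfolding central_def
proof (intro conjI ballI)
  have cl: "b \<in> carrier A" "c \<in> carrier A" using assms central_closed by auto
  then show "b \<otimes>\<^bsub>A\<^esub> c \<in> carrier A" by simp
  fix f assume f: "f \<in> carrier A"
  have "b \<otimes>\<^bsub>A\<^esub> c \<otimes>\<^bsub>A\<^esub> f = b \<otimes>\<^bsub>A\<^esub> (f \<otimes>\<^bsub>A\<^esub> c)" using assms(2) cl f by (simp add: A.m_assoc central_def)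
  also have "\<dots> = f \<otimes>\<^bsub>A\<^esub> b \<otimes>\<^bsub>A\<^esub> c" using assms(1) cl f by (simp add: A.m_assoc[symmetric] central_def)
  finally show "b \<otimes>\<^bsub>A\<^esub> c \<otimes>\<^bsub>A\<^esub> f = f \<otimes>\<^bsub>A\<^esub> (b \<otimes>\<^bsub>A\<^esub> c)" using cl f by (simp add: A.m_assoc)
qed

lemma central_conjugate:
  assumes b: "central b" and g: "g \<in> carrier G" and x: "x \<in> carrier G"
  shows "b (g \<otimes>\<^bsub>G\<^esub> x \<otimes>\<^bsub>G\<^esub> inv\<^bsub>G\<^esub> g) = b x"
proof -
  have "b (g \<otimes>\<^bsub>G\<^esub> x \<otimes>\<^bsub>G\<^esub> inv\<^bsub>G\<^esub> g) = (b \<otimes>\<^bsub>A\<^esub> \<delta> g) (g \<otimes>\<^bsub>G\<^esub> x)"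
    using g x central_closed[OF b] by (simp add: mult_basis_apply)
  also have "\<dots> = (\<delta> g \<otimes>\<^bsub>A\<^esub> b) (g \<otimes>\<^bsub>G\<^esub> x)" using b by (simp add: central_def)
  also have "\<dots> = b x" using g x central_closed[OF b] by (simp add: basis_mult_apply G.m_assoc[symmetric])
  finally show ?thesis .
qed

text \<open>The fixed points of conjugation are the central elements.\<close>

lemma conjugation_sum:
  fixes M :: "('x, 'y) ring_scheme"
  assumes M: "abelian_group M" and exponent: "\<And>m. m \<in> carrier M \<Longrightarrow> [p] \<cdot>\<^bsub>M\<^esub> m = \<zero>\<^bsub>M\<^esub>"
    and f: "\<And>x. x \<in> carrier G \<Longrightarrow> f x \<in> carrier M"
    and inv: "\<And>g x. g \<in> carrier G \<Longrightarrow> x \<in> carrier G \<Longrightarrow> f (g \<otimes>\<^bsub>G\<^esub> x \<otimes>\<^bsub>G\<^esub> inv\<^bsub>G\<^esub> g) = f x"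
  shows "(\<Oplus>\<^bsub>M\<^esub>x\<in>carrier G. f x) = (\<Oplus>\<^bsub>M\<^esub>x\<in>center G. f x)"
proof -
  interpret M: abelian_group M by fact
  obtain n where n: "order G = p ^ n" using order_G by auto
  let ?act = "\<lambda>g x. g \<otimes>\<^bsub>G\<^esub> x \<otimes>\<^bsub>G\<^esub> inv\<^bsub>G\<^esub> g"
  have "?act g x = x \<longleftrightarrow> x \<otimes>\<^bsub>G\<^esub> g = g \<otimes>\<^bsub>G\<^esub> x" if "g \<in> carrier G" "x \<in> carrier G" for g x
    using that by (metis G.inv_solve_right G.m_closed)
  then have fixpts: "{x \<in> carrier G. \<forall>g\<in>carrier G. ?act g x = x} = center G"
    by (auto simp: center_def)
  have "(\<Oplus>\<^bsub>M\<^esub>x\<in>carrier G. f x)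
      = (\<Oplus>\<^bsub>M\<^esub>x\<in>{x \<in> carrier G. \<forall>g\<in>carrier G. ?act g x = x}. f x)"
  proof (rule p_group_fixed_points_sum[OF G.group_axioms n prime_p finite_G])
    show "f (?act g x) = f x" if "g \<in> carrier G" "x \<in> carrier G" for g x
      using that by (rule inv)
  qed (auto simp: f M exponent G.inv_mult_group G.m_assoc)
  then show ?thesis unfolding fixpts .
qed

lemma center_comm_group: "comm_group (G\<lparr>carrier := center G\<rparr>)"
proof -
  interpret Z: group "(G\<lparr>carrier := center G\<rparr>)"
    by (rule G.subgroup_imp_group[OF center_subgroup[OF G.group_axioms]])
  show ?thesis
  proof (rule Z.group_comm_groupI)
    fix x y assume "x \<in> carrier (G\<lparr>carrier := center G\<rparr>)" "y \<in> carrier (G\<lparr>carrier := center G\<rparr>)"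
    then have "x \<in> center G" "y \<in> carrier G" by (auto simp: center_def)
    then have "x \<otimes>\<^bsub>G\<^esub> y = y \<otimes>\<^bsub>G\<^esub> x" unfolding center_def by blast
    then show "x \<otimes>\<^bsub>(G\<lparr>carrier := center G\<rparr>)\<^esub> y = y \<otimes>\<^bsub>(G\<lparr>carrier := center G\<rparr>)\<^esub> x" by simp
  qed
qed

lemma restrict_center_closed:
  assumes "f \<in> carrier A"
  shows "restrict f (center G) \<in> carrier (group_algebra F (G\<lparr>carrier := center G\<rparr>))"
proof -
  have "f x \<in> carrier F" if "x \<in> center G" for x
    using elem_closed[OF assms, of x] that by (simp add: center_def)
  then show ?thesis by (simp add: group_algebra_def)
qed

text \<open>Restriction of class functions to the center is the Brauer homomorphism of the p-group \<open>G\<close> acting on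
  \<open>FG\<close> by conjugation. In the sum for the coefficient of \<open>b c\<close> at a central \<open>z\<close>, the summand
  \<open>b y \<cdot> c (y\<^sup>-\<^sup>1 z)\<close> is invariant under conjugation of \<open>y\<close>, so only central \<open>y\<close> survive.\<close>

lemma restrict_center_mult:
  assumes b: "central b" and c: "central c"
  shows "restrict (b \<otimes>\<^bsub>A\<^esub> c) (center G)
    = restrict b (center G) \<otimes>\<^bsub>group_algebra F (G\<lparr>carrier := center G\<rparr>)\<^esub> restrict c (center G)"
proof -
  interpret Z: p_group_algebra F "(G\<lparr>carrier := center G\<rparr>)" p
    using p_group_algebra_subgroup[OF p_group_algebra_axioms center_subgroup[OF G.group_axioms]] .
  have bc: "b \<in> carrier A" "c \<in> carrier A" using b c central_closed by auto
  have ZG: "z \<in> carrier G" if "z \<in> center G" for z using that by (simp add: center_def)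
  have restr: "restrict f (center G) \<in> carrier Z.A" if "f \<in> carrier A" for f
    using that by (rule restrict_center_closed)
  show ?thesis
  proof (rule Z.elem_eqI)
    fix z assume "z \<in> carrier (G\<lparr>carrier := center G\<rparr>)"
    then have zZ: "z \<in> center G" and z: "z \<in> carrier G" using ZG by auto
    have "(b \<otimes>\<^bsub>A\<^esub> c) z = (\<Oplus>\<^bsub>F\<^esub>y\<in>carrier G. b y \<otimes>\<^bsub>F\<^esub> c (inv\<^bsub>G\<^esub> y \<otimes>\<^bsub>G\<^esub> z))"
      using z by (rule mult_apply)
    also have "\<dots> = (\<Oplus>\<^bsub>F\<^esub>y\<in>center G. b y \<otimes>\<^bsub>F\<^esub> c (inv\<^bsub>G\<^esub> y \<otimes>\<^bsub>G\<^esub> z))"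
    proof (rule conjugation_sum[OF F.abelian_group_axioms F_exponent])
      fix g y assume gy: "g \<in> carrier G" "y \<in> carrier G"
      have zg: "z \<otimes>\<^bsub>G\<^esub> inv\<^bsub>G\<^esub> g = inv\<^bsub>G\<^esub> g \<otimes>\<^bsub>G\<^esub> z"
        using zZ gy unfolding center_def by blast
      have "inv\<^bsub>G\<^esub> (g \<otimes>\<^bsub>G\<^esub> y \<otimes>\<^bsub>G\<^esub> inv\<^bsub>G\<^esub> g) \<otimes>\<^bsub>G\<^esub> z = g \<otimes>\<^bsub>G\<^esub> (inv\<^bsub>G\<^esub> y \<otimes>\<^bsub>G\<^esub> z) \<otimes>\<^bsub>G\<^esub> inv\<^bsub>G\<^esub> g"
        using gy z by (simp add: G.inv_mult_group G.m_assoc zg)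
      then show "b (g \<otimes>\<^bsub>G\<^esub> y \<otimes>\<^bsub>G\<^esub> inv\<^bsub>G\<^esub> g) \<otimes>\<^bsub>F\<^esub> c (inv\<^bsub>G\<^esub> (g \<otimes>\<^bsub>G\<^esub> y \<otimes>\<^bsub>G\<^esub> inv\<^bsub>G\<^esub> g) \<otimes>\<^bsub>G\<^esub> z)
          = b y \<otimes>\<^bsub>F\<^esub> c (inv\<^bsub>G\<^esub> y \<otimes>\<^bsub>G\<^esub> z)"
        using gy z by (simp add: central_conjugate[OF b] central_conjugate[OF c])
    qed (use bc z in auto)
    also have "\<dots> = (restrict b (center G) \<otimes>\<^bsub>Z.A\<^esub> restrict c (center G)) z"
    proof -
      interpret C: subgroup "center G" G by (rule center_subgroup[OF G.group_axioms])
      have inv: "inv\<^bsub>(G\<lparr>carrier := center G\<rparr>)\<^esub> y = inv\<^bsub>G\<^esub> y" if "y \<in> center G" for y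
        by (rule G.m_inv_consistent[OF C.subgroup_axioms that])
      have "(restrict b (center G) \<otimes>\<^bsub>Z.A\<^esub> restrict c (center G)) z
          = (\<Oplus>\<^bsub>F\<^esub>y\<in>center G. restrict b (center G) y \<otimes>\<^bsub>F\<^esub> restrict c (center G) (inv\<^bsub>(G\<lparr>carrier := center G\<rparr>)\<^esub> y \<otimes>\<^bsub>G\<^esub> z))"
        using zZ by (simp add: Z.mult_apply)
      also have "\<dots> = (\<Oplus>\<^bsub>F\<^esub>y\<in>center G. b y \<otimes>\<^bsub>F\<^esub> c (inv\<^bsub>G\<^esub> y \<otimes>\<^bsub>G\<^esub> z))"
        using zZ bc z by (intro F.finsum_cong') (auto simp: inv)
      finally show ?thesis by simp
    qed
    finally show "restrict (b \<otimes>\<^bsub>A\<^esub> c) (center G) z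
        = (restrict b (center G) \<otimes>\<^bsub>Z.A\<^esub> restrict c (center G)) z"
      using zZ by simp
  qed (use bc restr in auto)
qed

lemma restrict_center_pow:
  assumes "central b"
  shows "central (b [^]\<^bsub>A\<^esub> (n::nat)) \<and> restrict (b [^]\<^bsub>A\<^esub> n) (center G)
    = restrict b (center G) [^]\<^bsub>group_algebra F (G\<lparr>carrier := center G\<rparr>)\<^esub> n"
proof (induction n)
  case 0
  have "restrict \<one>\<^bsub>A\<^esub> (center G) = \<one>\<^bsub>group_algebra F (G\<lparr>carrier := center G\<rparr>)\<^esub>"
    by (auto simp: group_algebra_def fun_eq_iff center_def)
  then show ?case by (simp add: central_one)
next
  case (Suc n)
  then have IH: "central (b [^]\<^bsub>A\<^esub> n)" "restrict (b [^]\<^bsub>A\<^esub> n) (center G)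
    = restrict b (center G) [^]\<^bsub>group_algebra F (G\<lparr>carrier := center G\<rparr>)\<^esub> n"
    by (rule conjunct1, rule conjunct2)
  show ?case
    using restrict_center_mult[OF IH(1) assms] central_mult[OF IH(1) assms]
    unfolding nat_pow_Suc IH(2) by (intro conjI)
qed

lemma central_fibre_sums_zero:
  assumes b: "central b" "b [^]\<^bsub>A\<^esub> p = \<zero>\<^bsub>A\<^esub>" and w: "w \<in> center G"
  shows "(\<Oplus>\<^bsub>F\<^esub>z\<in>{z \<in> center G. z [^]\<^bsub>G\<^esub> p = w}. b z) = \<zero>\<^bsub>F\<^esub>"
proof -
  interpret Z: p_group_algebra F "(G\<lparr>carrier := center G\<rparr>)" p
    using p_group_algebra_subgroup[OF p_group_algebra_axioms center_subgroup[OF G.group_axioms]] .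
  let ?b = "restrict b (center G)"
  have ZG: "z \<in> carrier G" if "z \<in> center G" for z using that by (simp add: center_def)
  have bA: "b \<in> carrier A" using b central_closed by auto
  have c: "?b \<in> carrier Z.A" using bA by (rule restrict_center_closed)
  have "restrict \<zero>\<^bsub>A\<^esub> (center G) = \<zero>\<^bsub>Z.A\<^esub>"
    by (auto simp: group_algebra_def fun_eq_iff center_def)
  then have "?b [^]\<^bsub>Z.A\<^esub> p = \<zero>\<^bsub>Z.A\<^esub>"
    using restrict_center_pow[OF b(1), of p] b(2) by simp
  then have "(\<Oplus>\<^bsub>F\<^esub>z\<in>{z \<in> carrier (G\<lparr>carrier := center G\<rparr>). z [^]\<^bsub>(G\<lparr>carrier := center G\<rparr>)\<^esub> p = w}. ?b z) = \<zero>\<^bsub>F\<^esub>"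
    by (rule Z.fibre_sums_zero[OF center_comm_group c]) (simp add: w)
  also have "(\<Oplus>\<^bsub>F\<^esub>z\<in>{z \<in> carrier (G\<lparr>carrier := center G\<rparr>). z [^]\<^bsub>(G\<lparr>carrier := center G\<rparr>)\<^esub> p = w}. ?b z)
      = (\<Oplus>\<^bsub>F\<^esub>z\<in>{z \<in> center G. z [^]\<^bsub>G\<^esub> p = w}. b z)"
    using bA ZG by (intro F.finsum_cong') (auto simp: G.nat_pow_consistent[symmetric])
  finally show ?thesis .
qed

end

section \<open>Frattini subgroups and homomorphisms to elementary abelian groups\<close>

text \<open>Otherwise choose a subgroup \<open>M\<close> maximal among those that contain the kernel and avoid \<open>z\<close>. It is
  normal, because it contains all commutators, and it is a maximal subgroup: if \<open>M \<subset> L\<close> and \<open>x \<notin> L\<close>,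
  then both \<open>L\<close> and \<open>M \<langle>x\<rangle>\<close> contain \<open>z\<close>, whence \<open>x\<^sup>i \<in> L\<close> for some \<open>i\<close> prime to \<open>p\<close>; as
  also \<open>x\<^sup>p \<in> L\<close>, this gives \<open>x \<in> L\<close>. But \<open>z\<close> lies in every maximal subgroup.\<close>

lemma frattini_subset_kernel:
  fixes p :: nat
  assumes finite_G: "finite (carrier G)" and p: "Factorial_Ring.prime p"
    and hom: "group_hom G K \<kappa>" and comm: "comm_group K"
    and exponent: "\<And>k. k \<in> carrier K \<Longrightarrow> k [^]\<^bsub>K\<^esub> p = \<one>\<^bsub>K\<^esub>"
    and z: "z \<in> frattini G"
  shows "\<kappa> z = \<one>\<^bsub>K\<^esub>"
proof (rule ccontr)
  assume nz: "\<kappa> z \<noteq> \<one>\<^bsub>K\<^esub>"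
  interpret h: group_hom G K \<kappa> by fact
  interpret K: comm_group K by fact
  have zG: "z \<in> carrier G" using z by (simp add: frattini_def)
  define D where "D = kernel G K \<kappa>"
  have mem_D: "x \<in> D \<longleftrightarrow> x \<in> carrier G \<and> \<kappa> x = \<one>\<^bsub>K\<^esub>" for x
    by (auto simp: D_def kernel_def)
  have D: "subgroup D G" unfolding D_def by (rule h.subgroup_kernel)
  let ?M = "{M. subgroup M G \<and> D \<subseteq> M \<and> z \<notin> M}"
  have fin: "finite ?M"
    by (rule finite_subset[of _ "Pow (carrier G)"]) (auto simp: finite_G dest: subgroup.subset)
  have "D \<in> ?M" using D nz by (auto simp: mem_D)
  then have ne: "?M \<noteq> {}" by blast
  from finite_has_maximal[OF fin ne]
  obtain M where M: "M \<in> ?M" and max': "\<forall>L\<in>?M. M \<subseteq> L \<longrightarrow> M = L" by (elim bexE)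
  have max: "M = L" if "subgroup L G" "D \<subseteq> L" "z \<notin> L" "M \<subseteq> L" for L
    using max' that by simp
  interpret M: subgroup M G using M by simp
  have DM: "D \<subseteq> M" and zM: "z \<notin> M" using M by auto
  have M_normal: "M \<lhd> G"
    unfolding h.G.normal_inv_iff
  proof (intro conjI ballI)
    show "subgroup M G" by (rule M.subgroup_axioms)
    fix x m assume x: "x \<in> carrier G" and m: "m \<in> M"
    have mG: "m \<in> carrier G" using m by simp
    have "x \<otimes>\<^bsub>G\<^esub> m \<otimes>\<^bsub>G\<^esub> inv\<^bsub>G\<^esub> x \<otimes>\<^bsub>G\<^esub> inv\<^bsub>G\<^esub> m \<in> D"
      using x mG K.m_comm[of "\<kappa> x" "\<kappa> m"] by (simp add: mem_D h.H.m_assoc)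
    then have "x \<otimes>\<^bsub>G\<^esub> m \<otimes>\<^bsub>G\<^esub> inv\<^bsub>G\<^esub> x \<otimes>\<^bsub>G\<^esub> inv\<^bsub>G\<^esub> m \<otimes>\<^bsub>G\<^esub> m \<in> M" using DM m M.m_closed by blast
    then show "x \<otimes>\<^bsub>G\<^esub> m \<otimes>\<^bsub>G\<^esub> inv\<^bsub>G\<^esub> x \<in> M" using x mG by (simp add: h.G.m_assoc)
  qed
  have "maximal_subgroup M G"
    unfolding maximal_subgroup_def
  proof (intro conjI allI impI)
    show "subgroup M G" by (rule M.subgroup_axioms)
    show "M \<noteq> carrier G" using zM zG by auto
    fix L assume L: "subgroup L G \<and> M \<subseteq> L"
    interpret L: subgroup L G using L by simp
    show "L = M \<or> L = carrier G"
    proof (rule ccontr)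
      assume "\<not> (L = M \<or> L = carrier G)"
      then obtain x where LM: "L \<noteq> M" and x: "x \<in> carrier G" "x \<notin> L"
        using L.subset by blast
      have zL: "z \<in> L" using max[of L] L DM LM by blast
      \<comment> \<open>maximality of \<open>M\<close> forces \<open>z\<close> into \<open>M \<langle>x\<rangle>\<close>\<close>
      let ?C = "generate G {x}"
      have C: "subgroup ?C G" using x by (intro h.G.generate_is_subgroup) auto
      have MC: "subgroup (M <#>\<^bsub>G\<^esub> ?C) G" by (rule h.G.mult_norm_subgroup[OF M_normal C])
      have mem: "a \<otimes>\<^bsub>G\<^esub> c \<in> M <#>\<^bsub>G\<^esub> ?C" if "a \<in> M" "c \<in> ?C" for a c
        using that unfolding set_mult_def by blast
      have MMC: "M \<subseteq> M <#>\<^bsub>G\<^esub> ?C"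
      proof
        fix a assume a: "a \<in> M"
        then show "a \<in> M <#>\<^bsub>G\<^esub> ?C"
          using mem[OF a subgroup.one_closed[OF C]] M.mem_carrier[OF a] by simp
      qed
      have "x \<in> M <#>\<^bsub>G\<^esub> ?C"
        using mem[OF M.one_closed generate.incl[of x "{x}" G]] x by simp
      then have "M \<noteq> M <#>\<^bsub>G\<^esub> ?C" using x L by blast
      then have "z \<in> M <#>\<^bsub>G\<^esub> ?C"
        using max[OF MC subset_trans[OF DM MMC] _ MMC] by blast
      then obtain m i where m: "m \<in> M" and i: "z = m \<otimes>\<^bsub>G\<^esub> x [^]\<^bsub>G\<^esub> (i::int)"
        using h.G.generate_pow[OF x(1)] by (auto simp: set_mult_def)
      have mG: "m \<in> carrier G" using m by simp
      have xi: "x [^]\<^bsub>G\<^esub> i \<in> L"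
      proof -
        have "x [^]\<^bsub>G\<^esub> i = inv\<^bsub>G\<^esub> m \<otimes>\<^bsub>G\<^esub> z" using i mG x by (simp add: h.G.m_assoc[symmetric])
        then show ?thesis using m zL L by auto
      qed
      have "x [^]\<^bsub>G\<^esub> p \<in> D" using x exponent[of "\<kappa> x"] by (simp add: mem_D h.hom_nat_pow)
      then have xp: "x [^]\<^bsub>G\<^esub> int p \<in> M" using DM by (auto simp: int_pow_int)
      have "\<not> int p dvd i"
      proof
        assume "int p dvd i"
        then obtain j where "i = int p * j" by (auto simp: dvd_def)
        then have "x [^]\<^bsub>G\<^esub> i = (x [^]\<^bsub>G\<^esub> int p) [^]\<^bsub>G\<^esub> j" using x by (simp add: h.G.int_pow_pow)
        then have "x [^]\<^bsub>G\<^esub> i \<in> M" using h.G.subgroup_int_pow_closed[OF M.subgroup_axioms xp] by simp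
        then show False using i m zM by auto
      qed
      then have "coprime i (int p)"
        using p prime_imp_coprime[of "int p" i] by (simp add: coprime_commute)
      then obtain u v where "u * i + v * int p = 1"
        using bezout_int[of i "int p"] by auto
      then have "x = x [^]\<^bsub>G\<^esub> (i * u + int p * v)" using x by (simp add: mult.commute)
      also have "\<dots> = (x [^]\<^bsub>G\<^esub> i) [^]\<^bsub>G\<^esub> u \<otimes>\<^bsub>G\<^esub> (x [^]\<^bsub>G\<^esub> int p) [^]\<^bsub>G\<^esub> v"
        using x by (simp add: h.G.int_pow_mult h.G.int_pow_pow)
      also have "\<dots> \<in> L"
        by (intro L.m_closed h.G.subgroup_int_pow_closed[OF L.subgroup_axioms xi]
          h.G.subgroup_int_pow_closed[OF L.subgroup_axioms subsetD[OF conjunct2[OF L] xp]])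
      finally show False using x by simp
    qed
  qed
  then show False using z zM by (auto simp: frattini_def)
qed


section \<open>The linear part of a central element\<close>

context p_group_algebra
begin

definition square_quotient :: "('a \<Rightarrow> 'f) set ring" where
  "square_quotient = A Quot (P 2)"

definition residue_class :: "('a \<Rightarrow> 'f) \<Rightarrow> ('a \<Rightarrow> 'f) set" where
  "residue_class x = P 2 +>\<^bsub>A\<^esub> x"

text \<open>The class of \<open>g - 1\<close> modulo \<open>I\<^sup>2\<close>. It lives in \<open>I / I\<^sup>2\<close>, but is taken in the ring \<open>FG / I\<^sup>2\<close> so that
  coefficients can be multiplied.\<close>

definition linear_part :: "'a \<Rightarrow> ('a \<Rightarrow> 'f) set" where
  "linear_part g = residue_class (\<delta> g \<ominus>\<^bsub>A\<^esub> \<one>\<^bsub>A\<^esub>)"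

lemma residue_ring_hom: "ring_hom_ring A square_quotient residue_class"
proof -
  have "residue_class = (+>\<^bsub>A\<^esub>) (P 2)" by (rule ext) (simp add: residue_class_def)
  then show ?thesis
    unfolding square_quotient_def by (simp add: ideal.rcos_ring_hom_ring[OF ideal_P])
qed

lemma residue_class_eq_iff:
  "x \<in> carrier A \<Longrightarrow> y \<in> carrier A \<Longrightarrow> residue_class x = residue_class y \<longleftrightarrow> x \<ominus>\<^bsub>A\<^esub> y \<in> P 2"
  unfolding residue_class_def using A.quotient_eq_iff_same_a_r_cos[OF ideal_P] by simp

lemma residue_class_eq_zero:
  assumes "x \<in> P 2"
  shows "residue_class x = \<zero>\<^bsub>square_quotient\<^esub>"
proof -
  interpret \<pi>: ring_hom_ring A square_quotient residue_class by (rule residue_ring_hom)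
  have "residue_class x = residue_class \<zero>\<^bsub>A\<^esub>"
    using assms P_closed[OF assms] by (subst residue_class_eq_iff) (auto simp: A.minus_eq)
  then show ?thesis by simp
qed

lemma square_quotient_exponent:
  assumes "q \<in> carrier square_quotient"
  shows "[p] \<cdot>\<^bsub>square_quotient\<^esub> q = \<zero>\<^bsub>square_quotient\<^esub>"
proof -
  interpret \<pi>: ring_hom_ring A square_quotient residue_class by (rule residue_ring_hom)
  obtain x where x: "x \<in> carrier A" "q = residue_class x"
    using assms by (auto simp: square_quotient_def residue_class_def FactRing_def A_RCOSETS_def')
  have "residue_class ([k] \<cdot>\<^bsub>A\<^esub> x) = [k] \<cdot>\<^bsub>square_quotient\<^esub> residue_class x" for k :: nat
    using x(1) by (induction k) auto
  then show ?thesis using A_exponent[OF x(1)] x by (metis \<pi>.hom_zero)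
qed

lemma linear_part_closed:
  "g \<in> carrier G \<Longrightarrow> linear_part g \<in> carrier square_quotient"
proof -
  interpret \<pi>: ring_hom_ring A square_quotient residue_class by (rule residue_ring_hom)
  show "g \<in> carrier G \<Longrightarrow> linear_part g \<in> carrier square_quotient" by (simp add: linear_part_def)
qed

text \<open>From \<open>g h - 1 = (g - 1) (h - 1) + (g - 1) + (h - 1)\<close>.\<close>

lemma linear_part_mult:
  assumes g: "g \<in> carrier G" and h: "h \<in> carrier G"
  shows "linear_part (g \<otimes>\<^bsub>G\<^esub> h) = linear_part g \<oplus>\<^bsub>square_quotient\<^esub> linear_part h"
proof -
  interpret \<pi>: ring_hom_ring A square_quotient residue_class by (rule residue_ring_hom)
  let ?u = "\<delta> g \<ominus>\<^bsub>A\<^esub> \<one>\<^bsub>A\<^esub>" and ?v = "\<delta> h \<ominus>\<^bsub>A\<^esub> \<one>\<^bsub>A\<^esub>"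
  have uv: "?u \<otimes>\<^bsub>A\<^esub> ?v \<in> P 2"
    using ideal_prod.prod[of ?u I ?v "P (Suc 0)" A] basis_minus_one[OF g] basis_minus_one[OF h]
    by (simp add: numeral_2_eq_2 augmentation_power_Suc[of F G "Suc 0"] P_one)
  have c: "?u \<in> carrier A" "?v \<in> carrier A" by auto
  have "\<delta> (g \<otimes>\<^bsub>G\<^esub> h) \<ominus>\<^bsub>A\<^esub> \<one>\<^bsub>A\<^esub> = ?u \<otimes>\<^bsub>A\<^esub> ?v \<oplus>\<^bsub>A\<^esub> (?u \<oplus>\<^bsub>A\<^esub> ?v)"
  proof -
    have "?u \<otimes>\<^bsub>A\<^esub> ?v = \<delta> g \<otimes>\<^bsub>A\<^esub> ?v \<ominus>\<^bsub>A\<^esub> ?v"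
      using c by (simp add: A.minus_eq[of "\<delta> g" "\<one>\<^bsub>A\<^esub>"] A.l_distr A.l_minus A.minus_eq[of _ ?v])
    moreover have "\<delta> g \<otimes>\<^bsub>A\<^esub> ?v = \<delta> (g \<otimes>\<^bsub>G\<^esub> h) \<ominus>\<^bsub>A\<^esub> \<delta> g"
      using g h by (simp add: A.minus_eq A.r_distr A.r_minus basis_mult)
    ultimately have "?u \<otimes>\<^bsub>A\<^esub> ?v \<oplus>\<^bsub>A\<^esub> ?v = \<delta> (g \<otimes>\<^bsub>G\<^esub> h) \<ominus>\<^bsub>A\<^esub> \<delta> g"
      using c by (simp add: A.add_minus_cancel)
    then have "(?u \<otimes>\<^bsub>A\<^esub> ?v \<oplus>\<^bsub>A\<^esub> ?v) \<oplus>\<^bsub>A\<^esub> ?u = \<delta> (g \<otimes>\<^bsub>G\<^esub> h) \<ominus>\<^bsub>A\<^esub> \<one>\<^bsub>A\<^esub>"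
      by (simp add: A.minus_telescope)
    then show ?thesis using c by (simp add: A.add.m_ac)
  qed
  then have "linear_part (g \<otimes>\<^bsub>G\<^esub> h)
      = residue_class (?u \<otimes>\<^bsub>A\<^esub> ?v) \<oplus>\<^bsub>square_quotient\<^esub> (linear_part g \<oplus>\<^bsub>square_quotient\<^esub> linear_part h)"
    by (simp add: linear_part_def)
  then show ?thesis
    using residue_class_eq_zero[OF uv] linear_part_closed[OF g] linear_part_closed[OF h] by simp
qed

lemma linear_part_group_hom: "group_hom G (add_monoid square_quotient) linear_part"
proof -
  interpret \<pi>: ring_hom_ring A square_quotient residue_class by (rule residue_ring_hom)
  show ?thesis
    by (intro group_hom.intro group_hom_axioms.intro G.group_axioms \<pi>.S.a_group)
      (auto simp: hom_def linear_part_closed linear_part_mult)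
qed

text \<open>\<open>linear_part\<close> is a homomorphism to an abelian group of exponent \<open>p\<close>.\<close>

lemma linear_part_frattini:
  assumes "z \<in> frattini G"
  shows "linear_part z = \<zero>\<^bsub>square_quotient\<^esub>"
proof -
  interpret \<pi>: ring_hom_ring A square_quotient residue_class by (rule residue_ring_hom)
  have "linear_part z = \<one>\<^bsub>add_monoid square_quotient\<^esub>"
    using finite_G prime_p linear_part_group_hom
  proof (rule frattini_subset_kernel)
    show "comm_group (add_monoid square_quotient)" by (rule \<pi>.S.a_comm_group)
    show "k [^]\<^bsub>add_monoid square_quotient\<^esub> p = \<one>\<^bsub>add_monoid square_quotient\<^esub>"
      if "k \<in> carrier (add_monoid square_quotient)" for k
      using square_quotient_exponent[of k] that by (simp add: add_pow_def)
  qed (rule assms)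
  then show ?thesis by simp
qed

text \<open>Modulo \<open>I\<^sup>2\<close> the element \<open>b\<close> is the sum over \<open>z\<close> in the center of \<open>b z (z - 1)\<close>. Fix a representative
  \<open>r w\<close> of each fibre of \<open>z \<mapsto> z\<^sup>p\<close> and write \<open>z = r (z\<^sup>p) e z\<close> with \<open>(e z)\<^sup>p = 1\<close>. The part with \<open>r\<close>
  vanishes because the coefficients sum to zero over the fibres, and in the other part \<open>e z\<close> may be
  replaced by a congruent element of \<open>S\<close>.\<close>

lemma central_linear_part:
  assumes b: "central b" "b [^]\<^bsub>A\<^esub> p = \<zero>\<^bsub>A\<^esub>"
    and SG: "S \<subseteq> carrier G"
    and S: "\<And>z. z \<in> center G \<Longrightarrow> z [^]\<^bsub>G\<^esub> p = \<one>\<^bsub>G\<^esub> \<Longrightarrow> \<exists>s\<in>S. linear_part z = linear_part s"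
  obtains \<sigma> where "\<And>z. z \<in> center G \<Longrightarrow> \<sigma> z \<in> S"
    "b \<ominus>\<^bsub>A\<^esub> (\<Oplus>\<^bsub>A\<^esub>z\<in>center G. b z \<odot>\<^bsub>A\<^esub> (\<delta> (\<sigma> z) \<ominus>\<^bsub>A\<^esub> \<one>\<^bsub>A\<^esub>)) \<in> P 2"
proof -
  interpret \<pi>: ring_hom_ring A square_quotient residue_class by (rule residue_ring_hom)
  interpret aug: ring_hom_ring A F \<epsilon> by (rule augmentation_ring_hom)
  interpret lin: group_hom G "add_monoid square_quotient" linear_part by (rule linear_part_group_hom)
  interpret C: subgroup "center G" G by (rule center_subgroup[OF G.group_axioms])
  let ?Q = square_quotient
  have finC: "finite (center G)" using finite_G C.subset finite_subset by blast
  have bA: "b \<in> carrier A" using b central_closed by blast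
  \<comment> \<open>the scalars, seen in the quotient ring\<close>
  define c where "c a = residue_class (a \<odot>\<^bsub>A\<^esub> \<one>\<^bsub>A\<^esub>)" for a
  have c_closed: "c a \<in> carrier ?Q" if "a \<in> carrier F" for a using that by (simp add: c_def)
  have c_smult: "residue_class (a \<odot>\<^bsub>A\<^esub> (\<delta> g \<ominus>\<^bsub>A\<^esub> \<one>\<^bsub>A\<^esub>)) = c a \<otimes>\<^bsub>?Q\<^esub> linear_part g"
    if "a \<in> carrier F" for a g
  proof -
    have "a \<odot>\<^bsub>A\<^esub> (\<delta> g \<ominus>\<^bsub>A\<^esub> \<one>\<^bsub>A\<^esub>) = (a \<odot>\<^bsub>A\<^esub> \<one>\<^bsub>A\<^esub>) \<otimes>\<^bsub>A\<^esub> (\<delta> g \<ominus>\<^bsub>A\<^esub> \<one>\<^bsub>A\<^esub>)"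
      using that by (simp add: Alg.smult_mult_left)
    then show ?thesis using that by (simp add: c_def linear_part_def)
  qed
  have c_sum: "residue_class (\<Oplus>\<^bsub>A\<^esub>z\<in>J. b z \<odot>\<^bsub>A\<^esub> (\<delta> (\<sigma> z) \<ominus>\<^bsub>A\<^esub> \<one>\<^bsub>A\<^esub>))
      = (\<Oplus>\<^bsub>?Q\<^esub>z\<in>J. c (b z) \<otimes>\<^bsub>?Q\<^esub> linear_part (\<sigma> z))"
    if J: "J \<subseteq> carrier G" and \<sigma>: "\<And>z. z \<in> J \<Longrightarrow> \<sigma> z \<in> carrier G" for J and \<sigma> :: "'a \<Rightarrow> 'a"
  proof -
    have "residue_class (\<Oplus>\<^bsub>A\<^esub>z\<in>J. b z \<odot>\<^bsub>A\<^esub> (\<delta> (\<sigma> z) \<ominus>\<^bsub>A\<^esub> \<one>\<^bsub>A\<^esub>))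
        = (\<Oplus>\<^bsub>?Q\<^esub>z\<in>J. residue_class (b z \<odot>\<^bsub>A\<^esub> (\<delta> (\<sigma> z) \<ominus>\<^bsub>A\<^esub> \<one>\<^bsub>A\<^esub>)))"
      using bA J by (intro additive_finsum[where h = residue_class])
        (auto simp: A.abelian_monoid_axioms \<pi>.S.abelian_monoid_axioms)
    also have "\<dots> = (\<Oplus>\<^bsub>?Q\<^esub>z\<in>J. c (b z) \<otimes>\<^bsub>?Q\<^esub> linear_part (\<sigma> z))"
      using bA J \<sigma> c_closed linear_part_closed
      by (intro \<pi>.S.finsum_cong') (auto simp: c_smult subset_iff)
    finally show ?thesis .
  qed
  have aug_b: "\<epsilon> b = \<zero>\<^bsub>F\<^esub>"
  proof (rule F.nat_pow_eq_zero)
    have "\<epsilon> (b [^]\<^bsub>A\<^esub> k) = \<epsilon> b [^]\<^bsub>F\<^esub> k" for k :: nat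
      using bA by (induction k) auto
    then show "\<epsilon> b [^]\<^bsub>F\<^esub> p = \<zero>\<^bsub>F\<^esub>" using b(2) by (metis aug.hom_zero)
  qed (simp add: bA)
  have "residue_class b = residue_class (\<Oplus>\<^bsub>A\<^esub>g\<in>carrier G. b g \<odot>\<^bsub>A\<^esub> (\<delta> g \<ominus>\<^bsub>A\<^esub> \<one>\<^bsub>A\<^esub>))"
    using I_expansion[OF bA aug_b] by simp
  also have "\<dots> = (\<Oplus>\<^bsub>?Q\<^esub>g\<in>carrier G. c (b g) \<otimes>\<^bsub>?Q\<^esub> linear_part g)"
    by (rule c_sum) auto
  also have "\<dots> = (\<Oplus>\<^bsub>?Q\<^esub>z\<in>center G. c (b z) \<otimes>\<^bsub>?Q\<^esub> linear_part z)"
  proof (rule conjugation_sum[OF \<pi>.S.abelian_group_axioms square_quotient_exponent])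
    fix g x assume gx: "g \<in> carrier G" "x \<in> carrier G"
    have "linear_part (inv\<^bsub>G\<^esub> g) = \<ominus>\<^bsub>?Q\<^esub> linear_part g"
      using lin.hom_inv[OF gx(1)] by (simp add: a_inv_def)
    then have "linear_part (g \<otimes>\<^bsub>G\<^esub> x \<otimes>\<^bsub>G\<^esub> inv\<^bsub>G\<^esub> g)
        = (linear_part x \<oplus>\<^bsub>?Q\<^esub> linear_part g) \<oplus>\<^bsub>?Q\<^esub> \<ominus>\<^bsub>?Q\<^esub> linear_part g"
      using gx linear_part_closed by (simp add: linear_part_mult \<pi>.S.a_comm)
    also have "\<dots> = linear_part x"
      using gx linear_part_closed by (simp add: \<pi>.S.a_assoc \<pi>.S.r_neg)
    finally show "c (b (g \<otimes>\<^bsub>G\<^esub> x \<otimes>\<^bsub>G\<^esub> inv\<^bsub>G\<^esub> g)) \<otimes>\<^bsub>?Q\<^esub> linear_part (g \<otimes>\<^bsub>G\<^esub> x \<otimes>\<^bsub>G\<^esub> inv\<^bsub>G\<^esub> g)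
        = c (b x) \<otimes>\<^bsub>?Q\<^esub> linear_part x"
      using central_conjugate[OF b(1) gx] by simp
  qed (use bA c_closed linear_part_closed in auto)
  finally have b_eq: "residue_class b = (\<Oplus>\<^bsub>?Q\<^esub>z\<in>center G. c (b z) \<otimes>\<^bsub>?Q\<^esub> linear_part z)" .
  \<comment> \<open>evaluated only at p-th powers of central elements, where the choice is possible\<close>
  define r where "r w = (SOME z. z \<in> center G \<and> z [^]\<^bsub>G\<^esub> p = w)" for w
  have r: "r (z [^]\<^bsub>G\<^esub> p) \<in> center G" "r (z [^]\<^bsub>G\<^esub> p) [^]\<^bsub>G\<^esub> p = z [^]\<^bsub>G\<^esub> p"
    if "z \<in> center G" for z
    using someI[of "\<lambda>y. y \<in> center G \<and> y [^]\<^bsub>G\<^esub> p = z [^]\<^bsub>G\<^esub> p" z] that by (auto simp: r_def)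
  \<comment> \<open>the step from the chosen representative of the fibre to \<open>z\<close>\<close>
  define e where "e z = inv\<^bsub>G\<^esub> (r (z [^]\<^bsub>G\<^esub> p)) \<otimes>\<^bsub>G\<^esub> z" for z
  have eC: "e z \<in> center G" if "z \<in> center G" for z
    using that r by (simp add: e_def)
  have e_pow: "e z [^]\<^bsub>G\<^esub> p = \<one>\<^bsub>G\<^esub>" if z: "z \<in> center G" for z
  proof -
    let ?r = "r (z [^]\<^bsub>G\<^esub> p)"
    have comm: "inv\<^bsub>G\<^esub> ?r \<otimes>\<^bsub>G\<^esub> z = z \<otimes>\<^bsub>G\<^esub> inv\<^bsub>G\<^esub> ?r"
    proof -
      have "inv\<^bsub>G\<^esub> ?r \<in> center G" using r[OF z] by simp
      then show ?thesis using z C.subset unfolding center_def by blast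
    qed
    have "e z [^]\<^bsub>G\<^esub> p = inv\<^bsub>G\<^esub> ?r [^]\<^bsub>G\<^esub> p \<otimes>\<^bsub>G\<^esub> z [^]\<^bsub>G\<^esub> p"
      unfolding e_def using z r[OF z] by (intro G.pow_mult_distrib comm) auto
    also have "\<dots> = inv\<^bsub>G\<^esub> (?r [^]\<^bsub>G\<^esub> p) \<otimes>\<^bsub>G\<^esub> z [^]\<^bsub>G\<^esub> p"
      using r[OF z] by (simp add: G.nat_pow_inv)
    also have "\<dots> = \<one>\<^bsub>G\<^esub>" using z r[OF z] by simp
    finally show ?thesis .
  qed
  define \<sigma> where "\<sigma> z = (SOME s. s \<in> S \<and> linear_part (e z) = linear_part s)" for z
  have \<sigma>: "\<sigma> z \<in> S" "linear_part (e z) = linear_part (\<sigma> z)" if z: "z \<in> center G" for z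
  proof -
    have "\<exists>s. s \<in> S \<and> linear_part (e z) = linear_part s"
      using S[OF eC[OF z] e_pow[OF z]] by blast
    from someI_ex[OF this] show "\<sigma> z \<in> S" "linear_part (e z) = linear_part (\<sigma> z)"
      unfolding \<sigma>_def by blast+
  qed
  have split: "linear_part z = linear_part (r (z [^]\<^bsub>G\<^esub> p)) \<oplus>\<^bsub>?Q\<^esub> linear_part (\<sigma> z)"
    if z: "z \<in> center G" for z
  proof -
    have "z = r (z [^]\<^bsub>G\<^esub> p) \<otimes>\<^bsub>G\<^esub> e z"
      unfolding e_def using z r[OF z] by (simp add: G.m_assoc[symmetric])
    then have "linear_part z = linear_part (r (z [^]\<^bsub>G\<^esub> p) \<otimes>\<^bsub>G\<^esub> e z)" by (rule arg_cong)
    also have "\<dots> = linear_part (r (z [^]\<^bsub>G\<^esub> p)) \<oplus>\<^bsub>?Q\<^esub> linear_part (e z)"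
      using r(1)[OF z] eC[OF z] by (intro linear_part_mult) auto
    finally show ?thesis unfolding \<sigma>(2)[OF z] .
  qed
  let ?W = "(\<lambda>z. z [^]\<^bsub>G\<^esub> p) ` center G"
  have powC: "z [^]\<^bsub>G\<^esub> k \<in> center G" if "z \<in> center G" for z and k :: nat
    using that by (induction k) simp_all
  have W: "w \<in> center G" if "w \<in> ?W" for w
    using that by (rule imageE) (simp only: powC)
  have rW: "r w \<in> carrier G" if "w \<in> ?W" for w
    using that by (rule imageE) (simp only: C.mem_carrier[OF r(1)])
  have lin: "linear_part (r (z [^]\<^bsub>G\<^esub> p)) \<in> carrier ?Q" "linear_part (\<sigma> z) \<in> carrier ?Q"
    if "z \<in> center G" for z
    using linear_part_closed[OF C.mem_carrier[OF r(1)[OF that]]]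
      linear_part_closed[OF subsetD[OF SG \<sigma>(1)[OF that]]] by blast+
  have cb: "c (b z) \<in> carrier ?Q" if "z \<in> center G" for z
    by (rule c_closed[OF elem_closed[OF bA C.mem_carrier[OF that]]])
  have "(\<Oplus>\<^bsub>?Q\<^esub>z\<in>center G. c (b z) \<otimes>\<^bsub>?Q\<^esub> linear_part (r (z [^]\<^bsub>G\<^esub> p)))
      = (\<Oplus>\<^bsub>?Q\<^esub>w\<in>?W. \<Oplus>\<^bsub>?Q\<^esub>z\<in>{z \<in> center G. z [^]\<^bsub>G\<^esub> p = w}. c (b z) \<otimes>\<^bsub>?Q\<^esub> linear_part (r (z [^]\<^bsub>G\<^esub> p)))"
    using finC lin cb by (intro \<pi>.S.finsum_fibres) auto
  also have "\<dots> = (\<Oplus>\<^bsub>?Q\<^esub>w\<in>?W. \<zero>\<^bsub>?Q\<^esub>)"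
  proof (intro \<pi>.S.finsum_cong' refl)
    fix w assume w: "w \<in> ?W"
    let ?Z = "{z \<in> center G. z [^]\<^bsub>G\<^esub> p = w}"
    have finZ: "finite ?Z" using finC by simp
    have "(\<Oplus>\<^bsub>?Q\<^esub>z\<in>?Z. c (b z) \<otimes>\<^bsub>?Q\<^esub> linear_part (r (z [^]\<^bsub>G\<^esub> p)))
        = (\<Oplus>\<^bsub>?Q\<^esub>z\<in>?Z. c (b z) \<otimes>\<^bsub>?Q\<^esub> linear_part (r w))"
      using cb rW[OF w] by (intro \<pi>.S.finsum_cong') (auto intro!: linear_part_closed)
    also have "\<dots> = (\<Oplus>\<^bsub>?Q\<^esub>z\<in>?Z. c (b z)) \<otimes>\<^bsub>?Q\<^esub> linear_part (r w)"
      using finZ cb rW[OF w] by (intro \<pi>.S.finsum_ldistr[symmetric]) (auto intro!: linear_part_closed)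
    also have "(\<Oplus>\<^bsub>?Q\<^esub>z\<in>?Z. c (b z)) = c (\<Oplus>\<^bsub>F\<^esub>z\<in>?Z. b z)"
      using bA by (intro additive_finsum[where h = c, symmetric])
        (auto simp: c_def Alg.smult_l_distr F.abelian_monoid_axioms \<pi>.S.abelian_monoid_axioms)
    also have "(\<Oplus>\<^bsub>F\<^esub>z\<in>?Z. b z) = \<zero>\<^bsub>F\<^esub>" by (rule central_fibre_sums_zero[OF b W[OF w]])
    finally show "(\<Oplus>\<^bsub>?Q\<^esub>z\<in>?Z. c (b z) \<otimes>\<^bsub>?Q\<^esub> linear_part (r (z [^]\<^bsub>G\<^esub> p))) = \<zero>\<^bsub>?Q\<^esub>"
      using rW[OF w] linear_part_closed by (simp add: c_def)
  qed simp
  also have "\<dots> = \<zero>\<^bsub>?Q\<^esub>" by simp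
  finally have r_sum: "(\<Oplus>\<^bsub>?Q\<^esub>z\<in>center G. c (b z) \<otimes>\<^bsub>?Q\<^esub> linear_part (r (z [^]\<^bsub>G\<^esub> p))) = \<zero>\<^bsub>?Q\<^esub>" .
  have "residue_class b = (\<Oplus>\<^bsub>?Q\<^esub>z\<in>center G. c (b z) \<otimes>\<^bsub>?Q\<^esub> linear_part (r (z [^]\<^bsub>G\<^esub> p))
      \<oplus>\<^bsub>?Q\<^esub> c (b z) \<otimes>\<^bsub>?Q\<^esub> linear_part (\<sigma> z))"
    unfolding b_eq using cb lin
    by (intro \<pi>.S.finsum_cong') (auto simp: split \<pi>.S.r_distr)
  also have "\<dots> = (\<Oplus>\<^bsub>?Q\<^esub>z\<in>center G. c (b z) \<otimes>\<^bsub>?Q\<^esub> linear_part (r (z [^]\<^bsub>G\<^esub> p)))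
      \<oplus>\<^bsub>?Q\<^esub> (\<Oplus>\<^bsub>?Q\<^esub>z\<in>center G. c (b z) \<otimes>\<^bsub>?Q\<^esub> linear_part (\<sigma> z))"
    using cb lin by (intro \<pi>.S.finsum_addf) auto
  also have "\<dots> = (\<Oplus>\<^bsub>?Q\<^esub>z\<in>center G. c (b z) \<otimes>\<^bsub>?Q\<^esub> linear_part (\<sigma> z))"
    unfolding r_sum using cb lin by (intro \<pi>.S.l_zero \<pi>.S.finsum_closed) auto
  also have "\<dots> = residue_class (\<Oplus>\<^bsub>A\<^esub>z\<in>center G. b z \<odot>\<^bsub>A\<^esub> (\<delta> (\<sigma> z) \<ominus>\<^bsub>A\<^esub> \<one>\<^bsub>A\<^esub>))"
    using \<sigma> SG C.subset by (intro c_sum[symmetric]) auto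
  finally have "b \<ominus>\<^bsub>A\<^esub> (\<Oplus>\<^bsub>A\<^esub>z\<in>center G. b z \<odot>\<^bsub>A\<^esub> (\<delta> (\<sigma> z) \<ominus>\<^bsub>A\<^esub> \<one>\<^bsub>A\<^esub>)) \<in> P 2"
    using bA C.subset by (subst (asm) residue_class_eq_iff) (auto intro!: A.finsum_closed)
  then show ?thesis using that \<sigma>(1) by blast
qed

end

section \<open>Direct products and elementary decompositions\<close>

definition factor :: "('a, 'c) monoid_scheme \<Rightarrow> 'a set \<Rightarrow> 'a set \<Rightarrow> 'a \<Rightarrow> 'a" where
  "factor G T U g = (THE t. t \<in> T \<and> (\<exists>u\<in>U. g = t \<otimes>\<^bsub>G\<^esub> u))"

locale direct_product = group G for G :: "('a, 'c) monoid_scheme" (structure) +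
  fixes T U :: "'a set"
  assumes product: "internal_direct_product G T U"
begin

sublocale T: subgroup T G
  using product normal_imp_subgroup by (auto simp: internal_direct_product_def)

sublocale U: subgroup U G
  using product normal_imp_subgroup by (auto simp: internal_direct_product_def)

lemma disjoint: "x \<in> T \<Longrightarrow> x \<in> U \<Longrightarrow> x = \<one>"
  using product by (auto simp: internal_direct_product_def)

text \<open>The commutator lies in both normal factors.\<close>

lemma factors_commute:
  assumes t: "t \<in> T" and u: "u \<in> U"
  shows "t \<otimes> u = u \<otimes> t"
proof -
  have tu: "t \<in> carrier G" "u \<in> carrier G" using t u by auto
  have normal: "normal T G" "normal U G" using product by (auto simp: internal_direct_product_def)
  have "t \<otimes> u \<otimes> inv t \<in> U" using normal.inv_op_closed2[OF normal(2) tu(1) u] .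
  then have "t \<otimes> u \<otimes> inv t \<otimes> inv u \<in> U" using u by blast
  moreover have "u \<otimes> inv t \<otimes> inv u \<in> T"
    using normal.inv_op_closed2[OF normal(1) tu(2), of "inv t"] t by blast
  then have "t \<otimes> (u \<otimes> inv t \<otimes> inv u) \<in> T" using t by blast
  ultimately have "t \<otimes> u \<otimes> inv t \<otimes> inv u = \<one>"
    using tu by (intro disjoint) (simp_all add: m_assoc)
  then have "t \<otimes> u \<otimes> inv t = u" using tu by (metis inv_closed inv_equality inv_inv m_closed)
  then show ?thesis using tu by (metis inv_solve_right m_closed)
qed

lemma factors_unique:
  assumes "t \<in> T" "u \<in> U" "t' \<in> T" "u' \<in> U" "t \<otimes> u = t' \<otimes> u'"
  shows "t = t'" "u = u'"
proof -
  have c: "t \<in> carrier G" "u \<in> carrier G" "t' \<in> carrier G" "u' \<in> carrier G" using assms by auto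
  have eq: "inv t' \<otimes> t = u' \<otimes> inv u"
    using assms(5) c by (metis inv_closed inv_solve_left inv_solve_right m_assoc m_closed)
  have "inv t' \<otimes> t \<in> T" using assms by blast
  moreover have "inv t' \<otimes> t \<in> U" unfolding eq using assms by blast
  ultimately have one: "inv t' \<otimes> t = \<one>" by (rule disjoint)
  then show "t = t'" using c by (metis inv_closed inv_equality inv_inv)
  then show "u = u'" using assms(5) c by simp
qed

lemma factor_mult: "t \<in> T \<Longrightarrow> u \<in> U \<Longrightarrow> factor G T U (t \<otimes> u) = t"
  unfolding factor_def using factors_unique(1) by (intro the_equality) metis+

lemma factors_exist:
  assumes "g \<in> carrier G"
  obtains t u where "t \<in> T" "u \<in> U" "g = t \<otimes> u"
proof -
  have "g \<in> T <#> U" using assms product by (simp add: internal_direct_product_def)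
  then show ?thesis using that by (auto simp: set_mult_def)
qed

lemma factor_closed: "g \<in> carrier G \<Longrightarrow> factor G T U g \<in> T"
  by (erule factors_exist) (simp add: factor_mult)

lemma factor_hom: "factor G T U \<in> hom G (G\<lparr>carrier := T\<rparr>)"
proof (rule homI)
  fix g h assume g: "g \<in> carrier G" and h: "h \<in> carrier G"
  obtain t u where tu: "t \<in> T" "u \<in> U" "g = t \<otimes> u" using g by (rule factors_exist)
  obtain s v where sv: "s \<in> T" "v \<in> U" "h = s \<otimes> v" using h by (rule factors_exist)
  have "t \<in> carrier G" "u \<in> carrier G" "s \<in> carrier G" "v \<in> carrier G" using tu sv by auto
  then have "g \<otimes> h = t \<otimes> (u \<otimes> s) \<otimes> v" unfolding tu(3) sv(3) by (simp add: m_assoc)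
  also have "u \<otimes> s = s \<otimes> u" using factors_commute[OF sv(1) tu(2)] by simp
  finally have "g \<otimes> h = (t \<otimes> s) \<otimes> (u \<otimes> v)"
    using \<open>t \<in> carrier G\<close> \<open>u \<in> carrier G\<close> \<open>s \<in> carrier G\<close> \<open>v \<in> carrier G\<close> by (simp add: m_assoc)
  then show "factor G T U (g \<otimes> h) = factor G T U g \<otimes>\<^bsub>G\<lparr>carrier := T\<rparr>\<^esub> factor G T U h"
    using tu sv by (simp add: factor_mult)
qed (simp add: factor_closed)

lemma factor_left: "t \<in> T \<Longrightarrow> factor G T U t = t"
  using factor_mult[of t \<one>] by simp

lemma factor_right: "u \<in> U \<Longrightarrow> factor G T U u = \<one>"
  using factor_mult[of \<one> u] by simp

lemma swap: "direct_product G U T"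
proof (intro direct_product.intro direct_product_axioms.intro group_axioms)
  have "U <#> T = T <#> U"
    unfolding set_mult_def using factors_commute by (auto, metis+)
  then show "internal_direct_product G U T"
    using product by (auto simp: internal_direct_product_def)
qed

lemma factor_decomposition:
  assumes "g \<in> carrier G"
  shows "g = factor G T U g \<otimes> factor G U T g"
proof -
  interpret S: direct_product G U T by (rule swap)
  obtain t u where tu: "t \<in> T" "u \<in> U" "g = t \<otimes> u" using assms by (rule factors_exist)
  have "factor G U T g = u"
    unfolding tu(3) factors_commute[OF tu(1,2)] by (rule S.factor_mult[OF tu(2,1)])
  then show ?thesis using tu by (simp add: factor_mult)
qed

lemma commutative_factor_central:
  assumes "comm_group (G\<lparr>carrier := T\<rparr>)"
  shows "T \<subseteq> center G"
proof
  fix t assume t: "t \<in> T"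
  have "t \<otimes> g = g \<otimes> t" if g: "g \<in> carrier G" for g
  proof -
    obtain s u where su: "s \<in> T" "u \<in> U" "g = s \<otimes> u" using g by (rule factors_exist)
    have c: "t \<in> carrier G" "s \<in> carrier G" "u \<in> carrier G" using t su by auto
    have ts: "t \<otimes> s = s \<otimes> t"
      using comm_groupE(4)[OF assms, of t s] t su by simp
    have "t \<otimes> g = s \<otimes> t \<otimes> u" unfolding su(3) using c by (simp add: m_assoc[symmetric] ts)
    also have "\<dots> = g \<otimes> t" unfolding su(3) using c by (simp add: m_assoc factors_commute[OF t su(2)])
    finally show ?thesis .
  qed
  then show "t \<in> center G" using t by (auto simp: center_def)
qed

end

lemma subgroup_frattini:
  assumes "group G"
  shows "subgroup (frattini G) G"
proof -
  interpret group G by fact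
  have "subgroup M G" if "maximal_subgroup M G" for M
    using that by (simp add: maximal_subgroup_def)
  then show ?thesis
    unfolding frattini_def
    by (intro subgroupI) (auto dest: subgroup.one_closed subgroup.m_closed subgroup.m_inv_closed)
qed

lemma socle_elem:
  assumes G: "group G" and p: "Factorial_Ring.prime p"
    and z: "z \<in> center G" "z [^]\<^bsub>G\<^esub> (p::nat) = \<one>\<^bsub>G\<^esub>"
  shows "z \<in> socle p G"
proof -
  interpret group G by fact
  have zG: "z \<in> carrier G" using z by (simp add: center_def)
  have "ord z dvd p" using z zG pow_eq_id by blast
  then have "ord z = 1 \<or> ord z = p" using p by (simp add: prime_nat_iff)
  then show ?thesis
  proof
    assume "ord z = 1"
    then have "z = \<one>\<^bsub>G\<^esub>" using zG ord_eq_1 by blast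
    then show ?thesis unfolding socle_def by (simp add: generate.one)
  next
    assume "ord z = p"
    then show ?thesis unfolding socle_def using z by (intro generate.incl) simp
  qed
qed

text \<open>The factor \<open>T\<close> is contained in the socle, meets its Frattini part trivially and has the index of
  that part as its order. By counting, \<open>T\<close> is a complement of the Frattini part in the socle.\<close>

lemma elementary_decomposition_socle:
  assumes p: "Factorial_Ring.prime p" and G: "group G" and fin: "finite (carrier G)"
    and dec: "elementary_decomposition p G T U" and el: "elementary_abelian p (G\<lparr>carrier := T\<rparr>)"
    and z: "z \<in> center G" "z [^]\<^bsub>G\<^esub> p = \<one>\<^bsub>G\<^esub>"
  obtains t d where "t \<in> T" "d \<in> frattini G" "z = t \<otimes>\<^bsub>G\<^esub> d"
proof -
  interpret group G by fact
  interpret direct_product G T U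
    using dec by unfold_locales (simp add: elementary_decomposition_def)
  have TC: "T \<subseteq> center G"
    using el by (intro commutative_factor_central) (simp add: elementary_abelian_def)
  let ?S = "socle p G" and ?W = "socle p G \<inter> frattini G"
  have S: "subgroup ?S G"
    unfolding socle_def by (intro generate_is_subgroup) (auto simp: center_def)
  have W: "subgroup ?W G" using S subgroup_frattini[OF G] by (rule subgroups_Inter_pair)
  interpret S: subgroup ?S G by (rule S)
  interpret W: subgroup ?W G by (rule W)
  have TS: "T \<subseteq> ?S"
  proof
    fix t assume t: "t \<in> T"
    have "t [^]\<^bsub>G\<^esub> p = \<one>\<^bsub>G\<^esub>"
      using el t by (simp add: elementary_abelian_def flip: nat_pow_consistent)
    then show "t \<in> ?S" using socle_elem[OF G p] TC t by blast
  qed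
  have "subgroup ?W (G\<lparr>carrier := ?S\<rparr>)" by (rule subgroup_incl[OF W S]) simp
  then have "card (rcosets\<^bsub>G\<lparr>carrier := ?S\<rparr>\<^esub> ?W) * card ?W = card ?S"
    using group.lagrange[OF subgroup_imp_group[OF S]] by (simp add: order_def)
  moreover have "card T = card (rcosets\<^bsub>G\<lparr>carrier := ?S\<rparr>\<^esub> ?W)"
    using dec by (simp add: elementary_decomposition_def subgroup_index_def)
  ultimately have card: "card T * card ?W = card ?S" by simp
  let ?f = "\<lambda>(t, w). t \<otimes>\<^bsub>G\<^esub> w"
  have inj: "inj_on ?f (T \<times> ?W)"
  proof (rule inj_onI, clarify)
    fix t w t' w' assume a: "t \<in> T" "t' \<in> T" "w \<in> ?S" "w \<in> frattini G" "w' \<in> ?S" "w' \<in> frattini G"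
      and eq: "t \<otimes>\<^bsub>G\<^esub> w = t' \<otimes>\<^bsub>G\<^esub> w'"
    have w: "w \<in> ?W" "w' \<in> ?W" using a by auto
    have c: "t \<in> carrier G" "t' \<in> carrier G" "w \<in> carrier G" "w' \<in> carrier G" using a w by auto
    have eq': "inv\<^bsub>G\<^esub> t' \<otimes>\<^bsub>G\<^esub> t = w' \<otimes>\<^bsub>G\<^esub> inv\<^bsub>G\<^esub> w"
      using eq c by (metis inv_closed inv_solve_left inv_solve_right m_assoc m_closed)
    have "inv\<^bsub>G\<^esub> t' \<otimes>\<^bsub>G\<^esub> t \<in> T" using a by blast
    moreover have "inv\<^bsub>G\<^esub> t' \<otimes>\<^bsub>G\<^esub> t \<in> frattini G"
      unfolding eq' using W.m_closed[OF w(2) W.m_inv_closed[OF w(1)]] by blast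
    ultimately have "inv\<^bsub>G\<^esub> t' \<otimes>\<^bsub>G\<^esub> t = \<one>\<^bsub>G\<^esub>"
      using dec unfolding elementary_decomposition_def by blast
    then have "t = t'" using c by (metis inv_closed inv_equality inv_inv)
    then show "t = t' \<and> w = w'" using eq c by simp
  qed
  have "?f ` (T \<times> ?W) \<subseteq> ?S"
  proof clarify
    fix t w assume "t \<in> T" "w \<in> ?S"
    then show "t \<otimes>\<^bsub>G\<^esub> w \<in> ?S" using TS by blast
  qed
  moreover have "card (?f ` (T \<times> ?W)) = card ?S"
    using card_image[OF inj] card by (simp add: card_cartesian_product)
  moreover have "finite ?S" using S.subset fin by (rule finite_subset)
  ultimately have "?f ` (T \<times> ?W) = ?S" by (intro card_subset_eq)
  then have "z \<in> ?f ` (T \<times> ?W)" using socle_elem[OF G p z] by simp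
  then show ?thesis using that by auto
qed

section \<open>Inclusions and projections\<close>

definition inclusion ::
    "('f, 'm) ring_scheme \<Rightarrow> ('a, 'c) monoid_scheme \<Rightarrow> 'a set \<Rightarrow> ('a \<Rightarrow> 'f) \<Rightarrow> 'a \<Rightarrow> 'f" where
  "inclusion F G T = group_map F (G\<lparr>carrier := T\<rparr>) G (\<lambda>x. x)"

definition projection ::
    "('f, 'm) ring_scheme \<Rightarrow> ('a, 'c) monoid_scheme \<Rightarrow> 'a set \<Rightarrow> 'a set \<Rightarrow> ('a \<Rightarrow> 'f) \<Rightarrow> 'a \<Rightarrow> 'f"
  where "projection F G T U = group_map F G (G\<lparr>carrier := T\<rparr>) (factor G T U)"

locale p_group_product = A: p_group_algebra F G p + direct_product G T U
  for F :: "('f, 'm) ring_scheme" and G :: "('a, 'c) monoid_scheme" and p T U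
begin

lemma swap: "p_group_product F G p U T"
  by (intro p_group_product.intro A.p_group_algebra_axioms swap)

lemma left_algebra: "p_group_algebra F (G\<lparr>carrier := T\<rparr>) p"
  by (rule p_group_algebra_subgroup[OF A.p_group_algebra_axioms T.subgroup_axioms])

lemma finite_algebras: "finite_group_algebra F G" "finite_group_algebra F (G\<lparr>carrier := T\<rparr>)"
proof -
  interpret L: p_group_algebra F "G\<lparr>carrier := T\<rparr>" p by (rule left_algebra)
  show "finite_group_algebra F G" "finite_group_algebra F (G\<lparr>carrier := T\<rparr>)" by unfold_locales
qed

lemma id_hom: "(\<lambda>x. x) \<in> hom (G\<lparr>carrier := T\<rparr>) G"
  by (rule homI) auto

lemma inclusion_hom:
  "inclusion F G T \<in> algebra_hom F (group_algebra F (G\<lparr>carrier := T\<rparr>)) (group_algebra F G)"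
  unfolding inclusion_def by (rule group_map_algebra_hom[OF finite_algebras(2,1) id_hom])

lemma inclusion_basis: "t \<in> T \<Longrightarrow> inclusion F G T (basis F (G\<lparr>carrier := T\<rparr>) t) = basis F G t"
  unfolding inclusion_def by (subst group_map_basis[OF finite_algebras(2,1)]) auto

lemma inclusion_augmentation:
  "x \<in> carrier (group_algebra F (G\<lparr>carrier := T\<rparr>)) \<Longrightarrow>
    augmentation F G (inclusion F G T x) = augmentation F (G\<lparr>carrier := T\<rparr>) x"
  unfolding inclusion_def by (rule augmentation_group_map[OF finite_algebras(2,1) id_hom])

lemma projection_hom:
  "projection F G T U \<in> algebra_hom F (group_algebra F G) (group_algebra F (G\<lparr>carrier := T\<rparr>))"
  unfolding projection_def by (rule group_map_algebra_hom[OF finite_algebras factor_hom])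

lemma projection_basis:
  "g \<in> carrier G \<Longrightarrow> projection F G T U (basis F G g) = basis F (G\<lparr>carrier := T\<rparr>) (factor G T U g)"
  unfolding projection_def by (rule group_map_basis[OF finite_algebras])

lemma projection_augmentation:
  "x \<in> carrier (group_algebra F G) \<Longrightarrow>
    augmentation F (G\<lparr>carrier := T\<rparr>) (projection F G T U x) = augmentation F G x"
  unfolding projection_def by (rule augmentation_group_map[OF finite_algebras factor_hom])

lemma projection_inclusion:
  assumes "x \<in> carrier (group_algebra F (G\<lparr>carrier := T\<rparr>))"
  shows "projection F G T U (inclusion F G T x) = x"
proof -
  interpret L: p_group_algebra F "G\<lparr>carrier := T\<rparr>" p by (rule left_algebra)
  show ?thesis
  proof (rule L.algebra_hom_eqI[where h = "\<lambda>x. projection F G T U (inclusion F G T x)" and k = "\<lambda>x. x"])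
    show "(\<lambda>x. projection F G T U (inclusion F G T x)) \<in> algebra_hom F L.A L.A"
      by (rule algebra_hom_compose[OF inclusion_hom projection_hom])
    show "projection F G T U (inclusion F G T (L.\<delta> t)) = L.\<delta> t"
      if "t \<in> carrier (G\<lparr>carrier := T\<rparr>)" for t
      using that by (simp add: inclusion_basis projection_basis factor_left)
  qed (auto simp: algebra_hom_def ring_hom_def assms L.Alg.unital_algebra_axioms)
qed

text \<open>The composite sends every element of \<open>U\<close> to 1, so it is the augmentation followed by the scalars.\<close>

lemma projection_other_inclusion:
  assumes "x \<in> augmentation_ideal F (G\<lparr>carrier := U\<rparr>)"
  shows "projection F G T U (inclusion F G U x) = \<zero>\<^bsub>group_algebra F (G\<lparr>carrier := T\<rparr>)\<^esub>"
proof -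
  interpret R: p_group_product F G p U T by (rule swap)
  interpret L: p_group_algebra F "G\<lparr>carrier := T\<rparr>" p by (rule left_algebra)
  interpret M: p_group_algebra F "G\<lparr>carrier := U\<rparr>" p by (rule R.left_algebra)
  let ?h = "\<lambda>x. projection F G T U (inclusion F G U x)"
  have x: "x \<in> carrier M.A" "M.\<epsilon> x = \<zero>\<^bsub>F\<^esub>" using assms by (auto simp: augmentation_ideal_def)
  have "?h x = linear_extension (G\<lparr>carrier := U\<rparr>) L.A (\<lambda>u. ?h (M.\<delta> u)) x"
    by (rule M.algebra_hom_expansion[OF algebra_hom_compose[OF R.inclusion_hom projection_hom]
      L.Alg.unital_algebra_axioms x(1)])
  also have "\<dots> = (\<Oplus>\<^bsub>L.A\<^esub>u\<in>carrier (G\<lparr>carrier := U\<rparr>). x u \<odot>\<^bsub>L.A\<^esub> \<one>\<^bsub>L.A\<^esub>)"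
  proof -
    have "?h (M.\<delta> u) = \<one>\<^bsub>L.A\<^esub>" if "u \<in> U" for u
      using that by (simp add: R.inclusion_basis projection_basis factor_right L.one_eq_basis)
    then show ?thesis
      unfolding linear_extension_def using M.elem_closed[OF x(1)]
      by (intro L.A.finsum_cong') auto
  qed
  also have "\<dots> = M.\<epsilon> x \<odot>\<^bsub>L.A\<^esub> \<one>\<^bsub>L.A\<^esub>"
    unfolding augmentation_def using M.elem_closed[OF x(1)]
    by (intro additive_finsum[where h = "\<lambda>a. a \<odot>\<^bsub>L.A\<^esub> \<one>\<^bsub>L.A\<^esub>", symmetric])
      (auto simp: L.Alg.smult_l_distr L.A.abelian_monoid_axioms A.F.abelian_monoid_axioms)
  also have "\<dots> = \<zero>\<^bsub>L.A\<^esub>" using x(2) by simp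
  finally show ?thesis .
qed

lemma inclusion_power:
  "x \<in> augmentation_power F (G\<lparr>carrier := T\<rparr>) k \<Longrightarrow> inclusion F G T x \<in> augmentation_power F G k"
  by (rule algebra_hom_augmentation_power[OF finite_algebras(2,1) inclusion_hom inclusion_augmentation])

lemma projection_power:
  "x \<in> augmentation_power F G k \<Longrightarrow>
    projection F G T U x \<in> augmentation_power F (G\<lparr>carrier := T\<rparr>) k"
  by (rule algebra_hom_augmentation_power[OF finite_algebras projection_hom projection_augmentation])

lemma inclusion_central:
  assumes "T \<subseteq> center G" and x: "x \<in> carrier (group_algebra F (G\<lparr>carrier := T\<rparr>))"
  shows "A.central (inclusion F G T x)"
  unfolding A.central_def
proof (intro conjI ballI)
  interpret L: p_group_algebra F "G\<lparr>carrier := T\<rparr>" p by (rule left_algebra)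
  show "inclusion F G T x \<in> carrier A.A" using algebra_homD(1)[OF inclusion_hom x] .
  fix f assume f: "f \<in> carrier A.A"
  have comm: "A.\<delta> t \<otimes>\<^bsub>A.A\<^esub> f = f \<otimes>\<^bsub>A.A\<^esub> A.\<delta> t" if t: "t \<in> T" for t
  proof (rule A.elem_eqI)
    fix g assume g: "g \<in> carrier G"
    interpret C: subgroup "center G" G by (rule center_subgroup) (rule A.G.group_axioms)
    have "inv\<^bsub>G\<^esub> t \<in> center G" using t assms(1) by blast
    then have "inv\<^bsub>G\<^esub> t \<otimes>\<^bsub>G\<^esub> g = g \<otimes>\<^bsub>G\<^esub> inv\<^bsub>G\<^esub> t" using g unfolding center_def by blast
    then show "(A.\<delta> t \<otimes>\<^bsub>A.A\<^esub> f) g = (f \<otimes>\<^bsub>A.A\<^esub> A.\<delta> t) g"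
      using t f g by (simp add: A.basis_mult_apply A.mult_basis_apply)
  qed (use f in auto)
  have xT: "x t \<in> carrier F" if "t \<in> T" for t using L.elem_closed[OF x] that by simp
  have eq: "inclusion F G T x = (\<Oplus>\<^bsub>A.A\<^esub>t\<in>T. x t \<odot>\<^bsub>A.A\<^esub> A.\<delta> t)"
    by (simp add: inclusion_def group_map_def linear_extension_def)
  have fin: "finite T" using T.subset A.finite_G by (rule finite_subset)
  have "inclusion F G T x \<otimes>\<^bsub>A.A\<^esub> f = (\<Oplus>\<^bsub>A.A\<^esub>t\<in>T. (x t \<odot>\<^bsub>A.A\<^esub> A.\<delta> t) \<otimes>\<^bsub>A.A\<^esub> f)"
    unfolding eq using f fin xT by (intro A.A.finsum_ldistr) auto
  also have "\<dots> = (\<Oplus>\<^bsub>A.A\<^esub>t\<in>T. f \<otimes>\<^bsub>A.A\<^esub> (x t \<odot>\<^bsub>A.A\<^esub> A.\<delta> t))"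
    using f xT by (intro A.A.finsum_cong')
      (auto simp: A.Alg.smult_mult_left A.Alg.smult_mult_right comm)
  also have "\<dots> = f \<otimes>\<^bsub>A.A\<^esub> inclusion F G T x"
    unfolding eq using f fin xT by (intro A.A.finsum_rdistr[symmetric]) auto
  finally show "inclusion F G T x \<otimes>\<^bsub>A.A\<^esub> f = f \<otimes>\<^bsub>A.A\<^esub> inclusion F G T x" .
qed

text \<open>By linearity it suffices to treat \<open>x = t u - 1\<close>, which is congruent to \<open>(t - 1) + (u - 1)\<close>.\<close>

lemma linear_split:
  assumes x: "x \<in> A.I"
  shows "x \<ominus>\<^bsub>A.A\<^esub> (inclusion F G T (projection F G T U x) \<oplus>\<^bsub>A.A\<^esub>
    inclusion F G U (projection F G U T x)) \<in> A.P 2"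
proof -
  interpret R: p_group_product F G p U T by (rule swap)
  interpret \<pi>: ring_hom_ring A.A A.square_quotient A.residue_class by (rule A.residue_ring_hom)
  let ?E = "\<lambda>x. inclusion F G T (projection F G T U x)"
  let ?E' = "\<lambda>x. inclusion F G U (projection F G U T x)"
  have E: "?E \<in> algebra_hom F A.A A.A" "?E' \<in> algebra_hom F A.A A.A"
    by (rule algebra_hom_compose[OF projection_hom inclusion_hom]
      algebra_hom_compose[OF R.projection_hom R.inclusion_hom])+
  note Ec = algebra_homD(1)[OF E(1)] algebra_homD(1)[OF E(2)]
  let ?r = "A.residue_class" and ?Q = "A.square_quotient"
  have x': "x \<in> carrier A.A" "A.\<epsilon> x = \<zero>\<^bsub>F\<^esub>" using x by (auto simp: augmentation_ideal_def)
  have r_hom: "?r (h x) = (\<Oplus>\<^bsub>?Q\<^esub>g\<in>carrier G. ?r (h (x g \<odot>\<^bsub>A.A\<^esub> (A.\<delta> g \<ominus>\<^bsub>A.A\<^esub> \<one>\<^bsub>A.A\<^esub>))))"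
    if h: "h \<in> algebra_hom F A.A A.A" for h
  proof -
    have "?r (h (\<Oplus>\<^bsub>A.A\<^esub>g\<in>carrier G. x g \<odot>\<^bsub>A.A\<^esub> (A.\<delta> g \<ominus>\<^bsub>A.A\<^esub> \<one>\<^bsub>A.A\<^esub>)))
        = (\<Oplus>\<^bsub>?Q\<^esub>g\<in>carrier G. ?r (h (x g \<odot>\<^bsub>A.A\<^esub> (A.\<delta> g \<ominus>\<^bsub>A.A\<^esub> \<one>\<^bsub>A.A\<^esub>))))"
      using x' algebra_homD(1)[OF h]
      by (intro additive_finsum[where h = "\<lambda>y. ?r (h y)"])
        (auto simp: algebra_homD(3)[OF h] algebra_hom_minus(2)[OF h A.ring_A A.ring_A x'(1) x'(1)]
          A.A.abelian_monoid_axioms \<pi>.S.abelian_monoid_axioms)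
    then show ?thesis using A.I_expansion[OF x'] by simp
  qed
  have id: "(\<lambda>x. x) \<in> algebra_hom F A.A A.A" by (rule algebra_homI) auto
  have basis_split: "?r (a \<odot>\<^bsub>A.A\<^esub> (A.\<delta> g \<ominus>\<^bsub>A.A\<^esub> \<one>\<^bsub>A.A\<^esub>))
      = ?r (?E (a \<odot>\<^bsub>A.A\<^esub> (A.\<delta> g \<ominus>\<^bsub>A.A\<^esub> \<one>\<^bsub>A.A\<^esub>))) \<oplus>\<^bsub>?Q\<^esub> ?r (?E' (a \<odot>\<^bsub>A.A\<^esub> (A.\<delta> g \<ominus>\<^bsub>A.A\<^esub> \<one>\<^bsub>A.A\<^esub>)))"
    if a: "a \<in> carrier F" and g: "g \<in> carrier G" for a g
  proof -
    have tu: "factor G T U g \<in> carrier G" "factor G U T g \<in> carrier G"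
      using T.mem_carrier[OF factor_closed[OF g]] U.mem_carrier[OF R.factor_closed[OF g]] .
    have smult: "?r (a \<odot>\<^bsub>A.A\<^esub> (A.\<delta> k \<ominus>\<^bsub>A.A\<^esub> \<one>\<^bsub>A.A\<^esub>)) = ?r (a \<odot>\<^bsub>A.A\<^esub> \<one>\<^bsub>A.A\<^esub>) \<otimes>\<^bsub>?Q\<^esub> A.linear_part k" for k
    proof -
      have "a \<odot>\<^bsub>A.A\<^esub> (A.\<delta> k \<ominus>\<^bsub>A.A\<^esub> \<one>\<^bsub>A.A\<^esub>) = (a \<odot>\<^bsub>A.A\<^esub> \<one>\<^bsub>A.A\<^esub>) \<otimes>\<^bsub>A.A\<^esub> (A.\<delta> k \<ominus>\<^bsub>A.A\<^esub> \<one>\<^bsub>A.A\<^esub>)"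
        using a by (simp add: A.Alg.smult_mult_left)
      then show ?thesis using a by (simp add: A.linear_part_def)
    qed
    have Eg: "?E (a \<odot>\<^bsub>A.A\<^esub> (A.\<delta> g \<ominus>\<^bsub>A.A\<^esub> \<one>\<^bsub>A.A\<^esub>)) = a \<odot>\<^bsub>A.A\<^esub> (A.\<delta> (factor G T U g) \<ominus>\<^bsub>A.A\<^esub> \<one>\<^bsub>A.A\<^esub>)"
      using a g factor_closed[OF g] algebra_homD(5)[OF E(1) a, of "A.\<delta> g \<ominus>\<^bsub>A.A\<^esub> \<one>\<^bsub>A.A\<^esub>"]
        algebra_hom_minus(1)[OF E(1) A.ring_A A.ring_A, of "A.\<delta> g" "\<one>\<^bsub>A.A\<^esub>"] algebra_homD(4)[OF E(1)]
      by (simp add: projection_basis inclusion_basis)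
    have E'g: "?E' (a \<odot>\<^bsub>A.A\<^esub> (A.\<delta> g \<ominus>\<^bsub>A.A\<^esub> \<one>\<^bsub>A.A\<^esub>)) = a \<odot>\<^bsub>A.A\<^esub> (A.\<delta> (factor G U T g) \<ominus>\<^bsub>A.A\<^esub> \<one>\<^bsub>A.A\<^esub>)"
      using a g R.factor_closed[OF g] algebra_homD(5)[OF E(2) a, of "A.\<delta> g \<ominus>\<^bsub>A.A\<^esub> \<one>\<^bsub>A.A\<^esub>"]
        algebra_hom_minus(1)[OF E(2) A.ring_A A.ring_A, of "A.\<delta> g" "\<one>\<^bsub>A.A\<^esub>"] algebra_homD(4)[OF E(2)]
      by (simp add: R.projection_basis R.inclusion_basis)
    have "A.linear_part g = A.linear_part (factor G T U g \<otimes>\<^bsub>G\<^esub> factor G U T g)"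
      using factor_decomposition[OF g] by (rule arg_cong)
    also have "\<dots> = A.linear_part (factor G T U g) \<oplus>\<^bsub>?Q\<^esub> A.linear_part (factor G U T g)"
      by (rule A.linear_part_mult[OF tu])
    finally show ?thesis
      unfolding Eg E'g smult
      using a tu A.linear_part_closed by (simp add: \<pi>.S.r_distr)
  qed
  have "?r x = (\<Oplus>\<^bsub>?Q\<^esub>g\<in>carrier G. ?r (x g \<odot>\<^bsub>A.A\<^esub> (A.\<delta> g \<ominus>\<^bsub>A.A\<^esub> \<one>\<^bsub>A.A\<^esub>)))"
    by (rule r_hom[OF id])
  also have "\<dots> = (\<Oplus>\<^bsub>?Q\<^esub>g\<in>carrier G. ?r (?E (x g \<odot>\<^bsub>A.A\<^esub> (A.\<delta> g \<ominus>\<^bsub>A.A\<^esub> \<one>\<^bsub>A.A\<^esub>)))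
      \<oplus>\<^bsub>?Q\<^esub> ?r (?E' (x g \<odot>\<^bsub>A.A\<^esub> (A.\<delta> g \<ominus>\<^bsub>A.A\<^esub> \<one>\<^bsub>A.A\<^esub>))))"
    using x' Ec by (intro \<pi>.S.finsum_cong' refl basis_split) auto
  also have "\<dots> = ?r (?E x) \<oplus>\<^bsub>?Q\<^esub> ?r (?E' x)"
    unfolding r_hom[OF E(1)] r_hom[OF E(2)]
    using x' Ec by (intro \<pi>.S.finsum_addf) auto
  also have "\<dots> = ?r (?E x \<oplus>\<^bsub>A.A\<^esub> ?E' x)" using x' Ec by simp
  finally show ?thesis
    using x' Ec by (subst (asm) A.residue_class_eq_iff) auto
qed

end


section \<open>Isomorphisms of group algebras and elementary abelian factors\<close>

text \<open>Elements of \<open>I(G)\<close> are nilpotent, hence so are their images, and a nilpotent element has nilpotent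
  augmentation in the field, that is zero.\<close>

lemma algebra_hom_preserves_augmentation:
  assumes "p_group_algebra F G p" "p_group_algebra F H p"
    and h: "h \<in> algebra_hom F (group_algebra F G) (group_algebra F H)"
    and x: "x \<in> carrier (group_algebra F G)"
  shows "augmentation F H (h x) = augmentation F G x"
proof -
  interpret G: p_group_algebra F G p by fact
  interpret H: p_group_algebra F H p by fact
  interpret e: ring_hom_ring H.A F H.\<epsilon> by (rule H.augmentation_ring_hom)
  interpret h: ring_hom_ring G.A H.A h by (rule algebra_hom_ring_hom_ring[OF h G.ring_A H.ring_A])
  define y where "y = x \<ominus>\<^bsub>G.A\<^esub> G.\<epsilon> x \<odot>\<^bsub>G.A\<^esub> \<one>\<^bsub>G.A\<^esub>"
  have yI: "y \<in> G.I" unfolding y_def using x by (rule G.minus_augmentation)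
  have yA: "y \<in> carrier G.A" using G.augmentation_ideal_closed[OF yI] .
  obtain n where n: "G.P n = {\<zero>\<^bsub>G.A\<^esub>}" using G.augmentation_ideal_nilpotent by blast
  have "y [^]\<^bsub>G.A\<^esub> k \<in> G.P k" for k
  proof (induction k)
    case (Suc k)
    then show ?case
      using ideal_prod.prod[OF yI Suc, of G.A] G.A.nat_pow_Suc2[OF yA, of k]
      by (simp add: augmentation_power_Suc)
  qed simp
  then have "y [^]\<^bsub>G.A\<^esub> n = \<zero>\<^bsub>G.A\<^esub>" using n by blast
  moreover have "H.\<epsilon> (h (y [^]\<^bsub>G.A\<^esub> k)) = H.\<epsilon> (h y) [^]\<^bsub>F\<^esub> k" for k :: nat
    using yA by (induction k) auto
  ultimately have "H.\<epsilon> (h y) [^]\<^bsub>F\<^esub> n = \<zero>\<^bsub>F\<^esub>" by (metis e.hom_zero h.hom_zero)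
  then have hy: "H.\<epsilon> (h y) = \<zero>\<^bsub>F\<^esub>"
    using yA by (intro G.F.nat_pow_eq_zero[of "H.\<epsilon> (h y)" n]) auto
  have "y \<oplus>\<^bsub>G.A\<^esub> G.\<epsilon> x \<odot>\<^bsub>G.A\<^esub> \<one>\<^bsub>G.A\<^esub> = x"
    unfolding y_def using x by (simp add: G.A.add_minus_cancel)
  then have "h x = h y \<oplus>\<^bsub>H.A\<^esub> G.\<epsilon> x \<odot>\<^bsub>H.A\<^esub> \<one>\<^bsub>H.A\<^esub>"
    using yA x h.hom_add[of y "G.\<epsilon> x \<odot>\<^bsub>G.A\<^esub> \<one>\<^bsub>G.A\<^esub>"] algebra_homD(5)[OF h, of "G.\<epsilon> x" "\<one>\<^bsub>G.A\<^esub>"] by simp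
  then show ?thesis using hy yA x by (simp add: H.augmentation_add H.augmentation_smult)
qed

text \<open>The two homomorphisms need not be inverse to each other: injectivity of \<open>h\<close> comes from \<open>k \<circ> h\<close> and
  surjectivity from \<open>h \<circ> k\<close>.\<close>

lemma algebra_isomorphic_by_bijective_composites:
  assumes h: "h \<in> algebra_hom F A B" and k: "k \<in> algebra_hom F B A"
    and b: "bij_betw (\<lambda>x. k (h x)) (carrier A) (carrier A)"
      "bij_betw (\<lambda>x. h (k x)) (carrier B) (carrier B)"
  shows "algebra_isomorphic F A B"
proof -
  have "inj_on h (carrier A)"
    using b(1) unfolding bij_betw_def inj_on_def by metis
  moreover have "h ` carrier A = carrier B"
  proof
    show "h ` carrier A \<subseteq> carrier B" using algebra_homD(1)[OF h] by blast
    show "carrier B \<subseteq> h ` carrier A"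
    proof
      fix y assume "y \<in> carrier B"
      then obtain z where z: "z \<in> carrier B" "y = h (k z)" using b(2) unfolding bij_betw_def by blast
      then show "y \<in> h ` carrier A" using algebra_homD(1)[OF k] by blast
    qed
  qed
  ultimately show ?thesis
    using h by (auto simp: algebra_isomorphic_def algebra_iso_def algebra_hom_def ring_iso_def bij_betw_def)
qed

locale elementary_product = p_group_product F G p T U
  for F :: "('f, 'm) ring_scheme" and G :: "('a, 'c) monoid_scheme" and p T U +
  assumes decomposition: "elementary_decomposition p G T U"
    and elementary: "elementary_abelian p (G\<lparr>carrier := T\<rparr>)"
begin

lemma T_central: "T \<subseteq> center G"
  using elementary by (intro commutative_factor_central) (simp add: elementary_abelian_def)

text \<open>The hypotheses on \<open>b\<close> survive algebra isomorphisms, whereas \<open>I(T)\<close> itself is not preserved; this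
  lemma recovers \<open>I(T)\<close> modulo \<open>I\<^sup>2\<close> from them.\<close>

lemma central_p_nilpotent:
  assumes b: "A.central b" "b [^]\<^bsub>group_algebra F G\<^esub> p = \<zero>\<^bsub>group_algebra F G\<^esub>"
  obtains y where "y \<in> augmentation_ideal F (G\<lparr>carrier := T\<rparr>)"
    "b \<ominus>\<^bsub>group_algebra F G\<^esub> inclusion F G T y \<in> augmentation_power F G 2"
proof -
  interpret L: p_group_algebra F "G\<lparr>carrier := T\<rparr>" p by (rule left_algebra)
  interpret \<pi>: ring_hom_ring A.A A.square_quotient A.residue_class by (rule A.residue_ring_hom)
  have "\<exists>t\<in>T. A.linear_part z = A.linear_part t" if z: "z \<in> center G" "z [^]\<^bsub>G\<^esub> p = \<one>\<^bsub>G\<^esub>" for z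
  proof -
    obtain t d where td: "t \<in> T" "d \<in> frattini G" "z = t \<otimes>\<^bsub>G\<^esub> d"
      using elementary_decomposition_socle[OF A.prime_p A.G.group_axioms A.finite_G decomposition elementary z] .
    have c: "t \<in> carrier G" "d \<in> carrier G" using td by (auto simp: frattini_def)
    have "A.linear_part z = A.linear_part t"
      unfolding td(3) using A.linear_part_mult[OF c] A.linear_part_frattini[OF td(2)]
        A.linear_part_closed[OF c(1)] by simp
    then show ?thesis using td by blast
  qed
  then obtain \<sigma> where \<sigma>: "\<And>z. z \<in> center G \<Longrightarrow> \<sigma> z \<in> T"
    and b_eq: "b \<ominus>\<^bsub>A.A\<^esub> (\<Oplus>\<^bsub>A.A\<^esub>z\<in>center G. b z \<odot>\<^bsub>A.A\<^esub> (A.\<delta> (\<sigma> z) \<ominus>\<^bsub>A.A\<^esub> \<one>\<^bsub>A.A\<^esub>)) \<in> A.P 2"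
    using A.central_linear_part[OF b T.subset] by blast
  have bF: "b z \<in> carrier F" if "z \<in> center G" for z
    using A.elem_closed[OF A.central_closed[OF b(1)], of z] that by (simp add: center_def)
  define y where "y = (\<Oplus>\<^bsub>L.A\<^esub>z\<in>center G. b z \<odot>\<^bsub>L.A\<^esub> (L.\<delta> (\<sigma> z) \<ominus>\<^bsub>L.A\<^esub> \<one>\<^bsub>L.A\<^esub>))"
  have "y \<in> L.I"
    unfolding y_def
  proof (rule L.A.finsum_in_subgroup[OF ideal.axioms(1)[OF L.ideal_I]])
    fix z assume z: "z \<in> center G"
    have "L.\<epsilon> (L.\<delta> (\<sigma> z) \<ominus>\<^bsub>L.A\<^esub> \<one>\<^bsub>L.A\<^esub>) = \<zero>\<^bsub>F\<^esub>"
      using L.basis_minus_one[of "\<sigma> z"] \<sigma>[OF z] by (simp add: augmentation_ideal_def)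
    then show "b z \<odot>\<^bsub>L.A\<^esub> (L.\<delta> (\<sigma> z) \<ominus>\<^bsub>L.A\<^esub> \<one>\<^bsub>L.A\<^esub>) \<in> L.I"
      unfolding augmentation_ideal_def using bF[OF z] by (simp add: L.augmentation_smult)
  qed
  moreover have "inclusion F G T y = (\<Oplus>\<^bsub>A.A\<^esub>z\<in>center G. b z \<odot>\<^bsub>A.A\<^esub> (A.\<delta> (\<sigma> z) \<ominus>\<^bsub>A.A\<^esub> \<one>\<^bsub>A.A\<^esub>))"
  proof -
    note i = inclusion_hom
    have "inclusion F G T y = (\<Oplus>\<^bsub>A.A\<^esub>z\<in>center G. inclusion F G T (b z \<odot>\<^bsub>L.A\<^esub> (L.\<delta> (\<sigma> z) \<ominus>\<^bsub>L.A\<^esub> \<one>\<^bsub>L.A\<^esub>)))"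
      unfolding y_def
      by (intro additive_finsum[where h = "inclusion F G T"] L.A.abelian_monoid_axioms
          A.A.abelian_monoid_axioms algebra_homD(1)[OF i] algebra_homD(3)[OF i]
          algebra_hom_minus(2)[OF i L.ring_A A.ring_A L.A.one_closed L.A.one_closed])
        (auto simp: bF)
    also have "\<dots> = (\<Oplus>\<^bsub>A.A\<^esub>z\<in>center G. b z \<odot>\<^bsub>A.A\<^esub> (A.\<delta> (\<sigma> z) \<ominus>\<^bsub>A.A\<^esub> \<one>\<^bsub>A.A\<^esub>))"
    proof (intro A.A.finsum_cong' refl)
      fix z assume z: "z \<in> center G"
      show "inclusion F G T (b z \<odot>\<^bsub>L.A\<^esub> (L.\<delta> (\<sigma> z) \<ominus>\<^bsub>L.A\<^esub> \<one>\<^bsub>L.A\<^esub>)) = b z \<odot>\<^bsub>A.A\<^esub> (A.\<delta> (\<sigma> z) \<ominus>\<^bsub>A.A\<^esub> \<one>\<^bsub>A.A\<^esub>)"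
        using algebra_homD(5)[OF i bF[OF z], of "L.\<delta> (\<sigma> z) \<ominus>\<^bsub>L.A\<^esub> \<one>\<^bsub>L.A\<^esub>"]
          algebra_hom_minus(1)[OF i L.ring_A A.ring_A, of "L.\<delta> (\<sigma> z)" "\<one>\<^bsub>L.A\<^esub>"]
        by (simp add: algebra_homD(4)[OF i] inclusion_basis[OF \<sigma>[OF z]])
    qed (auto simp: bF)
    finally show ?thesis .
  qed
  ultimately show ?thesis using that b_eq by simp
qed

end

locale elementary_product_iso =
  G: elementary_product F G p T U + H: elementary_product F H p S V
  for F :: "('f, 'm) ring_scheme" and G :: "('a, 'c) monoid_scheme" and p T U
    and H :: "('b, 'd) monoid_scheme" and S V +
  fixes h :: "('a \<Rightarrow> 'f) \<Rightarrow> 'b \<Rightarrow> 'f" and k :: "('b \<Rightarrow> 'f) \<Rightarrow> 'a \<Rightarrow> 'f"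
  assumes h: "h \<in> algebra_hom F (group_algebra F G) (group_algebra F H)"
    and k: "k \<in> algebra_hom F (group_algebra F H) (group_algebra F G)"
    and kh: "\<And>x. x \<in> carrier (group_algebra F G) \<Longrightarrow> k (h x) = x"
    and hk: "\<And>y. y \<in> carrier (group_algebra F H) \<Longrightarrow> h (k y) = y"
begin

lemma inverse: "elementary_product_iso F H p S V G T U k h"
  by (intro elementary_product_iso.intro elementary_product_iso_axioms.intro
    G.elementary_product_axioms H.elementary_product_axioms h k kh hk)

lemma h_augmentation: "x \<in> carrier G.A.A \<Longrightarrow> H.A.\<epsilon> (h x) = G.A.\<epsilon> x"
  by (rule algebra_hom_preserves_augmentation[OF G.A.p_group_algebra_axioms
    H.A.p_group_algebra_axioms h])

lemma h_power: "x \<in> G.A.P n \<Longrightarrow> h x \<in> H.A.P n"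
  by (rule algebra_hom_augmentation_power[OF G.finite_algebras(1) H.finite_algebras(1) h h_augmentation])

lemma h_linear_part:
  assumes x: "x \<in> augmentation_ideal F (G\<lparr>carrier := T\<rparr>)"
  obtains y where "y \<in> augmentation_ideal F (H\<lparr>carrier := S\<rparr>)"
    "h (inclusion F G T x) \<ominus>\<^bsub>H.A.A\<^esub> inclusion F H S y \<in> H.A.P 2"
proof -
  interpret L: p_group_algebra F "G\<lparr>carrier := T\<rparr>" p by (rule G.left_algebra)
  have xA: "x \<in> carrier L.A" using x by (rule L.augmentation_ideal_closed)
  let ?x = "inclusion F G T x"
  have c: "?x \<in> carrier G.A.A" using algebra_homD(1)[OF G.inclusion_hom xA] .
  have hom: "(\<lambda>x. h (inclusion F G T x)) \<in> algebra_hom F L.A H.A.A"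
    by (rule algebra_hom_compose[OF G.inclusion_hom h])
  have "H.A.central (h ?x)"
    unfolding H.A.central_def
  proof (intro conjI ballI)
    show "h ?x \<in> carrier H.A.A" using algebra_homD(1)[OF h c] .
    fix f assume f: "f \<in> carrier H.A.A"
    have kf: "k f \<in> carrier G.A.A" using algebra_homD(1)[OF k f] .
    have "?x \<otimes>\<^bsub>G.A.A\<^esub> k f = k f \<otimes>\<^bsub>G.A.A\<^esub> ?x"
      using G.inclusion_central[OF G.T_central xA] kf unfolding G.A.central_def by blast
    then have "h (?x \<otimes>\<^bsub>G.A.A\<^esub> k f) = h (k f \<otimes>\<^bsub>G.A.A\<^esub> ?x)" by (rule arg_cong)
    then show "h ?x \<otimes>\<^bsub>H.A.A\<^esub> f = f \<otimes>\<^bsub>H.A.A\<^esub> h ?x"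
      unfolding algebra_homD(2)[OF h c kf] algebra_homD(2)[OF h kf c] hk[OF f] .
  qed
  moreover have "h ?x [^]\<^bsub>H.A.A\<^esub> p = \<zero>\<^bsub>H.A.A\<^esub>"
  proof -
    have "h (inclusion F G T (x [^]\<^bsub>L.A\<^esub> n)) = h ?x [^]\<^bsub>H.A.A\<^esub> n" for n :: nat
      using xA by (induction n) (auto simp: algebra_homD(2,4)[OF hom])
    moreover have "x [^]\<^bsub>L.A\<^esub> p = \<zero>\<^bsub>L.A\<^esub>" by (rule L.pow_p_eq_zero[OF G.elementary x])
    ultimately show ?thesis
      using algebra_hom_minus(2)[OF hom L.ring_A H.A.ring_A xA xA] by metis
  qed
  ultimately show ?thesis using H.central_p_nilpotent that by blast
qed

text \<open>Let \<open>y \<in> I(S)\<close> be congruent to \<open>h x\<close> modulo \<open>I(H)\<^sup>2\<close>. Projection to \<open>FS\<close> changes \<open>h x\<close> only by an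
  element of \<open>I(H)\<^sup>2\<close>, because it fixes \<open>y\<close>; so \<open>k\<close> maps the result back to \<open>x\<close> modulo \<open>I(G)\<^sup>2\<close>.\<close>

lemma left_unipotent:
  assumes x: "x \<in> augmentation_ideal F (G\<lparr>carrier := T\<rparr>)"
  shows "projection F G T U (k (inclusion F H S (projection F H S V (h (inclusion F G T x)))))
    \<ominus>\<^bsub>group_algebra F (G\<lparr>carrier := T\<rparr>)\<^esub> x \<in> augmentation_power F (G\<lparr>carrier := T\<rparr>) 2"
proof -
  interpret I: elementary_product_iso F H p S V G T U k h by (rule inverse)
  interpret L: p_group_algebra F "G\<lparr>carrier := T\<rparr>" p by (rule G.left_algebra)
  interpret M: p_group_algebra F "H\<lparr>carrier := S\<rparr>" p by (rule H.left_algebra)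
  obtain y where y: "y \<in> M.I" "h (inclusion F G T x) \<ominus>\<^bsub>H.A.A\<^esub> inclusion F H S y \<in> H.A.P 2"
    using x by (rule h_linear_part)
  have xA: "x \<in> carrier L.A" and yA: "y \<in> carrier M.A"
    using x y L.augmentation_ideal_closed M.augmentation_ideal_closed by blast+
  let ?x = "inclusion F G T x" and ?y = "inclusion F H S y"
  let ?s = "projection F H S V (h ?x)"
  have xc: "?x \<in> carrier G.A.A" using algebra_homD(1)[OF G.inclusion_hom xA] .
  have hxc: "h ?x \<in> carrier H.A.A" using algebra_homD(1)[OF h xc] .
  have yc: "?y \<in> carrier H.A.A" using algebra_homD(1)[OF H.inclusion_hom yA] .
  have sc: "?s \<in> carrier M.A" using algebra_homD(1)[OF H.projection_hom hxc] .
  have isc: "inclusion F H S ?s \<in> carrier H.A.A" using algebra_homD(1)[OF H.inclusion_hom sc] .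
  have kc: "k (inclusion F H S ?s) \<in> carrier G.A.A" using algebra_homD(1)[OF k isc] .
  have "projection F H S V (h ?x \<ominus>\<^bsub>H.A.A\<^esub> ?y) \<in> M.P 2"
    using y(2) by (rule H.projection_power)
  then have "?s \<ominus>\<^bsub>M.A\<^esub> y \<in> M.P 2"
    unfolding algebra_hom_minus(1)[OF H.projection_hom H.A.ring_A M.ring_A hxc yc]
      H.projection_inclusion[OF yA] .
  then have "inclusion F H S (?s \<ominus>\<^bsub>M.A\<^esub> y) \<in> H.A.P 2" by (rule H.inclusion_power)
  then have "inclusion F H S ?s \<ominus>\<^bsub>H.A.A\<^esub> ?y \<in> H.A.P 2"
    unfolding algebra_hom_minus(1)[OF H.inclusion_hom M.ring_A H.A.ring_A sc yA] .
  then have "inclusion F H S ?s \<ominus>\<^bsub>H.A.A\<^esub> h ?x \<in> H.A.P 2"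
    by (rule H.A.A.ideal_minus_trans[OF H.A.ideal_P isc yc hxc _
      H.A.A.ideal_minus_sym[OF H.A.ideal_P hxc yc y(2)]])
  then have "k (inclusion F H S ?s \<ominus>\<^bsub>H.A.A\<^esub> h ?x) \<in> G.A.P 2" by (rule I.h_power)
  then have "k (inclusion F H S ?s) \<ominus>\<^bsub>G.A.A\<^esub> ?x \<in> G.A.P 2"
    unfolding algebra_hom_minus(1)[OF k H.A.ring_A G.A.ring_A isc hxc] kh[OF xc] .
  then have "projection F G T U (k (inclusion F H S ?s) \<ominus>\<^bsub>G.A.A\<^esub> ?x) \<in> L.P 2"
    by (rule G.projection_power)
  then show ?thesis
    unfolding algebra_hom_minus(1)[OF G.projection_hom G.A.ring_A L.ring_A kc xc]
      G.projection_inclusion[OF xA] .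
qed

text \<open>Modulo \<open>I(H)\<^sup>2\<close> the element \<open>h x\<close> is the sum of its components \<open>a\<close> in \<open>I(S)\<close> and \<open>b\<close> in \<open>I(V)\<close>, so
  \<open>x\<close> is congruent to \<open>k a + k b\<close>. But \<open>k a\<close> lies in \<open>I(T) + I(G)\<^sup>2\<close> and thus disappears modulo \<open>I(U)\<^sup>2\<close>
  under the projection to \<open>FU\<close>.\<close>

lemma right_unipotent:
  assumes x: "x \<in> augmentation_ideal F (G\<lparr>carrier := U\<rparr>)"
  shows "projection F G U T (k (inclusion F H V (projection F H V S (h (inclusion F G U x)))))
    \<ominus>\<^bsub>group_algebra F (G\<lparr>carrier := U\<rparr>)\<^esub> x \<in> augmentation_power F (G\<lparr>carrier := U\<rparr>) 2"
proof -
  interpret I: elementary_product_iso F H p S V G T U k h by (rule inverse)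
  interpret GU: p_group_product F G p U T by (rule G.swap)
  interpret HV: p_group_product F H p V S by (rule H.swap)
  interpret LT: p_group_algebra F "G\<lparr>carrier := T\<rparr>" p by (rule G.left_algebra)
  interpret L: p_group_algebra F "G\<lparr>carrier := U\<rparr>" p by (rule GU.left_algebra)
  interpret M: p_group_algebra F "H\<lparr>carrier := S\<rparr>" p by (rule H.left_algebra)
  have xA: "x \<in> carrier L.A" and x0: "L.\<epsilon> x = \<zero>\<^bsub>F\<^esub>"
    using x by (auto simp: augmentation_ideal_def)
  let ?x = "inclusion F G U x"
  let ?s = "projection F H S V (h ?x)"
  let ?a = "inclusion F H S ?s" and ?b = "inclusion F H V (projection F H V S (h ?x))"
  have xc: "?x \<in> carrier G.A.A" using algebra_homD(1)[OF GU.inclusion_hom xA] .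
  have hxc: "h ?x \<in> carrier H.A.A" using algebra_homD(1)[OF h xc] .
  have sc: "?s \<in> carrier M.A" using algebra_homD(1)[OF H.projection_hom hxc] .
  have ac: "?a \<in> carrier H.A.A" using algebra_homD(1)[OF H.inclusion_hom sc] .
  have bc: "?b \<in> carrier H.A.A"
    using algebra_homD(1)[OF HV.inclusion_hom algebra_homD(1)[OF HV.projection_hom hxc]] .
  have kac: "k ?a \<in> carrier G.A.A" and kbc: "k ?b \<in> carrier G.A.A"
    using algebra_homD(1)[OF k ac] algebra_homD(1)[OF k bc] .
  have aug: "H.A.\<epsilon> (h ?x) = \<zero>\<^bsub>F\<^esub>"
    using h_augmentation[OF xc] GU.inclusion_augmentation[OF xA] x0 by simp
  then have hxI: "h ?x \<in> H.A.I" using hxc by (simp add: augmentation_ideal_def)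
  have sI: "?s \<in> M.I"
    using sc H.projection_augmentation[OF hxc] aug by (simp add: augmentation_ideal_def)
  let ?pi = "projection F G U T"
  note pi_c = algebra_homD(1)[OF GU.projection_hom]
  note pi_minus = algebra_hom_minus(1)[OF GU.projection_hom G.A.ring_A L.ring_A]
  obtain y where y: "y \<in> LT.I" "k ?a \<ominus>\<^bsub>G.A.A\<^esub> inclusion F G T y \<in> G.A.P 2"
    using sI by (rule I.h_linear_part)
  have yA: "y \<in> carrier LT.A" using y(1) by (rule LT.augmentation_ideal_closed)
  have iyc: "inclusion F G T y \<in> carrier G.A.A" using algebra_homD(1)[OF G.inclusion_hom yA] .
  have "?pi (k ?a \<ominus>\<^bsub>G.A.A\<^esub> inclusion F G T y) \<in> L.P 2" using y(2) by (rule GU.projection_power)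
  then have ka: "?pi (k ?a) \<in> L.P 2"
    unfolding pi_minus[OF kac iyc] GU.projection_other_inclusion[OF y(1)]
    using pi_c[OF kac] by (simp add: L.A.minus_eq)
  have "h ?x \<ominus>\<^bsub>H.A.A\<^esub> (?a \<oplus>\<^bsub>H.A.A\<^esub> ?b) \<in> H.A.P 2" by (rule H.linear_split[OF hxI])
  then have "k (h ?x \<ominus>\<^bsub>H.A.A\<^esub> (?a \<oplus>\<^bsub>H.A.A\<^esub> ?b)) \<in> G.A.P 2" by (rule I.h_power)
  then have "?x \<ominus>\<^bsub>G.A.A\<^esub> (k ?a \<oplus>\<^bsub>G.A.A\<^esub> k ?b) \<in> G.A.P 2"
    unfolding algebra_hom_minus(1)[OF k H.A.ring_A G.A.ring_A hxc H.A.A.a_closed[OF ac bc]]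
      algebra_homD(3)[OF k ac bc] kh[OF xc] .
  then have "?pi (?x \<ominus>\<^bsub>G.A.A\<^esub> (k ?a \<oplus>\<^bsub>G.A.A\<^esub> k ?b)) \<in> L.P 2" by (rule GU.projection_power)
  then have "x \<ominus>\<^bsub>L.A\<^esub> (?pi (k ?a) \<oplus>\<^bsub>L.A\<^esub> ?pi (k ?b)) \<in> L.P 2"
    unfolding pi_minus[OF xc G.A.A.a_closed[OF kac kbc]] algebra_homD(3)[OF GU.projection_hom kac kbc]
      GU.projection_inclusion[OF xA] .
  then have "(x \<ominus>\<^bsub>L.A\<^esub> (?pi (k ?a) \<oplus>\<^bsub>L.A\<^esub> ?pi (k ?b))) \<oplus>\<^bsub>L.A\<^esub> ?pi (k ?a) \<in> L.P 2"
    using ka by (rule L.P_add)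
  moreover have "(x \<ominus>\<^bsub>L.A\<^esub> (?pi (k ?a) \<oplus>\<^bsub>L.A\<^esub> ?pi (k ?b))) \<oplus>\<^bsub>L.A\<^esub> ?pi (k ?a) = x \<ominus>\<^bsub>L.A\<^esub> ?pi (k ?b)"
  proof -
    have "(x \<ominus>\<^bsub>L.A\<^esub> (a \<oplus>\<^bsub>L.A\<^esub> b)) \<oplus>\<^bsub>L.A\<^esub> a = x \<ominus>\<^bsub>L.A\<^esub> b"
      if "a \<in> carrier L.A" "b \<in> carrier L.A" for a b
    proof -
      have "(x \<ominus>\<^bsub>L.A\<^esub> (a \<oplus>\<^bsub>L.A\<^esub> b)) = (x \<ominus>\<^bsub>L.A\<^esub> b) \<ominus>\<^bsub>L.A\<^esub> a"
        using xA that by (simp add: L.A.minus_eq L.A.minus_add L.A.add.m_ac)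
      then show ?thesis using xA that by (simp add: L.A.add_minus_cancel)
    qed
    then show ?thesis using pi_c[OF kac] pi_c[OF kbc] by blast
  qed
  ultimately have "x \<ominus>\<^bsub>L.A\<^esub> ?pi (k ?b) \<in> L.P 2" by simp
  then show ?thesis by (rule L.A.ideal_minus_sym[OF L.ideal_P xA pi_c[OF kbc]])
qed

lemma left_factors_isomorphic:
  "algebra_isomorphic F (group_algebra F (G\<lparr>carrier := T\<rparr>)) (group_algebra F (H\<lparr>carrier := S\<rparr>))"
proof -
  interpret I: elementary_product_iso F H p S V G T U k h by (rule inverse)
  interpret L: p_group_algebra F "G\<lparr>carrier := T\<rparr>" p by (rule G.left_algebra)
  interpret M: p_group_algebra F "H\<lparr>carrier := S\<rparr>" p by (rule H.left_algebra)
  let ?f = "\<lambda>x. projection F H S V (h (inclusion F G T x))"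
  let ?g = "\<lambda>y. projection F G T U (k (inclusion F H S y))"
  have f: "?f \<in> algebra_hom F L.A M.A"
    by (rule algebra_hom_compose[OF algebra_hom_compose[OF G.inclusion_hom h] H.projection_hom])
  have g: "?g \<in> algebra_hom F M.A L.A"
    by (rule algebra_hom_compose[OF algebra_hom_compose[OF H.inclusion_hom k] G.projection_hom])
  obtain m n where mn: "L.P m = {\<zero>\<^bsub>L.A\<^esub>}" "M.P n = {\<zero>\<^bsub>M.A\<^esub>}"
    using L.augmentation_ideal_nilpotent M.augmentation_ideal_nilpotent by blast
  show ?thesis
  proof (rule algebra_isomorphic_by_bijective_composites[OF f g])
    show "bij_betw (\<lambda>x. ?g (?f x)) (carrier L.A) (carrier L.A)"
      by (rule L.unipotent_bij[OF algebra_hom_compose[OF f g] left_unipotent mn(1)])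
    show "bij_betw (\<lambda>x. ?f (?g x)) (carrier M.A) (carrier M.A)"
      by (rule M.unipotent_bij[OF algebra_hom_compose[OF g f] I.left_unipotent mn(2)])
  qed
qed

lemma right_factors_isomorphic:
  "algebra_isomorphic F (group_algebra F (G\<lparr>carrier := U\<rparr>)) (group_algebra F (H\<lparr>carrier := V\<rparr>))"
proof -
  interpret I: elementary_product_iso F H p S V G T U k h by (rule inverse)
  interpret GU: p_group_product F G p U T by (rule G.swap)
  interpret HV: p_group_product F H p V S by (rule H.swap)
  interpret L: p_group_algebra F "G\<lparr>carrier := U\<rparr>" p by (rule GU.left_algebra)
  interpret M: p_group_algebra F "H\<lparr>carrier := V\<rparr>" p by (rule HV.left_algebra)
  let ?f = "\<lambda>x. projection F H V S (h (inclusion F G U x))"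
  let ?g = "\<lambda>y. projection F G U T (k (inclusion F H V y))"
  have f: "?f \<in> algebra_hom F L.A M.A"
    by (rule algebra_hom_compose[OF algebra_hom_compose[OF GU.inclusion_hom h] HV.projection_hom])
  have g: "?g \<in> algebra_hom F M.A L.A"
    by (rule algebra_hom_compose[OF algebra_hom_compose[OF HV.inclusion_hom k] GU.projection_hom])
  obtain m n where mn: "L.P m = {\<zero>\<^bsub>L.A\<^esub>}" "M.P n = {\<zero>\<^bsub>M.A\<^esub>}"
    using L.augmentation_ideal_nilpotent M.augmentation_ideal_nilpotent by blast
  show ?thesis
  proof (rule algebra_isomorphic_by_bijective_composites[OF f g])
    show "bij_betw (\<lambda>x. ?g (?f x)) (carrier L.A) (carrier L.A)"
      by (rule L.unipotent_bij[OF algebra_hom_compose[OF f g] right_unipotent mn(1)])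
    show "bij_betw (\<lambda>x. ?f (?g x)) (carrier M.A) (carrier M.A)"
      by (rule M.unipotent_bij[OF algebra_hom_compose[OF g f] I.right_unipotent mn(2)])
  qed
qed

end


section \<open>Isomorphisms assembled from the factors\<close>

definition product_map ::
    "('f, 'm) ring_scheme \<Rightarrow> ('a, 'c) monoid_scheme \<Rightarrow> 'a set \<Rightarrow> 'a set \<Rightarrow>
     ('b, 'd) monoid_scheme \<Rightarrow> 'b set \<Rightarrow> 'b set \<Rightarrow>
     (('a \<Rightarrow> 'f) \<Rightarrow> 'b \<Rightarrow> 'f) \<Rightarrow> (('a \<Rightarrow> 'f) \<Rightarrow> 'b \<Rightarrow> 'f) \<Rightarrow> ('a \<Rightarrow> 'f) \<Rightarrow> 'b \<Rightarrow> 'f" where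
  "product_map F G T U H S V f f' = linear_extension G (group_algebra F H)
     (\<lambda>g. inclusion F H S (f (basis F (G\<lparr>carrier := T\<rparr>) (factor G T U g)))
       \<otimes>\<^bsub>group_algebra F H\<^esub>
       inclusion F H V (f' (basis F (G\<lparr>carrier := U\<rparr>) (factor G U T g))))"

text \<open>Centrality of \<open>S\<close> makes the image of \<open>FT\<close> commute with the image of \<open>FU\<close>, so that
  \<open>t u \<mapsto> f(t) f'(u)\<close> is multiplicative.\<close>

lemma product_map_props:
  assumes "p_group_product F G p T U" "p_group_product F H p S V" and S: "S \<subseteq> center H"
    and f: "f \<in> algebra_hom F (group_algebra F (G\<lparr>carrier := T\<rparr>)) (group_algebra F (H\<lparr>carrier := S\<rparr>))"
    and f': "f' \<in> algebra_hom F (group_algebra F (G\<lparr>carrier := U\<rparr>)) (group_algebra F (H\<lparr>carrier := V\<rparr>))"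
  defines "\<Theta> \<equiv> product_map F G T U H S V f f'"
  shows product_map_hom: "\<Theta> \<in> algebra_hom F (group_algebra F G) (group_algebra F H)"
    and product_map_left: "\<And>x. x \<in> carrier (group_algebra F (G\<lparr>carrier := T\<rparr>)) \<Longrightarrow>
      \<Theta> (inclusion F G T x) = inclusion F H S (f x)"
    and product_map_right: "\<And>x. x \<in> carrier (group_algebra F (G\<lparr>carrier := U\<rparr>)) \<Longrightarrow>
      \<Theta> (inclusion F G U x) = inclusion F H V (f' x)"
    and product_map_basis: "\<And>g. g \<in> carrier G \<Longrightarrow> \<Theta> (basis F G g) =
       inclusion F H S (f (basis F (G\<lparr>carrier := T\<rparr>) (factor G T U g)))
       \<otimes>\<^bsub>group_algebra F H\<^esub> inclusion F H V (f' (basis F (G\<lparr>carrier := U\<rparr>) (factor G U T g)))"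
proof -
  interpret G: p_group_product F G p T U by fact
  interpret H: p_group_product F H p S V by fact
  interpret GU: p_group_product F G p U T by (rule G.swap)
  interpret HV: p_group_product F H p V S by (rule H.swap)
  interpret LT: p_group_algebra F "G\<lparr>carrier := T\<rparr>" p by (rule G.left_algebra)
  interpret LU: p_group_algebra F "G\<lparr>carrier := U\<rparr>" p by (rule GU.left_algebra)
  interpret MS: p_group_algebra F "H\<lparr>carrier := S\<rparr>" p by (rule H.left_algebra)
  interpret MV: p_group_algebra F "H\<lparr>carrier := V\<rparr>" p by (rule HV.left_algebra)
  have a: "(\<lambda>x. inclusion F H S (f x)) \<in> algebra_hom F LT.A H.A.A"
    by (rule algebra_hom_compose[OF f H.inclusion_hom])
  have b: "(\<lambda>x. inclusion F H V (f' x)) \<in> algebra_hom F LU.A H.A.A"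
    by (rule algebra_hom_compose[OF f' HV.inclusion_hom])
  define \<alpha> where "\<alpha> g = inclusion F H S (f (LT.\<delta> (factor G T U g)))" for g
  define \<beta> where "\<beta> g = inclusion F H V (f' (LU.\<delta> (factor G U T g)))" for g
  have \<alpha>c: "\<alpha> g \<in> carrier H.A.A" for g unfolding \<alpha>_def using algebra_homD(1)[OF a LT.basis_closed] .
  have \<beta>c: "\<beta> g \<in> carrier H.A.A" for g unfolding \<beta>_def using algebra_homD(1)[OF b LU.basis_closed] .
  have \<alpha>_central: "\<alpha> g \<otimes>\<^bsub>H.A.A\<^esub> y = y \<otimes>\<^bsub>H.A.A\<^esub> \<alpha> g" if "y \<in> carrier H.A.A" for g y
    using H.inclusion_central[OF S algebra_homD(1)[OF f LT.basis_closed]] that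
    unfolding \<alpha>_def H.A.central_def by blast
  have \<alpha>_mult: "\<alpha> (g \<otimes>\<^bsub>G\<^esub> h) = \<alpha> g \<otimes>\<^bsub>H.A.A\<^esub> \<alpha> h" if "g \<in> carrier G" "h \<in> carrier G" for g h
  proof -
    have "factor G T U (g \<otimes>\<^bsub>G\<^esub> h) = factor G T U g \<otimes>\<^bsub>G\<^esub> factor G T U h"
      using hom_mult[OF G.factor_hom that] by simp
    then have "LT.\<delta> (factor G T U (g \<otimes>\<^bsub>G\<^esub> h)) = LT.\<delta> (factor G T U g) \<otimes>\<^bsub>LT.A\<^esub> LT.\<delta> (factor G T U h)"
      using G.factor_closed that by (simp add: LT.basis_mult)
    then show ?thesis unfolding \<alpha>_def by (simp only: algebra_homD(2)[OF a] LT.basis_closed)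
  qed
  have \<beta>_mult: "\<beta> (g \<otimes>\<^bsub>G\<^esub> h) = \<beta> g \<otimes>\<^bsub>H.A.A\<^esub> \<beta> h" if "g \<in> carrier G" "h \<in> carrier G" for g h
  proof -
    have "factor G U T (g \<otimes>\<^bsub>G\<^esub> h) = factor G U T g \<otimes>\<^bsub>G\<^esub> factor G U T h"
      using hom_mult[OF GU.factor_hom that] by simp
    then have "LU.\<delta> (factor G U T (g \<otimes>\<^bsub>G\<^esub> h)) = LU.\<delta> (factor G U T g) \<otimes>\<^bsub>LU.A\<^esub> LU.\<delta> (factor G U T h)"
      using GU.factor_closed that by (simp add: LU.basis_mult)
    then show ?thesis unfolding \<beta>_def by (simp only: algebra_homD(2)[OF b] LU.basis_closed)
  qed
  have \<alpha>_one: "\<alpha> u = \<one>\<^bsub>H.A.A\<^esub>" if "u \<in> U" for u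
    using algebra_homD(4)[OF a] G.factor_right[OF that] by (simp add: \<alpha>_def LT.one_eq_basis)
  have \<beta>_one: "\<beta> t = \<one>\<^bsub>H.A.A\<^esub>" if "t \<in> T" for t
    using algebra_homD(4)[OF b] GU.factor_right[OF that] by (simp add: \<beta>_def LU.one_eq_basis)
  have \<Theta>: "\<Theta> = linear_extension G H.A.A (\<lambda>g. \<alpha> g \<otimes>\<^bsub>H.A.A\<^esub> \<beta> g)"
    unfolding \<Theta>_def product_map_def \<alpha>_def \<beta>_def ..
  show hom: "\<Theta> \<in> algebra_hom F G.A.A H.A.A"
    unfolding \<Theta>
  proof (rule G.A.linear_extension_algebra_hom[OF H.A.Alg.unital_algebra_axioms])
    show "\<alpha> g \<otimes>\<^bsub>H.A.A\<^esub> \<beta> g \<in> carrier H.A.A" for g using \<alpha>c \<beta>c by simp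
    show "\<alpha> \<one>\<^bsub>G\<^esub> \<otimes>\<^bsub>H.A.A\<^esub> \<beta> \<one>\<^bsub>G\<^esub> = \<one>\<^bsub>H.A.A\<^esub>" by (simp add: \<alpha>_one \<beta>_one)
    fix g h assume gh: "g \<in> carrier G" "h \<in> carrier G"
    have "\<alpha> (g \<otimes>\<^bsub>G\<^esub> h) \<otimes>\<^bsub>H.A.A\<^esub> \<beta> (g \<otimes>\<^bsub>G\<^esub> h) = \<alpha> g \<otimes>\<^bsub>H.A.A\<^esub> (\<alpha> h \<otimes>\<^bsub>H.A.A\<^esub> \<beta> g) \<otimes>\<^bsub>H.A.A\<^esub> \<beta> h"
      using \<alpha>c \<beta>c gh by (simp add: \<alpha>_mult \<beta>_mult H.A.A.m_assoc)
    also have "\<alpha> h \<otimes>\<^bsub>H.A.A\<^esub> \<beta> g = \<beta> g \<otimes>\<^bsub>H.A.A\<^esub> \<alpha> h" by (rule \<alpha>_central[OF \<beta>c])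
    finally show "\<alpha> (g \<otimes>\<^bsub>G\<^esub> h) \<otimes>\<^bsub>H.A.A\<^esub> \<beta> (g \<otimes>\<^bsub>G\<^esub> h)
        = (\<alpha> g \<otimes>\<^bsub>H.A.A\<^esub> \<beta> g) \<otimes>\<^bsub>H.A.A\<^esub> (\<alpha> h \<otimes>\<^bsub>H.A.A\<^esub> \<beta> h)"
      using \<alpha>c \<beta>c by (simp add: H.A.A.m_assoc)
  qed
  have basis: "\<Theta> (G.A.\<delta> g) = \<alpha> g \<otimes>\<^bsub>H.A.A\<^esub> \<beta> g" if "g \<in> carrier G" for g
    unfolding \<Theta> using that \<alpha>c \<beta>c
    by (intro G.A.linear_extension_basis[OF H.A.Alg.unital_algebra_axioms]) auto
  then show "\<Theta> (G.A.\<delta> g) = inclusion F H S (f (LT.\<delta> (factor G T U g))) \<otimes>\<^bsub>H.A.A\<^esub>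
      inclusion F H V (f' (LU.\<delta> (factor G U T g)))" if "g \<in> carrier G" for g
    using that unfolding \<alpha>_def \<beta>_def .
  show "\<Theta> (inclusion F G T x) = inclusion F H S (f x)" if x: "x \<in> carrier LT.A" for x
  proof (rule LT.algebra_hom_eqI[OF algebra_hom_compose[OF G.inclusion_hom hom] a
      H.A.Alg.unital_algebra_axioms _ x])
    fix t assume "t \<in> carrier (G\<lparr>carrier := T\<rparr>)"
    then have t: "t \<in> T" by simp
    have "\<Theta> (inclusion F G T (LT.\<delta> t)) = \<alpha> t \<otimes>\<^bsub>H.A.A\<^esub> \<beta> t"
      unfolding G.inclusion_basis[OF t] by (rule basis[OF G.T.mem_carrier[OF t]])
    also have "\<dots> = \<alpha> t" using \<alpha>c \<beta>_one[OF t] by simp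
    also have "\<dots> = inclusion F H S (f (LT.\<delta> t))" unfolding \<alpha>_def G.factor_left[OF t] ..
    finally show "\<Theta> (inclusion F G T (LT.\<delta> t)) = inclusion F H S (f (LT.\<delta> t))" .
  qed
  show "\<Theta> (inclusion F G U x) = inclusion F H V (f' x)" if x: "x \<in> carrier LU.A" for x
  proof (rule LU.algebra_hom_eqI[OF algebra_hom_compose[OF GU.inclusion_hom hom] b
      H.A.Alg.unital_algebra_axioms _ x])
    fix u assume "u \<in> carrier (G\<lparr>carrier := U\<rparr>)"
    then have u: "u \<in> U" by simp
    have "\<Theta> (inclusion F G U (LU.\<delta> u)) = \<alpha> u \<otimes>\<^bsub>H.A.A\<^esub> \<beta> u"
      unfolding GU.inclusion_basis[OF u] by (rule basis[OF G.U.mem_carrier[OF u]])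
    also have "\<dots> = \<beta> u" using \<beta>c \<alpha>_one[OF u] by simp
    also have "\<dots> = inclusion F H V (f' (LU.\<delta> u))" unfolding \<beta>_def GU.factor_left[OF u] ..
    finally show "\<Theta> (inclusion F G U (LU.\<delta> u)) = inclusion F H V (f' (LU.\<delta> u))" .
  qed
qed

lemma product_map_inverse:
  assumes G: "p_group_product F G p T U" and H: "p_group_product F H p S V"
    and T: "T \<subseteq> center G" and S: "S \<subseteq> center H"
    and f: "f \<in> algebra_hom F (group_algebra F (G\<lparr>carrier := T\<rparr>)) (group_algebra F (H\<lparr>carrier := S\<rparr>))"
    and f': "f' \<in> algebra_hom F (group_algebra F (G\<lparr>carrier := U\<rparr>)) (group_algebra F (H\<lparr>carrier := V\<rparr>))"
    and e: "e \<in> algebra_hom F (group_algebra F (H\<lparr>carrier := S\<rparr>)) (group_algebra F (G\<lparr>carrier := T\<rparr>))"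
    and e': "e' \<in> algebra_hom F (group_algebra F (H\<lparr>carrier := V\<rparr>)) (group_algebra F (G\<lparr>carrier := U\<rparr>))"
    and ef: "\<And>x. x \<in> carrier (group_algebra F (G\<lparr>carrier := T\<rparr>)) \<Longrightarrow> e (f x) = x"
    and ef': "\<And>x. x \<in> carrier (group_algebra F (G\<lparr>carrier := U\<rparr>)) \<Longrightarrow> e' (f' x) = x"
    and x: "x \<in> carrier (group_algebra F G)"
  shows "product_map F H S V G T U e e' (product_map F G T U H S V f f' x) = x"
proof -
  interpret G: p_group_product F G p T U by fact
  interpret H: p_group_product F H p S V by fact
  interpret GU: p_group_product F G p U T by (rule G.swap)
  interpret HV: p_group_product F H p V S by (rule H.swap)
  interpret LT: p_group_algebra F "G\<lparr>carrier := T\<rparr>" p by (rule G.left_algebra)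
  interpret LU: p_group_algebra F "G\<lparr>carrier := U\<rparr>" p by (rule GU.left_algebra)
  let ?f = "product_map F G T U H S V f f'" and ?e = "product_map F H S V G T U e e'"
  note ef_hom = product_map_hom[OF G H S f f'] product_map_hom[OF H G T e e']
  show ?thesis
  proof (rule G.A.algebra_hom_eqI[OF algebra_hom_compose[OF ef_hom] _ G.A.Alg.unital_algebra_axioms _ x])
    show "(\<lambda>x. x) \<in> algebra_hom F G.A.A G.A.A" by (rule algebra_homI) auto
    fix g assume g: "g \<in> carrier G"
    let ?t = "factor G T U g" and ?u = "factor G U T g"
    let ?a = "LT.\<delta> ?t" and ?b = "LU.\<delta> ?u"
    have fa: "f ?a \<in> carrier (group_algebra F (H\<lparr>carrier := S\<rparr>))"
      and fb: "f' ?b \<in> carrier (group_algebra F (H\<lparr>carrier := V\<rparr>))"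
      using algebra_homD(1)[OF f LT.basis_closed] algebra_homD(1)[OF f' LU.basis_closed] .
    have "?e (?f (G.A.\<delta> g)) = ?e (inclusion F H S (f ?a) \<otimes>\<^bsub>H.A.A\<^esub> inclusion F H V (f' ?b))"
      unfolding product_map_basis[OF G H S f f' g] ..
    also have "\<dots> = ?e (inclusion F H S (f ?a)) \<otimes>\<^bsub>G.A.A\<^esub> ?e (inclusion F H V (f' ?b))"
      by (rule algebra_homD(2)[OF ef_hom(2) algebra_homD(1)[OF H.inclusion_hom fa]
        algebra_homD(1)[OF HV.inclusion_hom fb]])
    also have "\<dots> = inclusion F G T ?a \<otimes>\<^bsub>G.A.A\<^esub> inclusion F G U ?b"
      unfolding product_map_left[OF H G T e e' fa] product_map_right[OF H G T e e' fb]
        ef[OF LT.basis_closed] ef'[OF LU.basis_closed] ..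
    also have "\<dots> = G.A.\<delta> ?t \<otimes>\<^bsub>G.A.A\<^esub> G.A.\<delta> ?u"
      unfolding G.inclusion_basis[OF G.factor_closed[OF g]] GU.inclusion_basis[OF GU.factor_closed[OF g]] ..
    also have "\<dots> = G.A.\<delta> (?t \<otimes>\<^bsub>G\<^esub> ?u)"
      by (rule G.A.basis_mult[OF G.T.mem_carrier[OF G.factor_closed[OF g]]
        G.U.mem_carrier[OF GU.factor_closed[OF g]]])
    also have "\<dots> = G.A.\<delta> g" using arg_cong[OF G.factor_decomposition[OF g], of G.A.\<delta>] by simp
    finally show "?e (?f (G.A.\<delta> g)) = G.A.\<delta> g" .
  qed
qed

theorem theorem4p1:
  fixes p :: nat
    and F :: "('f, 'm) ring_scheme"
    and G :: "('a, 'c) monoid_scheme" and T U :: "'a set"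
    and H :: "('b, 'd) monoid_scheme" and S V :: "'b set"
  assumes "Factorial_Ring.prime p"
    and "field F" and "ring_char F = p"
    and "finite_p_group p G" and "finite_p_group p H"
    and "elementary_decomposition p G T U"
    and "elementary_decomposition p H S V"
    and "elementary_abelian p (G\<lparr>carrier := T\<rparr>)"
    and "elementary_abelian p (H\<lparr>carrier := S\<rparr>)"
  shows "algebra_isomorphic F (group_algebra F G) (group_algebra F H) \<longleftrightarrow>
    algebra_isomorphic F (group_algebra F (G\<lparr>carrier := T\<rparr>))
      (group_algebra F (H\<lparr>carrier := S\<rparr>)) \<and>
    algebra_isomorphic F (group_algebra F (G\<lparr>carrier := U\<rparr>))
      (group_algebra F (H\<lparr>carrier := V\<rparr>))"
proof -
  have elementary_productI: "elementary_product F K p M N"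
    if "finite_p_group p K" "elementary_decomposition p K M N" "elementary_abelian p (K\<lparr>carrier := M\<rparr>)"
    for K :: "('x, 'y) monoid_scheme" and M N
    using that assms(1-3)
    by (intro elementary_product.intro elementary_product_axioms.intro p_group_product.intro
        direct_product.intro direct_product_axioms.intro p_group_algebraI)
      (auto simp: finite_p_group_def elementary_decomposition_def)
  interpret G: elementary_product F G p T U by (rule elementary_productI[OF assms(4,6,8)])
  interpret H: elementary_product F H p S V by (rule elementary_productI[OF assms(5,7,9)])
  interpret GU: p_group_product F G p U T by (rule G.swap)
  interpret HV: p_group_product F H p V S by (rule H.swap)
  interpret LT: p_group_algebra F "G\<lparr>carrier := T\<rparr>" p by (rule G.left_algebra)
  interpret LU: p_group_algebra F "G\<lparr>carrier := U\<rparr>" p by (rule GU.left_algebra)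
  interpret MS: p_group_algebra F "H\<lparr>carrier := S\<rparr>" p by (rule H.left_algebra)
  interpret MV: p_group_algebra F "H\<lparr>carrier := V\<rparr>" p by (rule HV.left_algebra)
  show ?thesis
  proof
    assume "algebra_isomorphic F G.A.A H.A.A"
    then obtain h k where "h \<in> algebra_hom F G.A.A H.A.A" "k \<in> algebra_hom F H.A.A G.A.A"
      "\<And>x. x \<in> carrier G.A.A \<Longrightarrow> k (h x) = x" "\<And>y. y \<in> carrier H.A.A \<Longrightarrow> h (k y) = y"
      by (rule algebra_isomorphicE[OF _ G.A.Alg.unital_algebra_axioms H.A.Alg.unital_algebra_axioms]) blast
    then interpret elementary_product_iso F G p T U H S V h k
      by unfold_locales
    show "algebra_isomorphic F LT.A MS.A \<and> algebra_isomorphic F LU.A MV.A"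
      using left_factors_isomorphic right_factors_isomorphic ..
  next
    assume iso: "algebra_isomorphic F LT.A MS.A \<and> algebra_isomorphic F LU.A MV.A"
    obtain f e where f: "f \<in> algebra_hom F LT.A MS.A" and e: "e \<in> algebra_hom F MS.A LT.A"
      and ef: "\<And>x. x \<in> carrier LT.A \<Longrightarrow> e (f x) = x" and fe: "\<And>y. y \<in> carrier MS.A \<Longrightarrow> f (e y) = y"
      using conjunct1[OF iso]
      by (rule algebra_isomorphicE[OF _ LT.Alg.unital_algebra_axioms MS.Alg.unital_algebra_axioms]) blast
    obtain f' e' where f': "f' \<in> algebra_hom F LU.A MV.A" and e': "e' \<in> algebra_hom F MV.A LU.A"
      and ef': "\<And>x. x \<in> carrier LU.A \<Longrightarrow> e' (f' x) = x" and fe': "\<And>y. y \<in> carrier MV.A \<Longrightarrow> f' (e' y) = y"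
      using conjunct2[OF iso]
      by (rule algebra_isomorphicE[OF _ LU.Alg.unital_algebra_axioms MV.Alg.unital_algebra_axioms]) blast
    note G = G.p_group_product_axioms and H = H.p_group_product_axioms
    show "algebra_isomorphic F G.A.A H.A.A"
    proof (rule algebra_isomorphicI)
      show "product_map F G T U H S V f f' \<in> algebra_hom F G.A.A H.A.A"
        by (rule product_map_hom[OF G H H.T_central f f'])
      show "product_map F H S V G T U e e' \<in> carrier H.A.A \<rightarrow> carrier G.A.A"
        using algebra_homD(1)[OF product_map_hom[OF H G G.T_central e e']] by blast
      show "product_map F H S V G T U e e' (product_map F G T U H S V f f' x) = x"
        if "x \<in> carrier G.A.A" for x
        by (rule product_map_inverse[OF G H G.T_central H.T_central f f' e e' ef ef' that])
      show "product_map F G T U H S V f f' (product_map F H S V G T U e e' y) = y"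
        if "y \<in> carrier H.A.A" for y
        by (rule product_map_inverse[OF H G H.T_central G.T_central e e' f f' fe fe' that])
    qed
  qed
qed

end
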